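(* Let $p:\mathcal{B}\to G$ be a separable, saturated Fell bundle over a second countable, locally compact Hausdorff groupoid $G$ with a Haar system, and let $P\in\operatorname{Prim}A$, where $A=\Gamma_0(G^{(0)};\mathcal{B})$ is the associated $C^*$-algebra. Suppose that $P$ is locally closed in $\operatorname{Prim}A$ and that $L$ is an irreducible representation of $C^*(G_P,\mathcal{B})$ which is the integrated form of the strongly continuous map $\pi:\mathcal{B}|_{G_P}\to B(\mathcal{V})$ such that $\ker\pi|_{A(u)}=P$, where $u=\sigma_A(P)$. Then $\pi|_{A(u)}$ is a homogeneous representation of $A(u)$.
   Context: **Fell bundles.** A Fell bundle $p:\mathcal{B}\to G$ over a locally compact groupoid $G$ is an upper semicontinuous Banach bundle with fibres $B(x)=p^{-1}(x)$ together with a continuous, bilinear, associative multiplication $B(x)\times B(y)\to B(xy)$ (for composable $x,y$) and a continuous conjugate-linear involution $b\mapsto b^*$, $B(x)\to B(x^{-1})$, with $(ab)^*=b^*a^*$, such that each $B(u)$, $u\in G^{(0)}$, is a $C^*$-algebra and (saturation) each $B(x)$ is a $B(r(x))$–$B(s(x))$-imprimitivity bimodule with actions given by multiplication and left and right inner products $ab^*$ and $a^*b$. Separable means that $\Gamma_0(G;\mathcal{B})$ (continuous sections vanishing at infinity) is separable in the supremum norm and $G$ is second countable. **Algebras over groups.** For a locally compact group $H$ with left Haar measure $\nu$ and modular function $\Delta_H$ (so that $\int f(s^{-1})\Delta_H(s^{-1})\,d\nu(s)=\int f\,d\nu$) and a Fell bundle over $H$, the group is treated as a groupoid: $\Gamma_c(H;\mathcal{B})$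 is a $*$-algebra under $f*g(x)=\int_Hf(y)g(y^{-1}x)\,d\nu(y)$ and $f^*(x)=f(x^{-1})^*$, and $C^*(H,\mathcal{B})$ is its completion in the universal norm $\sup\|L(f)\|$ over $*$-representations $L$ that are norm-decreasing for $\|f\|_I=\max\{\int\|f(s)\|d\nu(s),\int\|f(s^{-1})\|d\nu(s)\}$. Every (nondegenerate) representation $L$ of $C^*(H,\mathcal{B})$ on $\mathcal{V}$ is the integrated form of a strictly continuous, nondegenerate $*$-homomorphism $\pi:\mathcal{B}\to B(\mathcal{V})$ (linear on fibres, multiplicative, $*$-preserving), meaning $L(f)=\int_H\pi(f(s))\Delta_H(s)^{-1/2}\,d\nu(s)$. $C^*(G_P,\mathcal{B})$ means $C^*(G_P,\mathcal{B}|_{G_P})$. **Primitive ideals and stability groups.** $A=\Gamma_0(G^{(0)};\mathcal{B})$ is a $C_0(G^{(0)})$-algebra with fibres $A(u)=B(u)$; let $I(u)$ be the kernel of evaluation $A\to A(u)$. For $P\in\operatorname{Prim}A$ there is a unique $u=\sigma_A(P)\in G^{(0)}$ with $P\supset I(u)$, and $P$ is identified with a primitive ideal of $A(u)$. $G$ acts on $\operatorname{Prim}A$: if $\sigma_A(P)=s(x)$, then $x\cdot P=h_x(P)$, where $h_x$ is the Rieffel correspondence from ideals of $B(s(x))$ to ideals of $B(r(x))$ given by $B(x)$, so that $B(x)\cdot P=(x\cdot P)\cdot B(x)$. The stability group $G_P=\{x\in G:r(x)=s(x)=u,\ x\cdot P=P\}$ is a closed subgroup of $G(u)=\{x\in G:r(x)=s(x)=u\}$.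 **Terminology.** $P$ is locally closed in $\operatorname{Prim}A$ if $\{P\}$ is open in its closure in the hull-kernel topology. A representation $\rho$ of a $C^*$-algebra is homogeneous if every nonzero subrepresentation of $\rho$ has the same kernel as $\rho$. *)

theory Defs
  imports "HOL-Analysis.Analysis"
begin

section \<open>Complex normed spaces, Hilbert spaces and star algebras on carrier sets\<close>

text \<open>
  The spaces needed below (fibres of a bundle, algebras of sections, completions of
  these) depend on parameters, so they are given by records with explicit carriers.
\<close>

record 'a vspace =
  carr :: "'a set"
  vzero :: 'a  ("\<zero>\<index>")
  vadd :: "'a \<Rightarrow> 'a \<Rightarrow> 'a"  (infixl "\<oplus>\<index>" 65)
  vscale :: "complex \<Rightarrow> 'a \<Rightarrow> 'a"  (infixr "\<odot>\<index>" 75)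
  vnorm :: "'a \<Rightarrow> real"  ("\<parallel>_\<parallel>\<index>")

record 'a star_alg = "'a vspace" +
  amult :: "'a \<Rightarrow> 'a \<Rightarrow> 'a"  (infixl "\<otimes>\<index>" 70)
  astar :: "'a \<Rightarrow> 'a"

record 'a ispace = "'a vspace" +
  vinner :: "'a \<Rightarrow> 'a \<Rightarrow> complex"

definition vdist :: "('a, 'm) vspace_scheme \<Rightarrow> 'a \<Rightarrow> 'a \<Rightarrow> real" where
  "vdist X x y = \<parallel>x \<oplus>\<^bsub>X\<^esub> (- 1) \<odot>\<^bsub>X\<^esub> y\<parallel>\<^bsub>X\<^esub>"

definition cauchy_in :: "('a, 'm) vspace_scheme \<Rightarrow> (nat \<Rightarrow> 'a) \<Rightarrow> bool" where
  "cauchy_in X S \<longleftrightarrow> range S \<subseteq> carr X \<and>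
     (\<forall>e>0. \<exists>N. \<forall>m\<ge>N. \<forall>n\<ge>N. vdist X (S m) (S n) < e)"

locale complex_space =
  fixes X :: "('a, 'm) vspace_scheme" (structure)
  assumes zero_closed: "\<zero> \<in> carr X"
    and add_closed: "\<lbrakk>x \<in> carr X; y \<in> carr X\<rbrakk> \<Longrightarrow> x \<oplus> y \<in> carr X"
    and scale_closed: "x \<in> carr X \<Longrightarrow> c \<odot> x \<in> carr X"
    and add_assoc: "\<lbrakk>x \<in> carr X; y \<in> carr X; z \<in> carr X\<rbrakk> \<Longrightarrow> (x \<oplus> y) \<oplus> z = x \<oplus> (y \<oplus> z)"
    and add_commute: "\<lbrakk>x \<in> carr X; y \<in> carr X\<rbrakk> \<Longrightarrow> x \<oplus> y = y \<oplus> x"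
    and zero_add: "x \<in> carr X \<Longrightarrow> \<zero> \<oplus> x = x"
    and scale_zero: "x \<in> carr X \<Longrightarrow> 0 \<odot> x = \<zero>"
    and scale_one: "x \<in> carr X \<Longrightarrow> 1 \<odot> x = x"
    and scale_scale: "x \<in> carr X \<Longrightarrow> c \<odot> (d \<odot> x) = (c * d) \<odot> x"
    and scale_add_left: "x \<in> carr X \<Longrightarrow> (c + d) \<odot> x = c \<odot> x \<oplus> d \<odot> x"
    and scale_add_right: "\<lbrakk>x \<in> carr X; y \<in> carr X\<rbrakk> \<Longrightarrow> c \<odot> (x \<oplus> y) = c \<odot> x \<oplus> c \<odot> y"

locale banach_space = complex_space +
  assumes norm_eq_zero: "x \<in> carr X \<Longrightarrow> \<parallel>x\<parallel> = 0 \<longleftrightarrow> x = \<zero>"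
    and norm_triangle: "\<lbrakk>x \<in> carr X; y \<in> carr X\<rbrakk> \<Longrightarrow> \<parallel>x \<oplus> y\<parallel> \<le> \<parallel>x\<parallel> + \<parallel>y\<parallel>"
    and norm_scale: "x \<in> carr X \<Longrightarrow> \<parallel>c \<odot> x\<parallel> = cmod c * \<parallel>x\<parallel>"
    and complete: "cauchy_in X S \<Longrightarrow> \<exists>l\<in>carr X. (\<lambda>n. vdist X (S n) l) \<longlonglongrightarrow> 0"

locale hilbert_space = banach_space V for V :: "('v, 'm) ispace_scheme" (structure) +
  assumes inner_add: "\<lbrakk>x \<in> carr V; y \<in> carr V; z \<in> carr V\<rbrakk>
      \<Longrightarrow> vinner V (x \<oplus> y) z = vinner V x z + vinner V y z"
    and inner_scale: "\<lbrakk>x \<in> carr V; y \<in> carr V\<rbrakk> \<Longrightarrow> vinner V (c \<odot> x) y = c * vinner V x y"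
    and inner_cnj: "\<lbrakk>x \<in> carr V; y \<in> carr V\<rbrakk> \<Longrightarrow> vinner V y x = cnj (vinner V x y)"
    and inner_norm: "x \<in> carr V \<Longrightarrow> vinner V x x = complex_of_real (\<parallel>x\<parallel>\<^sup>2)"

locale cstar_algebra = banach_space A for A :: "('a, 'm) star_alg_scheme" (structure) +
  assumes mult_closed: "\<lbrakk>a \<in> carr A; b \<in> carr A\<rbrakk> \<Longrightarrow> a \<otimes> b \<in> carr A"
    and star_closed: "a \<in> carr A \<Longrightarrow> astar A a \<in> carr A"
    and mult_assoc: "\<lbrakk>a \<in> carr A; b \<in> carr A; c \<in> carr A\<rbrakk> \<Longrightarrow> (a \<otimes> b) \<otimes> c = a \<otimes> (b \<otimes> c)"
    and mult_add_left: "\<lbrakk>a \<in> carr A; b \<in> carr A; c \<in> carr A\<rbrakk> \<Longrightarrow> (a \<oplus> b) \<otimes> c = a \<otimes> c \<oplus> b \<otimes> c"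
    and mult_add_right: "\<lbrakk>a \<in> carr A; b \<in> carr A; c \<in> carr A\<rbrakk> \<Longrightarrow> a \<otimes> (b \<oplus> c) = a \<otimes> b \<oplus> a \<otimes> c"
    and mult_scale_left: "\<lbrakk>a \<in> carr A; b \<in> carr A\<rbrakk> \<Longrightarrow> (z \<odot> a) \<otimes> b = z \<odot> (a \<otimes> b)"
    and mult_scale_right: "\<lbrakk>a \<in> carr A; b \<in> carr A\<rbrakk> \<Longrightarrow> a \<otimes> (z \<odot> b) = z \<odot> (a \<otimes> b)"
    and star_star: "a \<in> carr A \<Longrightarrow> astar A (astar A a) = a"
    and star_add: "\<lbrakk>a \<in> carr A; b \<in> carr A\<rbrakk> \<Longrightarrow> astar A (a \<oplus> b) = astar A a \<oplus> astar A b"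
    and star_scale: "a \<in> carr A \<Longrightarrow> astar A (z \<odot> a) = cnj z \<odot> astar A a"
    and star_mult: "\<lbrakk>a \<in> carr A; b \<in> carr A\<rbrakk> \<Longrightarrow> astar A (a \<otimes> b) = astar A b \<otimes> astar A a"
    and norm_mult: "\<lbrakk>a \<in> carr A; b \<in> carr A\<rbrakk> \<Longrightarrow> \<parallel>a \<otimes> b\<parallel> \<le> \<parallel>a\<parallel> * \<parallel>b\<parallel>"
    and cstar_identity: "a \<in> carr A \<Longrightarrow> \<parallel>astar A a \<otimes> a\<parallel> = \<parallel>a\<parallel>\<^sup>2"

definition closed_subspace :: "('a, 'm) vspace_scheme \<Rightarrow> 'a set \<Rightarrow> bool" where
  "closed_subspace X W \<longleftrightarrow> W \<subseteq> carr X \<and> \<zero>\<^bsub>X\<^esub> \<in> W \<and>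
     (\<forall>x\<in>W. \<forall>y\<in>W. x \<oplus>\<^bsub>X\<^esub> y \<in> W) \<and> (\<forall>c. \<forall>x\<in>W. c \<odot>\<^bsub>X\<^esub> x \<in> W) \<and>
     (\<forall>S l. range S \<subseteq> W \<and> l \<in> carr X \<and> (\<lambda>n. vdist X (S n) l) \<longlonglongrightarrow> 0 \<longrightarrow> l \<in> W)"

definition closed_span :: "('a, 'm) vspace_scheme \<Rightarrow> 'a set \<Rightarrow> 'a set" where
  "closed_span X S = \<Inter>{W. closed_subspace X W \<and> S \<subseteq> W}"

definition closed_ideal :: "('a, 'm) star_alg_scheme \<Rightarrow> 'a set \<Rightarrow> bool" where
  "closed_ideal A I \<longleftrightarrow> closed_subspace A I \<and>
     (\<forall>a\<in>carr A. \<forall>i\<in>I. a \<otimes>\<^bsub>A\<^esub> i \<in> I \<and> i \<otimes>\<^bsub>A\<^esub> a \<in> I)"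

definition positive_elt :: "('a, 'm) star_alg_scheme \<Rightarrow> 'a \<Rightarrow> bool" where
  "positive_elt A a \<longleftrightarrow> (\<exists>c\<in>carr A. a = astar A c \<otimes>\<^bsub>A\<^esub> c)"

definition bounded_op :: "('v, 'm) vspace_scheme \<Rightarrow> ('v \<Rightarrow> 'v) \<Rightarrow> bool" where
  "bounded_op V T \<longleftrightarrow>
     (\<forall>x\<in>carr V. T x \<in> carr V) \<and>
     (\<forall>x\<in>carr V. \<forall>y\<in>carr V. T (x \<oplus>\<^bsub>V\<^esub> y) = T x \<oplus>\<^bsub>V\<^esub> T y) \<and>
     (\<forall>c. \<forall>x\<in>carr V. T (c \<odot>\<^bsub>V\<^esub> x) = c \<odot>\<^bsub>V\<^esub> T x) \<and>
     (\<exists>M. \<forall>x\<in>carr V. \<parallel>T x\<parallel>\<^bsub>V\<^esub> \<le> M * \<parallel>x\<parallel>\<^bsub>V\<^esub>)"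

definition op_norm :: "('v, 'm) vspace_scheme \<Rightarrow> ('v \<Rightarrow> 'v) \<Rightarrow> real" where
  "op_norm V T = Sup {\<parallel>T x\<parallel>\<^bsub>V\<^esub> | x. x \<in> carr V \<and> \<parallel>x\<parallel>\<^bsub>V\<^esub> \<le> 1}"

definition bounded_functional :: "('a, 'm) vspace_scheme \<Rightarrow> ('a \<Rightarrow> complex) \<Rightarrow> bool" where
  "bounded_functional X \<phi> \<longleftrightarrow>
     (\<forall>x\<in>carr X. \<forall>y\<in>carr X. \<phi> (x \<oplus>\<^bsub>X\<^esub> y) = \<phi> x + \<phi> y) \<and>
     (\<forall>c. \<forall>x\<in>carr X. \<phi> (c \<odot>\<^bsub>X\<^esub> x) = c * \<phi> x) \<and>
     (\<exists>M. \<forall>x\<in>carr X. cmod (\<phi> x) \<le> M * \<parallel>x\<parallel>\<^bsub>X\<^esub>)"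

text \<open>
  The integral of a function with values in a Banach space. It is only applied to
  continuous, compactly supported functions, for which the weak integral exists, is
  unique, and agrees with the Bochner integral.
\<close>

definition vector_integral :: "('a, 'm) vspace_scheme \<Rightarrow> 's measure \<Rightarrow> ('s \<Rightarrow> 'a) \<Rightarrow> 'a" where
  "vector_integral X M F = (THE v. v \<in> carr X \<and>
     (\<forall>\<phi>. bounded_functional X \<phi> \<longrightarrow> has_bochner_integral M (\<lambda>s. \<phi> (F s)) (\<phi> v)))"


section \<open>Representations, primitive ideals, completions\<close>

text \<open>
  Norm-decreasing star homomorphisms into the bounded operators on a Hilbert space.
  For a C*-algebra the inequality is automatic; for convolution algebras normed by
  the I-norm it is the usual requirement.
\<close>

definition representation ::
    "('a, 'm) star_alg_scheme \<Rightarrow> 'v ispace \<Rightarrow> ('a \<Rightarrow> 'v \<Rightarrow> 'v) \<Rightarrow> bool" where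
  "representation A V L \<longleftrightarrow> hilbert_space V \<and>
     (\<forall>a\<in>carr A. bounded_op V (L a) \<and> op_norm V (L a) \<le> \<parallel>a\<parallel>\<^bsub>A\<^esub>) \<and>
     (\<forall>a\<in>carr A. \<forall>b\<in>carr A. \<forall>x\<in>carr V.
        L (a \<oplus>\<^bsub>A\<^esub> b) x = L a x \<oplus>\<^bsub>V\<^esub> L b x \<and> L (a \<otimes>\<^bsub>A\<^esub> b) x = L a (L b x)) \<and>
     (\<forall>c. \<forall>a\<in>carr A. \<forall>x\<in>carr V. L (c \<odot>\<^bsub>A\<^esub> a) x = c \<odot>\<^bsub>V\<^esub> L a x) \<and>
     (\<forall>a\<in>carr A. \<forall>x\<in>carr V. \<forall>y\<in>carr V. vinner V (L a x) y = vinner V x (L (astar A a) y))"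

definition invariant_subspace ::
    "('a, 'm) star_alg_scheme \<Rightarrow> 'v ispace \<Rightarrow> ('a \<Rightarrow> 'v \<Rightarrow> 'v) \<Rightarrow> 'v set \<Rightarrow> bool" where
  "invariant_subspace A V L W \<longleftrightarrow> closed_subspace V W \<and> (\<forall>a\<in>carr A. \<forall>x\<in>W. L a x \<in> W)"

text \<open>The kernel of the restriction of the representation to the subspace W.\<close>

definition kernel_on ::
    "('a, 'm) star_alg_scheme \<Rightarrow> 'v ispace \<Rightarrow> ('a \<Rightarrow> 'v \<Rightarrow> 'v) \<Rightarrow> 'v set \<Rightarrow> 'a set" where
  "kernel_on A V L W = {a \<in> carr A. \<forall>x\<in>W. L a x = \<zero>\<^bsub>V\<^esub>}"

abbreviation rep_kernel ::
    "('a, 'm) star_alg_scheme \<Rightarrow> 'v ispace \<Rightarrow> ('a \<Rightarrow> 'v \<Rightarrow> 'v) \<Rightarrow> 'a set" where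
  "rep_kernel A V L \<equiv> kernel_on A V L (carr V)"

definition irreducible_rep ::
    "('a, 'm) star_alg_scheme \<Rightarrow> 'v ispace \<Rightarrow> ('a \<Rightarrow> 'v \<Rightarrow> 'v) \<Rightarrow> bool" where
  "irreducible_rep A V L \<longleftrightarrow> representation A V L \<and> rep_kernel A V L \<noteq> carr A \<and>
     (\<forall>W. invariant_subspace A V L W \<longrightarrow> W = {\<zero>\<^bsub>V\<^esub>} \<or> W = carr V)"

definition homogeneous_rep ::
    "('a, 'm) star_alg_scheme \<Rightarrow> 'v ispace \<Rightarrow> ('a \<Rightarrow> 'v \<Rightarrow> 'v) \<Rightarrow> bool" where
  "homogeneous_rep A V L \<longleftrightarrow> representation A V L \<and>
     (\<forall>W. invariant_subspace A V L W \<and> W \<noteq> {\<zero>\<^bsub>V\<^esub>} \<longrightarrow> kernel_on A V L W = rep_kernel A V L)"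

text \<open>
  An irreducible representation of A is cyclic, so its Hilbert space has a dense subset
  of cardinality at most that of A. Hence, up to unitary equivalence, all irreducible
  representations act on spaces of vectors of type \<open>'a \<Rightarrow> complex\<close>, and restricting to
  these loses no primitive ideal.
\<close>

definition Prim :: "('a, 'm) star_alg_scheme \<Rightarrow> 'a set set" where
  "Prim A = {rep_kernel A V L | (V :: ('a \<Rightarrow> complex) ispace) L. irreducible_rep A V L}"

text \<open>
  The hull-kernel topology. Primitive ideals being prime, the generating family is
  already closed under finite intersections and arbitrary unions.
\<close>

definition hull_kernel :: "('a, 'm) star_alg_scheme \<Rightarrow> 'a set topology" where
  "hull_kernel A = topology_generated_by {{Q \<in> Prim A. \<not> I \<subseteq> Q} | I. closed_ideal A I}"

definition locally_closed_point :: "'p topology \<Rightarrow> 'p \<Rightarrow> bool" where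
  "locally_closed_point T P \<longleftrightarrow> openin (subtopology T (T closure_of {P})) {P}"

text \<open>
  As for primitive ideals, the type \<open>'a \<Rightarrow> complex\<close> accommodates all cyclic
  representations, and these determine the supremum.
\<close>

definition universal_norm :: "('a, 'm) star_alg_scheme \<Rightarrow> 'a \<Rightarrow> real" where
  "universal_norm A a =
     Sup {op_norm V (L a) | (V :: ('a \<Rightarrow> complex) ispace) L. representation A V L}"

definition cauchy_class :: "('a, 'm) vspace_scheme \<Rightarrow> (nat \<Rightarrow> 'a) \<Rightarrow> (nat \<Rightarrow> 'a) set" where
  "cauchy_class X S = {T. cauchy_in X T \<and> (\<lambda>n. vdist X (S n) (T n)) \<longlonglongrightarrow> 0}"

text \<open>Hausdorff completion, by classes of Cauchy sequences.\<close>

definition completion :: "('a, 'm) star_alg_scheme \<Rightarrow> (nat \<Rightarrow> 'a) set star_alg" where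
  "completion A = \<lparr>
     carr = cauchy_class A ` {S. cauchy_in A S},
     vzero = cauchy_class A (\<lambda>n. \<zero>\<^bsub>A\<^esub>),
     vadd = (\<lambda>C D. \<Union>S\<in>C. \<Union>T\<in>D. cauchy_class A (\<lambda>n. S n \<oplus>\<^bsub>A\<^esub> T n)),
     vscale = (\<lambda>c C. \<Union>S\<in>C. cauchy_class A (\<lambda>n. c \<odot>\<^bsub>A\<^esub> S n)),
     vnorm = (\<lambda>C. THE t. \<forall>S\<in>C. (\<lambda>n. \<parallel>S n\<parallel>\<^bsub>A\<^esub>) \<longlonglongrightarrow> t),
     amult = (\<lambda>C D. \<Union>S\<in>C. \<Union>T\<in>D. cauchy_class A (\<lambda>n. S n \<otimes>\<^bsub>A\<^esub> T n)),
     astar = (\<lambda>C. \<Union>S\<in>C. cauchy_class A (\<lambda>n. astar A (S n)))\<rparr>"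

definition universal_alg :: "('a, 'm) star_alg_scheme \<Rightarrow> ('a, 'm) star_alg_scheme" where
  "universal_alg A = A\<lparr>vnorm := universal_norm A\<rparr>"

definition enveloping_cstar :: "('a, 'm) star_alg_scheme \<Rightarrow> (nat \<Rightarrow> 'a) set star_alg" where
  "enveloping_cstar A = completion (universal_alg A)"

definition envelope_embed :: "('a, 'm) star_alg_scheme \<Rightarrow> 'a \<Rightarrow> (nat \<Rightarrow> 'a) set" where
  "envelope_embed A a = cauchy_class (universal_alg A) (\<lambda>n. a)"


section \<open>Imprimitivity bimodules\<close>

locale full_right_hilbert_module =
  X: banach_space X + B: cstar_algebra B
  for X :: "('x, 'm) vspace_scheme" and B :: "('b, 'n) star_alg_scheme" +
  fixes ract :: "'x \<Rightarrow> 'b \<Rightarrow> 'x" and rip :: "'x \<Rightarrow> 'x \<Rightarrow> 'b"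
  assumes ract_closed: "\<lbrakk>x \<in> carr X; b \<in> carr B\<rbrakk> \<Longrightarrow> ract x b \<in> carr X"
    and ract_add: "\<lbrakk>x \<in> carr X; y \<in> carr X; b \<in> carr B\<rbrakk>
        \<Longrightarrow> ract (x \<oplus>\<^bsub>X\<^esub> y) b = ract x b \<oplus>\<^bsub>X\<^esub> ract y b"
    and ract_add': "\<lbrakk>x \<in> carr X; b \<in> carr B; c \<in> carr B\<rbrakk>
        \<Longrightarrow> ract x (b \<oplus>\<^bsub>B\<^esub> c) = ract x b \<oplus>\<^bsub>X\<^esub> ract x c"
    and ract_scale: "\<lbrakk>x \<in> carr X; b \<in> carr B\<rbrakk> \<Longrightarrow> ract (k \<odot>\<^bsub>X\<^esub> x) b = k \<odot>\<^bsub>X\<^esub> ract x b"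
    and ract_scale': "\<lbrakk>x \<in> carr X; b \<in> carr B\<rbrakk> \<Longrightarrow> ract x (k \<odot>\<^bsub>B\<^esub> b) = k \<odot>\<^bsub>X\<^esub> ract x b"
    and ract_mult: "\<lbrakk>x \<in> carr X; b \<in> carr B; c \<in> carr B\<rbrakk> \<Longrightarrow> ract x (b \<otimes>\<^bsub>B\<^esub> c) = ract (ract x b) c"
    and rip_closed: "\<lbrakk>x \<in> carr X; y \<in> carr X\<rbrakk> \<Longrightarrow> rip x y \<in> carr B"
    and rip_add: "\<lbrakk>x \<in> carr X; y \<in> carr X; z \<in> carr X\<rbrakk> \<Longrightarrow> rip x (y \<oplus>\<^bsub>X\<^esub> z) = rip x y \<oplus>\<^bsub>B\<^esub> rip x z"
    and rip_scale: "\<lbrakk>x \<in> carr X; y \<in> carr X\<rbrakk> \<Longrightarrow> rip x (k \<odot>\<^bsub>X\<^esub> y) = k \<odot>\<^bsub>B\<^esub> rip x y"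
    and rip_ract: "\<lbrakk>x \<in> carr X; y \<in> carr X; b \<in> carr B\<rbrakk> \<Longrightarrow> rip x (ract y b) = rip x y \<otimes>\<^bsub>B\<^esub> b"
    and rip_star: "\<lbrakk>x \<in> carr X; y \<in> carr X\<rbrakk> \<Longrightarrow> astar B (rip x y) = rip y x"
    and rip_positive: "x \<in> carr X \<Longrightarrow> positive_elt B (rip x x)"
    and rip_norm: "x \<in> carr X \<Longrightarrow> \<parallel>x\<parallel>\<^bsub>X\<^esub>\<^sup>2 = \<parallel>rip x x\<parallel>\<^bsub>B\<^esub>"
    and rip_full: "closed_span B {rip x y | x y. x \<in> carr X \<and> y \<in> carr X} = carr B"

locale full_left_hilbert_module =
  A: cstar_algebra A + X: banach_space X
  for A :: "('a, 'l) star_alg_scheme" and X :: "('x, 'm) vspace_scheme" +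
  fixes lact :: "'a \<Rightarrow> 'x \<Rightarrow> 'x" and lip :: "'x \<Rightarrow> 'x \<Rightarrow> 'a"
  assumes lact_closed: "\<lbrakk>a \<in> carr A; x \<in> carr X\<rbrakk> \<Longrightarrow> lact a x \<in> carr X"
    and lact_add: "\<lbrakk>a \<in> carr A; x \<in> carr X; y \<in> carr X\<rbrakk>
        \<Longrightarrow> lact a (x \<oplus>\<^bsub>X\<^esub> y) = lact a x \<oplus>\<^bsub>X\<^esub> lact a y"
    and lact_add': "\<lbrakk>a \<in> carr A; b \<in> carr A; x \<in> carr X\<rbrakk>
        \<Longrightarrow> lact (a \<oplus>\<^bsub>A\<^esub> b) x = lact a x \<oplus>\<^bsub>X\<^esub> lact b x"
    and lact_scale: "\<lbrakk>a \<in> carr A; x \<in> carr X\<rbrakk> \<Longrightarrow> lact a (k \<odot>\<^bsub>X\<^esub> x) = k \<odot>\<^bsub>X\<^esub> lact a x"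
    and lact_scale': "\<lbrakk>a \<in> carr A; x \<in> carr X\<rbrakk> \<Longrightarrow> lact (k \<odot>\<^bsub>A\<^esub> a) x = k \<odot>\<^bsub>X\<^esub> lact a x"
    and lact_mult: "\<lbrakk>a \<in> carr A; b \<in> carr A; x \<in> carr X\<rbrakk> \<Longrightarrow> lact (a \<otimes>\<^bsub>A\<^esub> b) x = lact a (lact b x)"
    and lip_closed: "\<lbrakk>x \<in> carr X; y \<in> carr X\<rbrakk> \<Longrightarrow> lip x y \<in> carr A"
    and lip_add: "\<lbrakk>x \<in> carr X; y \<in> carr X; z \<in> carr X\<rbrakk> \<Longrightarrow> lip (x \<oplus>\<^bsub>X\<^esub> y) z = lip x z \<oplus>\<^bsub>A\<^esub> lip y z"
    and lip_scale: "\<lbrakk>x \<in> carr X; y \<in> carr X\<rbrakk> \<Longrightarrow> lip (k \<odot>\<^bsub>X\<^esub> x) y = k \<odot>\<^bsub>A\<^esub> lip x y"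
    and lip_lact: "\<lbrakk>a \<in> carr A; x \<in> carr X; y \<in> carr X\<rbrakk> \<Longrightarrow> lip (lact a x) y = a \<otimes>\<^bsub>A\<^esub> lip x y"
    and lip_star: "\<lbrakk>x \<in> carr X; y \<in> carr X\<rbrakk> \<Longrightarrow> astar A (lip x y) = lip y x"
    and lip_positive: "x \<in> carr X \<Longrightarrow> positive_elt A (lip x x)"
    and lip_norm: "x \<in> carr X \<Longrightarrow> \<parallel>x\<parallel>\<^bsub>X\<^esub>\<^sup>2 = \<parallel>lip x x\<parallel>\<^bsub>A\<^esub>"
    and lip_full: "closed_span A {lip x y | x y. x \<in> carr X \<and> y \<in> carr X} = carr A"

locale imprimitivity_bimodule =
  full_left_hilbert_module A X lact lip + full_right_hilbert_module X B ract rip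
  for A :: "('a, 'l) star_alg_scheme" and B :: "('b, 'n) star_alg_scheme"
    and X :: "('x, 'm) vspace_scheme" and lact ract lip rip +
  assumes lact_adjoint: "\<lbrakk>a \<in> carr A; x \<in> carr X; y \<in> carr X\<rbrakk>
        \<Longrightarrow> rip (lact a x) y = rip x (lact (astar A a) y)"
    and ract_adjoint: "\<lbrakk>b \<in> carr B; x \<in> carr X; y \<in> carr X\<rbrakk>
        \<Longrightarrow> lip (ract x b) y = lip x (ract y (astar B b))"
    and lip_rip: "\<lbrakk>x \<in> carr X; y \<in> carr X; z \<in> carr X\<rbrakk> \<Longrightarrow> lact (lip x y) z = ract x (rip y z)"

text \<open>The Rieffel correspondence for an A-B-imprimitivity bimodule X, from ideals of B to ideals of A.\<close>

definition rieffel_ideal :: "('a, 'l) star_alg_scheme \<Rightarrow> ('x, 'm) vspace_scheme \<Rightarrow>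
    ('x \<Rightarrow> 'b \<Rightarrow> 'x) \<Rightarrow> ('x \<Rightarrow> 'x \<Rightarrow> 'a) \<Rightarrow> 'b set \<Rightarrow> 'a set" where
  "rieffel_ideal A X ract lip J =
     closed_span A {lip (ract x j) y | x j y. x \<in> carr X \<and> j \<in> J \<and> y \<in> carr X}"


section \<open>Locally compact groupoids, Haar systems, Haar measures on subgroups\<close>

text \<open>The groupoid is the whole type; \<open>gmul x y\<close> is meaningful only if \<open>src x = rng y\<close>.\<close>

record 'g grpd =
  rng :: "'g \<Rightarrow> 'g"
  src :: "'g \<Rightarrow> 'g"
  gmul :: "'g \<Rightarrow> 'g \<Rightarrow> 'g"
  ginv :: "'g \<Rightarrow> 'g"

definition units :: "'g grpd \<Rightarrow> 'g set" where
  "units G = range (rng G)"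

locale lc_groupoid =
  fixes G :: "'g::t2_space grpd"
  assumes rng_rng: "rng G (rng G x) = rng G x" and src_rng: "src G (rng G x) = rng G x"
    and rng_src: "rng G (src G x) = src G x" and src_src: "src G (src G x) = src G x"
    and rng_mul: "src G x = rng G y \<Longrightarrow> rng G (gmul G x y) = rng G x"
    and src_mul: "src G x = rng G y \<Longrightarrow> src G (gmul G x y) = src G y"
    and mul_assoc: "\<lbrakk>src G x = rng G y; src G y = rng G z\<rbrakk>
        \<Longrightarrow> gmul G (gmul G x y) z = gmul G x (gmul G y z)"
    and rng_unit: "gmul G (rng G x) x = x" and src_unit: "gmul G x (src G x) = x"
    and rng_inv: "rng G (ginv G x) = src G x" and src_inv: "src G (ginv G x) = rng G x"
    and mul_inv: "gmul G x (ginv G x) = rng G x" and inv_mul: "gmul G (ginv G x) x = src G x"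
    and continuous_mul: "continuous_on {(x, y). src G x = rng G y} (\<lambda>(x, y). gmul G x y)"
    and continuous_inv: "continuous_on UNIV (ginv G)"
    and locally_compact: "locally_compact_space (euclidean :: 'g topology)"

definition Cc :: "'g::topological_space set \<Rightarrow> ('g \<Rightarrow> complex) set" where
  "Cc X = {f. continuous_on X f \<and> (\<exists>K. compact K \<and> K \<subseteq> X \<and> (\<forall>x\<in>X - K. f x = 0))}"

locale haar_system =
  fixes G :: "'g::t2_space grpd" and \<mu> :: "'g \<Rightarrow> 'g measure"
  assumes sets_borel: "u \<in> units G \<Longrightarrow> sets (\<mu> u) = sets borel"
    and compact_finite: "\<lbrakk>u \<in> units G; compact K\<rbrakk> \<Longrightarrow> emeasure (\<mu> u) K < \<infinity>"
    and support: "u \<in> units G \<Longrightarrow>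
        {x. \<forall>U. open U \<and> x \<in> U \<longrightarrow> emeasure (\<mu> u) U > 0} = {x. rng G x = u}"
    and continuous: "f \<in> Cc UNIV \<Longrightarrow> continuous_on (units G) (\<lambda>u. \<integral>x. f x \<partial>\<mu> u)"
    and left_invariant: "f \<in> Cc UNIV \<Longrightarrow>
        (LINT y:{y. rng G y = src G x}|\<mu> (src G x). f (gmul G x y)) = (\<integral>y. f y \<partial>\<mu> (rng G x))"

text \<open>
  Haar measure and modular function of a closed subgroup H of an isotropy group of G. Over
  a second countable base all measures finite on compact sets are Radon.
\<close>

locale haar_measure =
  fixes G :: "'g::t2_space grpd" and H :: "'g set" and \<nu> :: "'g measure"
  assumes sets_borel: "sets \<nu> = sets (restrict_space borel H)"
    and compact_finite: "\<lbrakk>compact K; K \<subseteq> H\<rbrakk> \<Longrightarrow> emeasure \<nu> K < \<infinity>"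
    and nonzero: "emeasure \<nu> H \<noteq> 0"
    and left_invariant: "\<lbrakk>x \<in> H; E \<in> sets \<nu>\<rbrakk> \<Longrightarrow> emeasure \<nu> (gmul G x ` E) = emeasure \<nu> E"

locale modular_function =
  fixes G :: "'g::t2_space grpd" and H :: "'g set" and \<nu> :: "'g measure" and \<Delta> :: "'g \<Rightarrow> real"
  assumes positive: "x \<in> H \<Longrightarrow> \<Delta> x > 0"
    and continuous: "continuous_on H \<Delta>"
    and multiplicative: "\<lbrakk>x \<in> H; y \<in> H\<rbrakk> \<Longrightarrow> \<Delta> (gmul G x y) = \<Delta> x * \<Delta> y"
    and inversion: "f \<in> Cc H \<Longrightarrow>
        (\<integral>x. f (ginv G x) * complex_of_real (\<Delta> (ginv G x)) \<partial>\<nu>) = (\<integral>x. f x \<partial>\<nu>)"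


section \<open>Fell bundles\<close>

text \<open>
  The total space is the whole type \<open>'b\<close>, which need not be Hausdorff. Addition is
  meaningful within a fibre, multiplication for elements over composable arrows.
\<close>

record ('g, 'b) banach_bundle =
  proj :: "'b \<Rightarrow> 'g"
  bzero :: "'g \<Rightarrow> 'b"
  badd :: "'b \<Rightarrow> 'b \<Rightarrow> 'b"
  bscale :: "complex \<Rightarrow> 'b \<Rightarrow> 'b"
  bnorm :: "'b \<Rightarrow> real"
  bmul :: "'b \<Rightarrow> 'b \<Rightarrow> 'b"
  bstar :: "'b \<Rightarrow> 'b"

text \<open>The fibre over x; its last two components are operations on it only if x is a unit.\<close>

definition fibre :: "('g, 'b) banach_bundle \<Rightarrow> 'g \<Rightarrow> 'b star_alg" where
  "fibre B x = \<lparr>carr = {b. proj B b = x}, vzero = bzero B x, vadd = badd B, vscale = bscale B,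
     vnorm = bnorm B, amult = bmul B, astar = bstar B\<rparr>"

text \<open>In \<open>zero_limit\<close>, filters on the total space take the place of nets.\<close>

locale usc_banach_bundle =
  fixes B :: "('g::topological_space, 'b::topological_space) banach_bundle"
  assumes fibre_banach: "banach_space (fibre B x)"
    and continuous_proj: "continuous_on UNIV (proj B)"
    and open_proj: "open U \<Longrightarrow> open (proj B ` U)"
    and norm_usc: "open {b. bnorm B b < t}"
    and continuous_add: "continuous_on {(a, b). proj B a = proj B b} (\<lambda>(a, b). badd B a b)"
    and continuous_scale: "continuous_on UNIV (bscale B c)"
    and zero_limit: "\<lbrakk>(proj B \<longlongrightarrow> x) F; (bnorm B \<longlongrightarrow> 0) F\<rbrakk> \<Longrightarrow> F \<le> nhds (bzero B x)"

locale fell_bundle = usc_banach_bundle B + lc_groupoid G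
  for G :: "'g::t2_space grpd" and B :: "('g, 'b::topological_space) banach_bundle" +
  assumes proj_mul: "src G (proj B a) = rng G (proj B b)
        \<Longrightarrow> proj B (bmul B a b) = gmul G (proj B a) (proj B b)"
    and continuous_bmul:
      "continuous_on {(a, b). src G (proj B a) = rng G (proj B b)} (\<lambda>(a, b). bmul B a b)"
    and bmul_add_left: "\<lbrakk>proj B a = proj B b; src G (proj B a) = rng G (proj B c)\<rbrakk>
        \<Longrightarrow> bmul B (badd B a b) c = badd B (bmul B a c) (bmul B b c)"
    and bmul_add_right: "\<lbrakk>proj B b = proj B c; src G (proj B a) = rng G (proj B b)\<rbrakk>
        \<Longrightarrow> bmul B a (badd B b c) = badd B (bmul B a b) (bmul B a c)"
    and bmul_scale_left: "src G (proj B a) = rng G (proj B b)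
        \<Longrightarrow> bmul B (bscale B z a) b = bscale B z (bmul B a b)"
    and bmul_scale_right: "src G (proj B a) = rng G (proj B b)
        \<Longrightarrow> bmul B a (bscale B z b) = bscale B z (bmul B a b)"
    and bmul_assoc: "\<lbrakk>src G (proj B a) = rng G (proj B b); src G (proj B b) = rng G (proj B c)\<rbrakk>
        \<Longrightarrow> bmul B (bmul B a b) c = bmul B a (bmul B b c)"
    and proj_star: "proj B (bstar B a) = ginv G (proj B a)"
    and continuous_bstar: "continuous_on UNIV (bstar B)"
    and bstar_add: "proj B a = proj B b \<Longrightarrow> bstar B (badd B a b) = badd B (bstar B a) (bstar B b)"
    and bstar_scale: "bstar B (bscale B z a) = bscale B (cnj z) (bstar B a)"
    and bstar_bstar: "bstar B (bstar B a) = a"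
    and bstar_mul: "src G (proj B a) = rng G (proj B b)
        \<Longrightarrow> bstar B (bmul B a b) = bmul B (bstar B b) (bstar B a)"
    and unit_fibre_cstar: "u \<in> units G \<Longrightarrow> cstar_algebra (fibre B u)"
    and saturated: "imprimitivity_bimodule (fibre B (rng G x)) (fibre B (src G x)) (fibre B x)
        (bmul B) (bmul B) (\<lambda>a b. bmul B a (bstar B b)) (\<lambda>a b. bmul B (bstar B a) b)"

text \<open>Sections over X are normalised to be \<open>undefined\<close> off X, so that they form a set of functions on X.\<close>

definition continuous_sections ::
    "('g::topological_space, 'b::topological_space) banach_bundle \<Rightarrow> 'g set \<Rightarrow> ('g \<Rightarrow> 'b) set" where
  "continuous_sections B X = {f \<in> extensional X. (\<forall>x\<in>X. proj B (f x) = x) \<and> continuous_on X f}"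

text \<open>
  The sections vanishing at infinity, with the supremum norm and pointwise operations;
  multiplication and involution are operations on it only if X consists of units.
\<close>

definition section_alg ::
    "('g::topological_space, 'b::topological_space) banach_bundle \<Rightarrow> 'g set \<Rightarrow> ('g \<Rightarrow> 'b) star_alg" where
  "section_alg B X = \<lparr>
     carr = {f \<in> continuous_sections B X.
       \<forall>e>0. \<exists>K. compact K \<and> K \<subseteq> X \<and> (\<forall>x\<in>X - K. bnorm B (f x) < e)},
     vzero = (\<lambda>x\<in>X. bzero B x),
     vadd = (\<lambda>f g. \<lambda>x\<in>X. badd B (f x) (g x)),
     vscale = (\<lambda>c f. \<lambda>x\<in>X. bscale B c (f x)),
     vnorm = (\<lambda>f. SUP x\<in>X. bnorm B (f x)),
     amult = (\<lambda>f g. \<lambda>x\<in>X. bmul B (f x) (g x)),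
     astar = (\<lambda>f. \<lambda>x\<in>X. bstar B (f x))\<rparr>"

text \<open>Second countability of the base is left to the type class of \<open>'g\<close>.\<close>

definition separable_bundle ::
    "('g::second_countable_topology, 'b::topological_space) banach_bundle \<Rightarrow> bool" where
  "separable_bundle B \<longleftrightarrow> (let S = section_alg B UNIV in
     \<exists>D. countable D \<and> D \<subseteq> carr S \<and> (\<forall>f\<in>carr S. \<forall>e>0. \<exists>d\<in>D. vdist S f d < e))"

abbreviation unit_alg ::
    "'g::topological_space grpd \<Rightarrow> ('g, 'b::topological_space) banach_bundle \<Rightarrow> ('g \<Rightarrow> 'b) star_alg" where
  "unit_alg G B \<equiv> section_alg B (units G)"

definition eval_kernel ::
    "'g::topological_space grpd \<Rightarrow> ('g, 'b::topological_space) banach_bundle \<Rightarrow> 'g \<Rightarrow> ('g \<Rightarrow> 'b) set" where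
  "eval_kernel G B u = {f \<in> carr (unit_alg G B). f u = bzero B u}"

definition sigma ::
    "'g::topological_space grpd \<Rightarrow> ('g, 'b::topological_space) banach_bundle \<Rightarrow> ('g \<Rightarrow> 'b) set \<Rightarrow> 'g" where
  "sigma G B P = (THE u. u \<in> units G \<and> eval_kernel G B u \<subseteq> P)"

text \<open>
  Ideals of the section algebra containing \<open>eval_kernel G B u\<close> correspond to ideals of the
  fibre over u: the former are mapped to the latter by \<open>at_fibre u\<close> and recovered
  by \<open>from_fibre G B u\<close>.
\<close>

definition at_fibre :: "'g \<Rightarrow> ('g \<Rightarrow> 'b) set \<Rightarrow> 'b set" where
  "at_fibre u P = (\<lambda>f. f u) ` P"

definition from_fibre ::
    "'g::topological_space grpd \<Rightarrow> ('g, 'b::topological_space) banach_bundle \<Rightarrow> 'g \<Rightarrow> 'b set \<Rightarrow> ('g \<Rightarrow> 'b) set" where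
  "from_fibre G B u J = {f \<in> carr (unit_alg G B). f u \<in> J}"

definition fibre_rieffel :: "'g grpd \<Rightarrow> ('g, 'b) banach_bundle \<Rightarrow> 'g \<Rightarrow> 'b set \<Rightarrow> 'b set" where
  "fibre_rieffel G B x J =
     rieffel_ideal (fibre B (rng G x)) (fibre B x) (bmul B) (\<lambda>a b. bmul B a (bstar B b)) J"

definition prim_act ::
    "'g::topological_space grpd \<Rightarrow> ('g, 'b::topological_space) banach_bundle \<Rightarrow> 'g \<Rightarrow> ('g \<Rightarrow> 'b) set \<Rightarrow> ('g \<Rightarrow> 'b) set" where
  "prim_act G B x P = from_fibre G B (rng G x) (fibre_rieffel G B x (at_fibre (src G x) P))"

definition stability_group ::
    "'g::topological_space grpd \<Rightarrow> ('g, 'b::topological_space) banach_bundle \<Rightarrow> ('g \<Rightarrow> 'b) set \<Rightarrow> 'g set" where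
  "stability_group G B P =
     {x. rng G x = sigma G B P \<and> src G x = sigma G B P \<and> prim_act G B x P = P}"


section \<open>The C*-algebra of the restriction to a subgroup\<close>

text \<open>
  The compactly supported continuous sections over a closed subgroup H of an isotropy group,
  with convolution, normed by the I-norm.
\<close>

definition convolution_alg ::
    "'g::t2_space grpd \<Rightarrow> ('g, 'b::topological_space) banach_bundle \<Rightarrow> 'g set \<Rightarrow> 'g measure \<Rightarrow> ('g \<Rightarrow> 'b) star_alg" where
  "convolution_alg G B H \<nu> = \<lparr>
     carr = {f \<in> continuous_sections B H.
       \<exists>K. compact K \<and> K \<subseteq> H \<and> (\<forall>x\<in>H - K. f x = bzero B x)},
     vzero = (\<lambda>x\<in>H. bzero B x),
     vadd = (\<lambda>f g. \<lambda>x\<in>H. badd B (f x) (g x)),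
     vscale = (\<lambda>c f. \<lambda>x\<in>H. bscale B c (f x)),
     vnorm = (\<lambda>f. max (\<integral>x. bnorm B (f x) \<partial>\<nu>) (\<integral>x. bnorm B (f (ginv G x)) \<partial>\<nu>)),
     amult = (\<lambda>f g. \<lambda>x\<in>H.
       vector_integral (fibre B x) \<nu> (\<lambda>y. bmul B (f y) (g (gmul G (ginv G y) x)))),
     astar = (\<lambda>f. \<lambda>x\<in>H. bstar B (f (ginv G x)))\<rparr>"

definition group_cstar ::
    "'g::t2_space grpd \<Rightarrow> ('g, 'b::topological_space) banach_bundle \<Rightarrow> 'g set \<Rightarrow> 'g measure
      \<Rightarrow> (nat \<Rightarrow> 'g \<Rightarrow> 'b) set star_alg" where
  "group_cstar G B H \<nu> = enveloping_cstar (convolution_alg G B H \<nu>)"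

text \<open>
  Nondegenerate star homomorphisms of the restriction of B to the group H into the bounded
  operators on V. Continuity is required for the strong operator topology; as the involution
  of B is continuous and its norm locally bounded, this amounts to strict continuity.
\<close>

locale bundle_rep = hilbert_space V
  for B :: "('g, 'b::topological_space) banach_bundle" and H :: "'g set" and V :: "'v ispace"
    and \<pi> :: "'b \<Rightarrow> 'v \<Rightarrow> 'v" +
  assumes bounded: "proj B b \<in> H \<Longrightarrow> bounded_op V (\<pi> b)"
    and rep_add: "\<lbrakk>proj B a \<in> H; proj B a = proj B b; x \<in> carr V\<rbrakk>
        \<Longrightarrow> \<pi> (badd B a b) x = \<pi> a x \<oplus>\<^bsub>V\<^esub> \<pi> b x"
    and rep_scale: "\<lbrakk>proj B a \<in> H; x \<in> carr V\<rbrakk> \<Longrightarrow> \<pi> (bscale B c a) x = c \<odot>\<^bsub>V\<^esub> \<pi> a x"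
    and rep_mul: "\<lbrakk>proj B a \<in> H; proj B b \<in> H; x \<in> carr V\<rbrakk> \<Longrightarrow> \<pi> (bmul B a b) x = \<pi> a (\<pi> b x)"
    and rep_star: "\<lbrakk>proj B a \<in> H; x \<in> carr V; y \<in> carr V\<rbrakk>
        \<Longrightarrow> vinner V (\<pi> a x) y = vinner V x (\<pi> (bstar B a) y)"
    and strongly_continuous: "\<lbrakk>proj B b \<in> H; x \<in> carr V\<rbrakk>
        \<Longrightarrow> ((\<lambda>a. vdist V (\<pi> a x) (\<pi> b x)) \<longlongrightarrow> 0) (at b within {a. proj B a \<in> H})"
    and nondegenerate: "closed_span V {\<pi> b x | b x. proj B b \<in> H \<and> x \<in> carr V} = carr V"

text \<open>
  The operator-valued integral defining the integrated form, on sections of compact support,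
  is the weak one.
\<close>

definition integrated_form ::
    "'g::t2_space grpd \<Rightarrow> ('g, 'b::topological_space) banach_bundle \<Rightarrow> 'g set \<Rightarrow> 'g measure \<Rightarrow> ('g \<Rightarrow> real)
      \<Rightarrow> 'v ispace \<Rightarrow> ('b \<Rightarrow> 'v \<Rightarrow> 'v) \<Rightarrow> ((nat \<Rightarrow> 'g \<Rightarrow> 'b) set \<Rightarrow> 'v \<Rightarrow> 'v) \<Rightarrow> bool" where
  "integrated_form G B H \<nu> \<Delta> V \<pi> L \<longleftrightarrow>
     (\<forall>f\<in>carr (convolution_alg G B H \<nu>). \<forall>x\<in>carr V. \<forall>y\<in>carr V.
        has_bochner_integral \<nu>
          (\<lambda>s. vinner V (\<pi> (f s) x) y * complex_of_real (\<Delta> s powr (- 1 / 2)))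
          (vinner V (L (envelope_embed (convolution_alg G B H \<nu>) f) x) y))"

end

theory Submission
  imports Defs
begin

text \<open>
  Write \<open>A(u)\<close> for the fibre over u and J for the ideal of \<open>A(u)\<close> that corresponds to P,
  which is the kernel of \<open>\<pi>\<close> on \<open>A(u)\<close>.

  As P is locally closed, there is a section g outside P that lies in every primitive ideal strictly
  above P (\<open>locally_closed_witness\<close>); put \<open>j = g u\<close>, so j is not in J. A closed ideal of
  \<open>A(u)\<close> that is the kernel of a subrepresentation and differs from J must contain j
  (\<open>kernel_contains_witness\<close>): otherwise an irreducible representation with a larger kernel
  not containing j would give a primitive ideal strictly above P that does not contain g. Such
  representations are found by the GNS construction for extreme points of a compact convex set of
  quasi-states (\<open>irreducible_rep_separating\<close>). To pass between ideals of \<open>A(u)\<close> and of the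
  section algebra one needs that evaluation of continuous sections at u is onto
  (\<open>enough_sections\<close>).

  Now suppose that the restriction of \<open>\<pi>\<close> to a nonzero \<open>A(u)\<close>-invariant subspace W has a kernel
  other than J. Then j vanishes on W, and W is contained in the closed subspace \<open>V0\<close> of all v with
  \<open>\<pi> j (\<pi> a v) = 0\<close> for all a in \<open>A(u)\<close>. This space is invariant under \<open>\<pi> b\<close> for b over any
  x in the stability group. Indeed, let K be the kernel of \<open>A(u)\<close> on the span of the vectors
  \<open>\<pi> b v\<close> with b over x and v in \<open>V0\<close>. It contains all products \<open>b j c\<^sup>*\<close> with b and c over
  x. If K were J, then, J being fixed by x, these products would force j to lie in J
  (\<open>in_J_if_translates_in_J\<close>). Hence K differs from J and contains j, which is what is claimed.

  By invariance under the bundle, \<open>V0\<close> is invariant under the integrated form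
  (\<open>integrated_form_invariant\<close>), which is irreducible, and \<open>V0\<close> is nonzero, so \<open>V0\<close> is the
  whole space. Then j annihilates everything and lies in J, a contradiction.

  Two facts about the stability group are needed on the way. It is nonempty, since it carries a
  nonzero measure, and any of its arrows shows that P contains the kernel of the evaluation at u and is
  therefore determined by J. And it contains the unit u, because closed ideals satisfy
  \<open>J = A(u) J A(u)\<close> up to closure (\<open>two_sided_approx\<close>); hence \<open>\<pi>\<close> is a representation of
  \<open>A(u)\<close>.
\<close>

section \<open>Vector spaces on carriers\<close>

abbreviation vdiff :: "('a, 'm) vspace_scheme \<Rightarrow> 'a \<Rightarrow> 'a \<Rightarrow> 'a"  (infixl "\<ominus>\<index>" 65) where
  "x \<ominus>\<^bsub>X\<^esub> y \<equiv> x \<oplus>\<^bsub>X\<^esub> (- 1) \<odot>\<^bsub>X\<^esub> y"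

context complex_space
begin

lemmas closed_ops [simp, intro] = zero_closed add_closed scale_closed

lemma add_left_commute:
  "\<lbrakk>x \<in> carr X; y \<in> carr X; z \<in> carr X\<rbrakk> \<Longrightarrow> x \<oplus> (y \<oplus> z) = y \<oplus> (x \<oplus> z)"
  by (metis add_assoc add_commute)

lemmas add_ac = add_assoc add_commute add_left_commute

lemma add_zero [simp]: "x \<in> carr X \<Longrightarrow> x \<oplus> \<zero> = x"
  by (metis add_commute zero_add zero_closed)

declare zero_add [simp] scale_zero [simp] scale_one [simp] scale_scale [simp]

lemma scale_zero_right [simp]: "c \<odot> \<zero> = \<zero>"
  by (metis mult_zero_right scale_scale scale_zero zero_closed)

lemma scale_sum: "x \<in> carr X \<Longrightarrow> c \<odot> x \<oplus> d \<odot> x = (c + d) \<odot> x"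
  by (simp add: scale_add_left)

lemma add_minus [simp]: "x \<in> carr X \<Longrightarrow> x \<ominus> x = \<zero>"
  using scale_sum[of x 1 "-1"] by simp

lemma minus_add [simp]: "x \<in> carr X \<Longrightarrow> (- 1) \<odot> x \<oplus> x = \<zero>"
  using add_minus[of x] by (simp add: add_commute)

lemma add_minus_left [simp]: "\<lbrakk>x \<in> carr X; y \<in> carr X\<rbrakk> \<Longrightarrow> x \<oplus> ((- 1) \<odot> x \<oplus> y) = y"
  by (metis add_assoc add_minus scale_closed zero_add)

lemma minus_add_left [simp]: "\<lbrakk>x \<in> carr X; y \<in> carr X\<rbrakk> \<Longrightarrow> (- 1) \<odot> x \<oplus> (x \<oplus> y) = y"
  by (metis add_assoc minus_add scale_closed zero_add)

lemma diff_add_cancel: "\<lbrakk>x \<in> carr X; y \<in> carr X\<rbrakk> \<Longrightarrow> (x \<ominus> y) \<oplus> y = x"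
  by (simp add: add_assoc)

lemma diff_eq_zero: "\<lbrakk>x \<in> carr X; y \<in> carr X\<rbrakk> \<Longrightarrow> x \<ominus> y = \<zero> \<longleftrightarrow> x = y"
  by (metis add_minus diff_add_cancel zero_add)

lemma diff_triangle:
  assumes "x \<in> carr X" "y \<in> carr X" "z \<in> carr X"
  shows "(x \<ominus> y) \<oplus> (y \<ominus> z) = x \<ominus> z"
  using assms by (simp add: add_ac)

lemma diff_commute: "\<lbrakk>x \<in> carr X; y \<in> carr X\<rbrakk> \<Longrightarrow> (- 1) \<odot> (x \<ominus> y) = y \<ominus> x"
  by (simp add: scale_add_right add_commute)

lemma diff_add_add:
  assumes "x \<in> carr X" "y \<in> carr X" "x' \<in> carr X" "y' \<in> carr X"
  shows "(x \<oplus> y) \<ominus> (x' \<oplus> y') = (x \<ominus> x') \<oplus> (y \<ominus> y')"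
  using assms by (simp add: scale_add_right add_ac)

lemma diff_scale: "\<lbrakk>x \<in> carr X; y \<in> carr X\<rbrakk> \<Longrightarrow> c \<odot> x \<oplus> (- c) \<odot> y = c \<odot> (x \<ominus> y)"
  by (simp add: scale_add_right)

end

context banach_space
begin

lemma norm_zero [simp]: "\<parallel>\<zero>\<parallel> = 0"
  using norm_eq_zero zero_closed by blast

lemma norm_minus [simp]: "x \<in> carr X \<Longrightarrow> \<parallel>(- 1) \<odot> x\<parallel> = \<parallel>x\<parallel>"
  by (simp add: norm_scale)

lemma norm_nonneg [simp]: "x \<in> carr X \<Longrightarrow> 0 \<le> \<parallel>x\<parallel>"
  using norm_triangle[of x "(-1) \<odot> x"] by simp

lemma norm_diff_commute: "\<lbrakk>x \<in> carr X; y \<in> carr X\<rbrakk> \<Longrightarrow> \<parallel>x \<ominus> y\<parallel> = \<parallel>y \<ominus> x\<parallel>"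
  by (metis diff_commute norm_minus add_closed scale_closed)

lemma norm_diff_triangle:
  assumes "x \<in> carr X" "y \<in> carr X" "z \<in> carr X"
  shows "\<parallel>x \<ominus> z\<parallel> \<le> \<parallel>x \<ominus> y\<parallel> + \<parallel>y \<ominus> z\<parallel>"
  using norm_triangle[of "x \<ominus> y" "y \<ominus> z"] assms by (simp add: diff_triangle)

lemma norm_triangle_sub:
  assumes "x \<in> carr X" "y \<in> carr X"
  shows "\<parallel>x\<parallel> \<le> \<parallel>y\<parallel> + \<parallel>x \<ominus> y\<parallel>"
  using norm_triangle[of "x \<ominus> y" y] assms by (simp add: diff_add_cancel)

lemma norm_diff_le: "\<lbrakk>x \<in> carr X; y \<in> carr X\<rbrakk> \<Longrightarrow> \<parallel>x \<ominus> y\<parallel> \<le> \<parallel>x\<parallel> + \<parallel>y\<parallel>"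
  using norm_triangle[of x "(-1) \<odot> y"] by simp

lemma norm_tendsto:
  assumes "range S \<subseteq> carr X" "l \<in> carr X" "(\<lambda>n. vdist X (S n) l) \<longlonglongrightarrow> 0"
  shows "(\<lambda>n. \<parallel>S n\<parallel>) \<longlonglongrightarrow> \<parallel>l\<parallel>"
proof -
  have S: "S n \<in> carr X" for n using assms(1) by auto
  have "\<bar>\<parallel>S n\<parallel> - \<parallel>l\<parallel>\<bar> \<le> vdist X (S n) l" for n
    using norm_triangle_sub[of "S n" l] norm_triangle_sub[of l "S n"] S[of n] assms(2)
      norm_diff_commute[of "S n" l] by (simp add: vdist_def)
  then have "(\<lambda>n. \<parallel>S n\<parallel> - \<parallel>l\<parallel>) \<longlonglongrightarrow> 0"
    by (intro Lim_null_comparison[OF _ assms(3)]) auto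
  then show ?thesis by (simp add: LIM_zero_iff)
qed

lemma limit_unique:
  assumes "range S \<subseteq> carr X" "l \<in> carr X" "m \<in> carr X"
    "(\<lambda>n. vdist X (S n) l) \<longlonglongrightarrow> 0" "(\<lambda>n. vdist X (S n) m) \<longlonglongrightarrow> 0"
  shows "l = m"
proof -
  have S: "S n \<in> carr X" for n using assms(1) by auto
  have "(\<lambda>n. vdist X (S n) l + vdist X (S n) m) \<longlonglongrightarrow> 0"
    using tendsto_add[OF assms(4,5)] by simp
  moreover have "\<parallel>l \<ominus> m\<parallel> \<le> vdist X (S n) l + vdist X (S n) m" for n
    using norm_diff_triangle[of l "S n" m] norm_diff_commute[of l "S n"] assms(2,3) S[of n]
    by (simp add: vdist_def)
  ultimately have "\<parallel>l \<ominus> m\<parallel> \<le> 0"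
    by (intro LIMSEQ_le_const) auto
  then have "\<parallel>l \<ominus> m\<parallel> = 0"
    by (rule antisym) (use assms(2,3) in simp)
  then show ?thesis using norm_eq_zero[of "l \<ominus> m"] assms(2,3) by (simp add: diff_eq_zero)
qed

end

lemma null_comparison:
  fixes f :: "nat \<Rightarrow> 'n::real_normed_vector"
  assumes "g \<longlonglongrightarrow> 0" "\<And>n. norm (f n) \<le> g n"
  shows "f \<longlonglongrightarrow> 0"
  by (rule Lim_null_comparison[OF always_eventually assms(1)]) (simp add: assms(2))

lemma null_le:
  fixes f :: "nat \<Rightarrow> real"
  assumes "g \<longlonglongrightarrow> 0" "\<And>n. 0 \<le> f n" "\<And>n. f n \<le> g n"
  shows "f \<longlonglongrightarrow> 0"
  by (rule null_comparison[OF assms(1)]) (simp add: assms(2,3))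

lemma closed_spanI:
  assumes "\<And>W. closed_subspace X W \<Longrightarrow> S \<subseteq> W \<Longrightarrow> x \<in> W"
  shows "x \<in> closed_span X S"
  using assms by (auto simp: closed_span_def)

lemma closed_span_minimal: "\<lbrakk>closed_subspace X W; S \<subseteq> W\<rbrakk> \<Longrightarrow> closed_span X S \<subseteq> W"
  by (auto simp: closed_span_def)

lemma closed_span_superset: "S \<subseteq> closed_span X S"
  by (auto simp: closed_span_def)

lemma (in complex_space) closed_subspace_carr: "closed_subspace X (carr X)"
  by (auto simp: closed_subspace_def)

lemma (in complex_space) closed_span_closed_subspace:
  assumes "S \<subseteq> carr X"
  shows "closed_subspace X (closed_span X S)"
  unfolding closed_subspace_def
proof (intro conjI ballI allI impI)
  show "closed_span X S \<subseteq> carr X"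
    using closed_span_minimal[OF closed_subspace_carr assms] .
  show "\<zero> \<in> closed_span X S"
    by (rule closed_spanI) (simp add: closed_subspace_def)
  fix x assume x: "x \<in> closed_span X S"
  then have mem: "x \<in> W" if "closed_subspace X W" "S \<subseteq> W" for W
    using closed_span_minimal that by blast
  show "c \<odot> x \<in> closed_span X S" for c
    by (rule closed_spanI) (metis closed_subspace_def mem)
  fix y assume y: "y \<in> closed_span X S"
  show "x \<oplus> y \<in> closed_span X S"
    by (rule closed_spanI) (metis closed_subspace_def mem subsetD[OF closed_span_minimal y])
next
  fix T l assume T: "range T \<subseteq> closed_span X S \<and> l \<in> carr X \<and> (\<lambda>n. vdist X (T n) l) \<longlonglongrightarrow> 0"
  show "l \<in> closed_span X S"
  proof (rule closed_spanI)
    fix W assume W: "closed_subspace X W" "S \<subseteq> W"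
    then have "range T \<subseteq> W" using T closed_span_minimal by blast
    then show "l \<in> W" using T W(1) unfolding closed_subspace_def by blast
  qed
qed

lemma (in banach_space) closed_subspace_approx:
  assumes W: "closed_subspace X W" and x: "x \<in> carr X"
    and approx: "\<And>e. e > 0 \<Longrightarrow> \<exists>w\<in>W. \<parallel>x \<ominus> w\<parallel> < e"
  shows "x \<in> W"
proof -
  have "\<forall>n. \<exists>w\<in>W. \<parallel>x \<ominus> w\<parallel> < 1 / real (Suc n)" using approx by simp
  then obtain S where S: "\<And>n. S n \<in> W" "\<And>n. \<parallel>x \<ominus> S n\<parallel> < 1 / real (Suc n)" by metis
  have SX: "S n \<in> carr X" for n using W S(1) by (auto simp: closed_subspace_def)
  have "(\<lambda>n. vdist X (S n) x) \<longlonglongrightarrow> 0"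
  proof (rule Lim_null_comparison)
    show "\<forall>\<^sub>F n in sequentially. norm (vdist X (S n) x) \<le> 1 / real (Suc n)"
      using S(2) SX x norm_diff_commute[of "S _" x]
      by (auto simp: vdist_def less_imp_le)
    show "(\<lambda>n. 1 / real (Suc n)) \<longlonglongrightarrow> 0" by (rule LIMSEQ_Suc[OF lim_1_over_n])
  qed
  then show ?thesis using W S(1) x unfolding closed_subspace_def by blast
qed

lemma bounded_opI:
  assumes "\<And>x. x \<in> carr V \<Longrightarrow> T x \<in> carr V"
    "\<And>x y. \<lbrakk>x \<in> carr V; y \<in> carr V\<rbrakk> \<Longrightarrow> T (x \<oplus>\<^bsub>V\<^esub> y) = T x \<oplus>\<^bsub>V\<^esub> T y"
    "\<And>c x. x \<in> carr V \<Longrightarrow> T (c \<odot>\<^bsub>V\<^esub> x) = c \<odot>\<^bsub>V\<^esub> T x"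
    "\<And>x. x \<in> carr V \<Longrightarrow> \<parallel>T x\<parallel>\<^bsub>V\<^esub> \<le> M * \<parallel>x\<parallel>\<^bsub>V\<^esub>"
  shows "bounded_op V T"
  using assms unfolding bounded_op_def by blast

lemma bounded_opD:
  assumes "bounded_op V T"
  shows "x \<in> carr V \<Longrightarrow> T x \<in> carr V"
    and "\<lbrakk>x \<in> carr V; y \<in> carr V\<rbrakk> \<Longrightarrow> T (x \<oplus>\<^bsub>V\<^esub> y) = T x \<oplus>\<^bsub>V\<^esub> T y"
    and "x \<in> carr V \<Longrightarrow> T (c \<odot>\<^bsub>V\<^esub> x) = c \<odot>\<^bsub>V\<^esub> T x"
  using assms unfolding bounded_op_def by blast+

context banach_space
begin

lemma bounded_op_zero: "bounded_op X T \<Longrightarrow> T \<zero> = \<zero>"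
  by (metis bounded_opD(1,3) scale_zero zero_closed)

lemma op_norm_le:
  assumes "\<And>x. x \<in> carr X \<Longrightarrow> \<parallel>T x\<parallel> \<le> M * \<parallel>x\<parallel>" "0 \<le> M"
  shows "op_norm X T \<le> M"
  unfolding op_norm_def
proof (rule cSup_least)
  show "{\<parallel>T x\<parallel> |x. x \<in> carr X \<and> \<parallel>x\<parallel> \<le> 1} \<noteq> {}"
    using zero_closed norm_zero by force
  fix r assume "r \<in> {\<parallel>T x\<parallel> |x. x \<in> carr X \<and> \<parallel>x\<parallel> \<le> 1}"
  then obtain x where x: "x \<in> carr X" "\<parallel>x\<parallel> \<le> 1" "r = \<parallel>T x\<parallel>" by blast
  have "M * \<parallel>x\<parallel> \<le> M * 1" using x(2) assms(2) by (intro mult_left_mono)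
  then show "r \<le> M" using assms(1)[OF x(1)] x(3) by simp
qed

lemma op_norm_bdd:
  assumes T: "bounded_op X T"
  shows "bdd_above {\<parallel>T x\<parallel> |x. x \<in> carr X \<and> \<parallel>x\<parallel> \<le> 1}"
proof -
  obtain M where M: "\<And>x. x \<in> carr X \<Longrightarrow> \<parallel>T x\<parallel> \<le> M * \<parallel>x\<parallel>"
    using T unfolding bounded_op_def by blast
  show ?thesis
  proof (rule bdd_aboveI)
    fix r assume "r \<in> {\<parallel>T x\<parallel> |x. x \<in> carr X \<and> \<parallel>x\<parallel> \<le> 1}"
    then obtain z where z: "z \<in> carr X" "\<parallel>z\<parallel> \<le> 1" "r = \<parallel>T z\<parallel>" by blast
    have "M * \<parallel>z\<parallel> \<le> \<bar>M\<bar> * 1"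
      using z by (intro mult_mono) auto
    then show "r \<le> \<bar>M\<bar>" using M[OF z(1)] z(3) by simp
  qed
qed

lemma op_norm_upper: "\<lbrakk>bounded_op X T; x \<in> carr X; \<parallel>x\<parallel> \<le> 1\<rbrakk> \<Longrightarrow> \<parallel>T x\<parallel> \<le> op_norm X T"
  unfolding op_norm_def by (rule cSup_upper[OF _ op_norm_bdd]) auto

lemma op_norm_bound:
  assumes T: "bounded_op X T" and x: "x \<in> carr X"
  shows "\<parallel>T x\<parallel> \<le> op_norm X T * \<parallel>x\<parallel>"
proof (cases "x = \<zero>")
  case True
  then show ?thesis using bounded_op_zero[OF T] by simp
next
  case False
  have n0: "\<parallel>x\<parallel> > 0" using False norm_eq_zero[OF x] norm_nonneg[OF x] by linarith
  define y where "y = complex_of_real (1 / \<parallel>x\<parallel>) \<odot> x"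
  have y: "y \<in> carr X" "\<parallel>y\<parallel> = 1" using x n0 by (auto simp: y_def norm_scale norm_divide)
  have "\<parallel>T y\<parallel> \<le> op_norm X T" using op_norm_upper[OF T y(1)] y(2) by simp
  moreover have "\<parallel>T y\<parallel> = \<parallel>T x\<parallel> / \<parallel>x\<parallel>"
    using bounded_opD(1,3)[OF T] x n0 by (simp add: y_def norm_scale norm_divide)
  ultimately show ?thesis using n0 by (simp add: field_simps)
qed

lemma op_norm_nonneg: "bounded_op X T \<Longrightarrow> 0 \<le> op_norm X T"
  using op_norm_upper[of T \<zero>] bounded_op_zero[of T] by simp

lemma bounded_op_comp:
  assumes S: "bounded_op X S" and T: "bounded_op X T"
  shows "bounded_op X (\<lambda>v. S (T v))"
proof -
  obtain M where M: "\<And>x. x \<in> carr X \<Longrightarrow> \<parallel>S x\<parallel> \<le> M * \<parallel>x\<parallel>" using S unfolding bounded_op_def by blast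
  obtain N where N: "\<And>x. x \<in> carr X \<Longrightarrow> \<parallel>T x\<parallel> \<le> N * \<parallel>x\<parallel>" using T unfolding bounded_op_def by blast
  show ?thesis
  proof (rule bounded_opI)
    fix x assume x: "x \<in> carr X"
    have "\<parallel>S (T x)\<parallel> \<le> M * \<parallel>T x\<parallel>" using M bounded_opD(1)[OF T x] .
    also have "\<dots> \<le> \<bar>M\<bar> * \<parallel>T x\<parallel>" using bounded_opD(1)[OF T x] by (intro mult_right_mono) auto
    also have "\<dots> \<le> \<bar>M\<bar> * (N * \<parallel>x\<parallel>)" using N[OF x] by (rule mult_left_mono) simp
    finally show "\<parallel>S (T x)\<parallel> \<le> (\<bar>M\<bar> * N) * \<parallel>x\<parallel>" by (simp add: mult.assoc)
  qed (use bounded_opD[OF S] bounded_opD[OF T] in simp_all)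
qed

lemma closed_subspace_zero: "closed_subspace X {\<zero>}"
  unfolding closed_subspace_def
proof (intro conjI ballI allI impI)
  fix S l assume "range S \<subseteq> {\<zero>} \<and> l \<in> carr X \<and> (\<lambda>n. vdist X (S n) l) \<longlonglongrightarrow> 0"
  then have S: "S n = \<zero>" "l \<in> carr X" "(\<lambda>n. vdist X (S n) l) \<longlonglongrightarrow> 0" for n by auto
  have "l = \<zero>"
    by (rule limit_unique[of S]) (use S in \<open>auto simp: vdist_def\<close>)
  then show "l \<in> {\<zero>}" by simp
qed auto

lemma closed_subspace_vimage:
  assumes W: "closed_subspace X W" and T: "\<And>i. i \<in> I \<Longrightarrow> bounded_op X (T i)"
  shows "closed_subspace X {v \<in> carr X. \<forall>i\<in>I. T i v \<in> W}"
  unfolding closed_subspace_def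
proof (intro conjI ballI allI impI)
  have W': "\<zero> \<in> W" "\<And>x y. x \<in> W \<Longrightarrow> y \<in> W \<Longrightarrow> x \<oplus> y \<in> W" "\<And>c x. x \<in> W \<Longrightarrow> c \<odot> x \<in> W"
    using W by (auto simp: closed_subspace_def)
  show "\<zero> \<in> {v \<in> carr X. \<forall>i\<in>I. T i v \<in> W}" using W' bounded_op_zero[OF T] by simp
  show "x \<oplus> y \<in> {v \<in> carr X. \<forall>i\<in>I. T i v \<in> W}"
    if "x \<in> {v \<in> carr X. \<forall>i\<in>I. T i v \<in> W}" "y \<in> {v \<in> carr X. \<forall>i\<in>I. T i v \<in> W}" for x y
    using that W'(2) bounded_opD(2)[OF T] by simp
  show "c \<odot> x \<in> {v \<in> carr X. \<forall>i\<in>I. T i v \<in> W}"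
    if "x \<in> {v \<in> carr X. \<forall>i\<in>I. T i v \<in> W}" for c x
    using that W'(3) bounded_opD(3)[OF T] by simp
  fix S l assume "range S \<subseteq> {v \<in> carr X. \<forall>i\<in>I. T i v \<in> W} \<and> l \<in> carr X \<and> (\<lambda>n. vdist X (S n) l) \<longlonglongrightarrow> 0"
  then have S: "range S \<subseteq> {v \<in> carr X. \<forall>i\<in>I. T i v \<in> W}" and l: "l \<in> carr X"
    and lim: "(\<lambda>n. vdist X (S n) l) \<longlonglongrightarrow> 0" by auto
  have S: "S n \<in> carr X" "i \<in> I \<Longrightarrow> T i (S n) \<in> W" for n i using S by auto
  have "T i l \<in> W" if i: "i \<in> I" for i
  proof -
    obtain M where M: "\<And>x. x \<in> carr X \<Longrightarrow> \<parallel>T i x\<parallel> \<le> M * \<parallel>x\<parallel>" using T[OF i] unfolding bounded_op_def by blast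
    note Ti = bounded_opD[OF T[OF i]]
    have "vdist X (T i (S n)) (T i l) \<le> M * vdist X (S n) l" for n
      using M[of "S n \<ominus> l"] S(1)[of n] l Ti(2)[of "S n" "(-1) \<odot> l"] Ti(3)[OF l] by (simp add: vdist_def)
    then have "(\<lambda>n. vdist X (T i (S n)) (T i l)) \<longlonglongrightarrow> 0"
      by (intro null_le[OF tendsto_mult_right_zero[OF lim, of M]]) (use Ti(1) S(1) l in \<open>auto simp: vdist_def\<close>)
    moreover have "range (\<lambda>n. T i (S n)) \<subseteq> W" using S(2)[OF i] by auto
    ultimately show ?thesis using W Ti(1)[OF l] unfolding closed_subspace_def by blast
  qed
  then show "l \<in> {v \<in> carr X. \<forall>i\<in>I. T i v \<in> W}" using l by simp
qed auto

lemma closed_subspace_annihilator: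
  assumes "\<And>i. i \<in> I \<Longrightarrow> bounded_op X (T i)"
  shows "closed_subspace X {v \<in> carr X. \<forall>i\<in>I. T i v = \<zero>}"
  using closed_subspace_vimage[OF closed_subspace_zero assms] by simp

end

section \<open>Positive semidefinite sesquilinear forms\<close>

locale semi_inner = complex_space E for E :: "('a, 'm) vspace_scheme" (structure) +
  fixes s :: "'a \<Rightarrow> 'a \<Rightarrow> complex"
  assumes form_add: "\<lbrakk>x \<in> carr E; y \<in> carr E; z \<in> carr E\<rbrakk> \<Longrightarrow> s (x \<oplus> y) z = s x z + s y z"
    and form_scale: "\<lbrakk>x \<in> carr E; y \<in> carr E\<rbrakk> \<Longrightarrow> s (c \<odot> x) y = c * s x y"
    and form_cnj: "\<lbrakk>x \<in> carr E; y \<in> carr E\<rbrakk> \<Longrightarrow> s y x = cnj (s x y)"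
    and form_pos: "x \<in> carr E \<Longrightarrow> 0 \<le> Re (s x x)"
begin

definition seminorm :: "'a \<Rightarrow> real" where
  "seminorm x = sqrt (Re (s x x))"

lemma form_add_right: "\<lbrakk>x \<in> carr E; y \<in> carr E; z \<in> carr E\<rbrakk> \<Longrightarrow> s z (x \<oplus> y) = s z x + s z y"
  using form_add[of x y z] form_cnj[of x z] form_cnj[of y z] form_cnj[of "x \<oplus> y" z] by simp

lemma form_scale_right: "\<lbrakk>x \<in> carr E; y \<in> carr E\<rbrakk> \<Longrightarrow> s y (c \<odot> x) = cnj c * s y x"
  using form_scale[of x y c] form_cnj[of x y] form_cnj[of "c \<odot> x" y] by simp

lemma form_diff: "\<lbrakk>x \<in> carr E; y \<in> carr E; z \<in> carr E\<rbrakk> \<Longrightarrow> s (x \<ominus> y) z = s x z - s y z"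
  by (simp add: form_add form_scale)

lemma form_diff_right: "\<lbrakk>x \<in> carr E; y \<in> carr E; z \<in> carr E\<rbrakk> \<Longrightarrow> s z (x \<ominus> y) = s z x - s z y"
  by (simp add: form_add_right form_scale_right)

lemma form_zero [simp]: "x \<in> carr E \<Longrightarrow> s \<zero> x = 0" "x \<in> carr E \<Longrightarrow> s x \<zero> = 0"
  using form_scale[of x x 0] form_scale_right[of x x 0] by simp_all

lemma form_self: "x \<in> carr E \<Longrightarrow> s x x = complex_of_real ((seminorm x)\<^sup>2)"
  using form_cnj[of x x] form_pos[of x] by (simp add: seminorm_def complex_eq_iff)

lemma form_expand:
  assumes "x \<in> carr E" "y \<in> carr E"
  shows "Re (s (x \<oplus> c \<odot> y) (x \<oplus> c \<odot> y)) = Re (s x x) + 2 * Re (cnj c * s x y) + (cmod c)\<^sup>2 * Re (s y y)"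
proof -
  have "s (x \<oplus> c \<odot> y) (x \<oplus> c \<odot> y) = s x x + cnj c * s x y + cnj (cnj c * s x y) + (c * cnj c) * s y y"
    using assms form_cnj[of x y]
    by (simp add: form_add form_scale form_add_right form_scale_right algebra_simps)
  moreover have "c * cnj c = complex_of_real ((cmod c)\<^sup>2)" by (rule complex_norm_square[symmetric])
  ultimately show ?thesis by simp
qed

lemma cauchy_schwarz_sq:
  assumes "x \<in> carr E" "y \<in> carr E"
  shows "(cmod (s x y))\<^sup>2 \<le> Re (s x x) * Re (s y y)"
proof -
  define b where "b = (cmod (s x y))\<^sup>2"
  define d where "d = Re (s y y)"
  define a where "a = Re (s x x)"
  have q: "0 \<le> a - 2 * t * b + t\<^sup>2 * b * d" for t :: real
  proof -
    have "0 \<le> Re (s (x \<oplus> (- t * s x y) \<odot> y) (x \<oplus> (- t * s x y) \<odot> y))"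
      using assms by (intro form_pos) auto
    also have "\<dots> = a - 2 * t * b + t\<^sup>2 * b * d"
    proof -
      have "cnj (- t * s x y) * s x y = complex_of_real (- t * b)"
        using complex_norm_square[of "s x y"] by (simp add: b_def mult.commute)
      moreover have "(cmod (- t * s x y))\<^sup>2 = t\<^sup>2 * b"
        by (simp add: b_def norm_mult power_mult_distrib)
      ultimately show ?thesis
        unfolding form_expand[OF assms] a_def d_def by (simp only: Re_complex_of_real)
    qed
    finally show ?thesis .
  qed
  have d0: "0 \<le> d" and b0: "0 \<le> b" using form_pos assms by (auto simp: d_def b_def)
  show ?thesis
  proof (cases "d = 0")
    case True
    have "b = 0"
    proof (rule ccontr)
      assume "b \<noteq> 0"
      then show False using q[of "(a + 1) / (2 * b)"] True b0 by (simp add: field_simps)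
    qed
    then show ?thesis using b_def d_def True by simp
  next
    case False
    then have "0 \<le> a - b / d" using q[of "1 / d"] by (simp add: power2_eq_square field_simps)
    then show ?thesis using False d0 by (simp add: a_def b_def d_def field_simps)
  qed
qed

lemma cauchy_schwarz:
  assumes "x \<in> carr E" "y \<in> carr E"
  shows "cmod (s x y) \<le> seminorm x * seminorm y"
  using real_sqrt_le_mono[OF cauchy_schwarz_sq[OF assms]] by (simp add: seminorm_def real_sqrt_mult)

lemma seminorm_nonneg [simp]: "x \<in> carr E \<Longrightarrow> 0 \<le> seminorm x"
  by (simp add: seminorm_def form_pos)

lemma seminorm_sq: "x \<in> carr E \<Longrightarrow> (seminorm x)\<^sup>2 = Re (s x x)"
  by (simp add: seminorm_def form_pos)

lemma seminorm_scale: "x \<in> carr E \<Longrightarrow> seminorm (c \<odot> x) = cmod c * seminorm x"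
proof -
  assume x: "x \<in> carr E"
  have "s (c \<odot> x) (c \<odot> x) = complex_of_real ((cmod c)\<^sup>2) * s x x"
    unfolding complex_norm_square using x by (simp add: form_scale form_scale_right)
  then show ?thesis by (simp add: seminorm_def real_sqrt_mult)
qed

lemma seminorm_zero [simp]: "seminorm \<zero> = 0"
  by (simp add: seminorm_def)

lemma seminorm_triangle:
  assumes "x \<in> carr E" "y \<in> carr E"
  shows "seminorm (x \<oplus> y) \<le> seminorm x + seminorm y"
proof (rule power2_le_imp_le)
  have "(seminorm (x \<oplus> y))\<^sup>2 = (seminorm x)\<^sup>2 + 2 * Re (s x y) + (seminorm y)\<^sup>2"
    using form_expand[of x y 1] assms by (simp add: seminorm_sq)
  also have "Re (s x y) \<le> seminorm x * seminorm y"
    using cauchy_schwarz[OF assms] complex_Re_le_cmod order_trans by blast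
  finally show "(seminorm (x \<oplus> y))\<^sup>2 \<le> (seminorm x + seminorm y)\<^sup>2"
    by (simp add: power2_sum)
qed (use assms in auto)

lemma seminorm_triangle_sub:
  assumes "x \<in> carr E" "y \<in> carr E"
  shows "seminorm x \<le> seminorm y + seminorm (x \<ominus> y)"
  using seminorm_triangle[of "x \<ominus> y" y] assms by (simp add: diff_add_cancel)

lemma parallelogram_half:
  assumes "x \<in> carr E" "y \<in> carr E"
  shows "(seminorm ((1/2) \<odot> (x \<oplus> y)))\<^sup>2 + (seminorm ((1/2) \<odot> (x \<ominus> y)))\<^sup>2
    = ((seminorm x)\<^sup>2 + (seminorm y)\<^sup>2) / 2"
  using form_expand[of x y 1] form_expand[of x y "-1"] assms
  by (simp add: seminorm_scale power_mult_distrib seminorm_sq field_simps)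

end

section \<open>Hilbert spaces\<close>

sublocale hilbert_space \<subseteq> form: semi_inner V "vinner V"
  by unfold_locales (auto simp: inner_add inner_scale inner_norm intro: inner_cnj)

context hilbert_space
begin

lemma form_seminorm [simp]: "x \<in> carr V \<Longrightarrow> form.seminorm x = \<parallel>x\<parallel>"
  by (simp add: form.seminorm_def inner_norm)

lemma inner_cauchy_schwarz: "\<lbrakk>x \<in> carr V; y \<in> carr V\<rbrakk> \<Longrightarrow> cmod (vinner V x y) \<le> \<parallel>x\<parallel> * \<parallel>y\<parallel>"
  using form.cauchy_schwarz[of x y] by simp

lemma inner_self_zero: "x \<in> carr V \<Longrightarrow> vinner V x x = 0 \<longleftrightarrow> x = \<zero>"
  using inner_norm[of x] norm_eq_zero[of x] by simp

lemma inner_tendsto: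
  assumes "range S \<subseteq> carr V" "l \<in> carr V" "y \<in> carr V" "(\<lambda>n. vdist V (S n) l) \<longlonglongrightarrow> 0"
  shows "(\<lambda>n. vinner V (S n) y) \<longlonglongrightarrow> vinner V l y"
proof -
  have S: "S n \<in> carr V" for n using assms(1) by auto
  have "cmod (vinner V (S n) y - vinner V l y) \<le> vdist V (S n) l * \<parallel>y\<parallel>" for n
    using inner_cauchy_schwarz[of "S n \<ominus> l" y] S[of n] assms(2,3)
    by (simp add: vdist_def form.form_diff)
  then have "(\<lambda>n. vinner V (S n) y - vinner V l y) \<longlonglongrightarrow> 0"
    by (intro Lim_null_comparison[OF always_eventually tendsto_mult_left_zero[OF assms(4)]] allI)
  then show ?thesis by (simp add: LIM_zero_iff)
qed

text \<open>
  The functional \<open>2 Re (\<phi> d) - \<parallel>d\<parallel>\<^sup>2\<close> is bounded above on D and, by the parallelogram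
  law, its maximising sequences are Cauchy; their limit represents \<open>\<phi>\<close>. For closed D this
  yields orthogonal projections, for dense D the cyclic vector of a GNS representation.
\<close>

lemma riesz:
  assumes D: "D \<subseteq> carr V" "\<zero> \<in> D" "\<And>x y. x \<in> D \<Longrightarrow> y \<in> D \<Longrightarrow> x \<oplus> y \<in> D"
    "\<And>c x. x \<in> D \<Longrightarrow> c \<odot> x \<in> D"
    and \<phi>: "\<And>x y. x \<in> D \<Longrightarrow> y \<in> D \<Longrightarrow> \<phi> (x \<oplus> y) = \<phi> x + \<phi> y"
    "\<And>c x. x \<in> D \<Longrightarrow> \<phi> (c \<odot> x) = c * \<phi> x"
    "\<And>x. x \<in> D \<Longrightarrow> cmod (\<phi> x) \<le> C * \<parallel>x\<parallel>"
  obtains \<xi> S where "\<xi> \<in> carr V" "range S \<subseteq> D" "(\<lambda>n. vdist V (S n) \<xi>) \<longlonglongrightarrow> 0"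
    "\<And>x. x \<in> D \<Longrightarrow> \<phi> x = vinner V x \<xi>"
proof -
  define J where "J d = 2 * Re (\<phi> d) - \<parallel>d\<parallel>\<^sup>2" for d
  have DV: "d \<in> D \<Longrightarrow> d \<in> carr V" for d using D(1) by auto
  have J_bdd: "bdd_above (J ` D)"
  proof (rule bdd_aboveI2)
    fix d assume d: "d \<in> D"
    have "Re (\<phi> d) \<le> C * \<parallel>d\<parallel>" using \<phi>(3)[OF d] complex_Re_le_cmod order_trans by blast
    moreover have "0 \<le> (C - \<parallel>d\<parallel>)\<^sup>2" by simp
    ultimately show "J d \<le> C\<^sup>2" by (simp add: J_def power2_eq_square algebra_simps)
  qed
  define m where "m = Sup (J ` D)"
  have Jm: "J d \<le> m" if "d \<in> D" for d
    unfolding m_def using that J_bdd by (intro cSup_upper) auto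
  have "\<exists>d\<in>D. m - 1 / real (Suc n) < J d" for n
    using less_cSupD[of "J ` D" "m - 1 / real (Suc n)"] D(2) unfolding m_def by force
  then obtain S where S: "\<And>n. S n \<in> D" "\<And>n. m - 1 / real (Suc n) < J (S n)" by metis
  have SV: "S n \<in> carr V" for n using S(1) DV by auto
  \<comment> \<open>The functional is strictly concave, so almost maximisers are close to each other.\<close>
  have mid: "(\<parallel>d \<ominus> d'\<parallel> / 2)\<^sup>2 \<le> e" if d: "d \<in> D" "d' \<in> D" "m - e \<le> J d" "m - e \<le> J d'" for d d' e
  proof -
    have in_V: "d \<in> carr V" "d' \<in> carr V" using d DV by auto
    have "(1/2) \<odot> (d \<oplus> d') \<in> D" using D(3,4) d by blast
    then have "J ((1/2) \<odot> (d \<oplus> d')) \<le> m" by (rule Jm)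
    moreover have "J ((1/2) \<odot> (d \<oplus> d')) = (J d + J d') / 2 + (\<parallel>d \<ominus> d'\<parallel> / 2)\<^sup>2"
      using form.parallelogram_half[OF in_V] in_V d \<phi>(1,2) D(3)
      by (simp add: J_def norm_scale power_divide field_simps)
    ultimately have "(J d + J d') / 2 + (\<parallel>d \<ominus> d'\<parallel> / 2)\<^sup>2 \<le> m" by simp
    moreover have "m - e \<le> (J d + J d') / 2" using d(3,4) by simp
    ultimately show ?thesis by (smt (verit))
  qed
  have "cauchy_in V S"
    unfolding cauchy_in_def
  proof (intro conjI allI impI)
    show "range S \<subseteq> carr V" using SV by auto
    fix e :: real assume e: "e > 0"
    obtain N :: nat where N: "1 / real (Suc N) < (e/2)\<^sup>2" using e nat_approx_posE[of "(e/2)\<^sup>2"] by force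
    have "vdist V (S i) (S j) < e" if "i \<ge> N" "j \<ge> N" for i j
    proof -
      have "1 / real (Suc i) \<le> 1 / real (Suc N)" "1 / real (Suc j) \<le> 1 / real (Suc N)"
        using that by (auto intro!: divide_left_mono)
      then have "(\<parallel>S i \<ominus> S j\<parallel> / 2)\<^sup>2 \<le> 1 / real (Suc N)"
        using S(2)[of i] S(2)[of j] by (intro mid S(1)) linarith+
      then have "(\<parallel>S i \<ominus> S j\<parallel> / 2)\<^sup>2 < (e/2)\<^sup>2" using N by linarith
      then have "\<parallel>S i \<ominus> S j\<parallel> / 2 < e / 2" by (rule power2_less_imp_less) (use e in simp)
      then show ?thesis by (simp add: vdist_def)
    qed
    then show "\<exists>N. \<forall>m\<ge>N. \<forall>n\<ge>N. vdist V (S m) (S n) < e" by blast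
  qed
  then obtain \<xi> where \<xi>: "\<xi> \<in> carr V" "(\<lambda>n. vdist V (S n) \<xi>) \<longlonglongrightarrow> 0"
    using complete by blast
  have re: "Re (\<phi> w) = Re (vinner V w \<xi>)" if w: "w \<in> D" for w
  proof -
    have wV: "w \<in> carr V" using w DV by auto
    have quad: "2 * t * (Re (\<phi> w) - Re (vinner V w \<xi>)) \<le> t\<^sup>2 * \<parallel>w\<parallel>\<^sup>2" for t :: real
    proof -
      have "J (S n \<oplus> complex_of_real t \<odot> w) \<le> m" for n
        using D(3,4) S(1) w by (intro Jm) blast
      moreover have "J (S n \<oplus> complex_of_real t \<odot> w)
        = J (S n) + 2 * t * (Re (\<phi> w) - Re (vinner V (S n) w)) - t\<^sup>2 * \<parallel>w\<parallel>\<^sup>2" for n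
        using form.form_expand[OF SV wV, of n "complex_of_real t"] \<phi>(1,2) S(1) D(4) w SV wV
          inner_norm[OF SV[of n]] inner_norm[OF wV] inner_norm[of "S n \<oplus> complex_of_real t \<odot> w"]
        by (simp add: J_def algebra_simps)
      ultimately have below: "2 * t * (Re (\<phi> w) - Re (vinner V (S n) w)) - t\<^sup>2 * \<parallel>w\<parallel>\<^sup>2 \<le> 1 / real (Suc n)" for n
        using S(2)[of n] by (smt (verit))
      have lim: "(\<lambda>n. 2 * t * (Re (\<phi> w) - Re (vinner V (S n) w)) - t\<^sup>2 * \<parallel>w\<parallel>\<^sup>2)
        \<longlonglongrightarrow> 2 * t * (Re (\<phi> w) - Re (vinner V \<xi> w)) - t\<^sup>2 * \<parallel>w\<parallel>\<^sup>2"
        using inner_tendsto[OF _ \<xi>(1) wV \<xi>(2)] SV by (intro tendsto_intros) auto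
      have "2 * t * (Re (\<phi> w) - Re (vinner V \<xi> w)) - t\<^sup>2 * \<parallel>w\<parallel>\<^sup>2 \<le> 0"
        by (rule LIMSEQ_le[OF lim LIMSEQ_Suc[OF lim_1_over_n]]) (use below in blast)
      moreover have "Re (vinner V \<xi> w) = Re (vinner V w \<xi>)"
        using inner_cnj[OF \<xi>(1) wV] by simp
      ultimately show ?thesis by simp
    qed
    define r where "r = Re (\<phi> w) - Re (vinner V w \<xi>)"
    define b where "b = \<parallel>w\<parallel>\<^sup>2 + 1"
    have b: "b > 0" by (simp add: b_def add_nonneg_pos)
    have "2 * (r / b) * r \<le> (r / b)\<^sup>2 * \<parallel>w\<parallel>\<^sup>2" using quad[of "r / b"] by (simp add: r_def)
    also have "\<dots> \<le> (r / b)\<^sup>2 * b" by (intro mult_left_mono) (auto simp: b_def)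
    finally have "2 * r\<^sup>2 \<le> r\<^sup>2" using b by (simp add: power2_eq_square field_simps)
    then show ?thesis by (simp add: r_def)
  qed
  have "\<phi> w = vinner V w \<xi>" if w: "w \<in> D" for w
  proof (rule complex_eqI)
    show "Re (\<phi> w) = Re (vinner V w \<xi>)" using re[OF w] .
    show "Im (\<phi> w) = Im (vinner V w \<xi>)"
      using re[OF D(4)[OF w, of \<i>]] \<phi>(2)[OF w, of \<i>] inner_scale[OF DV[OF w] \<xi>(1), of \<i>] by simp
  qed
  then show thesis using that \<xi> S(1) by blast
qed

text \<open>
  The vector y represents the functional \<open>w \<mapsto> \<langle>w, x\<rangle>\<close> on W.
\<close>

lemma projection:
  assumes W: "closed_subspace V W" and x: "x \<in> carr V"
  obtains y where "y \<in> W" "\<And>w. w \<in> W \<Longrightarrow> vinner V w x = vinner V w y"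
proof -
  have D: "W \<subseteq> carr V" "\<zero> \<in> W" "\<And>x y. x \<in> W \<Longrightarrow> y \<in> W \<Longrightarrow> x \<oplus> y \<in> W"
    "\<And>c x. x \<in> W \<Longrightarrow> c \<odot> x \<in> W"
    using W by (auto simp: closed_subspace_def)
  have DV: "w \<in> W \<Longrightarrow> w \<in> carr V" for w using D(1) by auto
  obtain y S where y: "y \<in> carr V" "range S \<subseteq> W" "(\<lambda>n. vdist V (S n) y) \<longlonglongrightarrow> 0"
    "\<And>w. w \<in> W \<Longrightarrow> vinner V w x = vinner V w y"
    by (rule riesz[OF D, where \<phi> = "\<lambda>w. vinner V w x" and C = "\<parallel>x\<parallel>"])
      (use x DV inner_cauchy_schwarz in \<open>auto simp: inner_add inner_scale mult.commute\<close>)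
  have "y \<in> W" using W y(1-3) unfolding closed_subspace_def by blast
  then show thesis using that y(4) by blast
qed

lemma in_closed_subspace_if_orthogonal:
  assumes W: "closed_subspace V W" and x: "x \<in> carr V"
    and orth: "\<And>y. \<lbrakk>y \<in> carr V; \<And>w. w \<in> W \<Longrightarrow> vinner V w y = 0\<rbrakk> \<Longrightarrow> vinner V x y = 0"
  shows "x \<in> W"
proof -
  obtain y where y: "y \<in> W" "\<And>w. w \<in> W \<Longrightarrow> vinner V w x = vinner V w y"
    using projection[OF W x] by blast
  have WV: "w \<in> W \<Longrightarrow> w \<in> carr V" for w using W by (auto simp: closed_subspace_def)
  have yV: "y \<in> carr V" using WV y(1) .
  have "vinner V w (x \<ominus> y) = 0" if "w \<in> W" for w
    using y(2)[OF that] form.form_diff_right[OF x yV WV[OF that]] by simp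
  then have "vinner V x (x \<ominus> y) = 0" "vinner V y (x \<ominus> y) = 0"
    using orth[of "x \<ominus> y"] x yV y(1) by auto
  then have "vinner V (x \<ominus> y) (x \<ominus> y) = 0"
    using form.form_diff[OF x yV, of "x \<ominus> y"] x yV by simp
  then have "x = y" using inner_self_zero[of "x \<ominus> y"] x yV by (simp add: diff_eq_zero)
  then show ?thesis using y(1) by simp
qed

end

section \<open>Approximate units in C*-algebras\<close>

context cstar_algebra
begin

lemmas alg_closed [simp, intro] = mult_closed star_closed

lemma mult_zero [simp]: "a \<in> carr A \<Longrightarrow> a \<otimes> \<zero> = \<zero>" "a \<in> carr A \<Longrightarrow> \<zero> \<otimes> a = \<zero>"
  using mult_scale_right[of a a 0] mult_scale_left[of a a 0] by simp_all

lemma star_zero [simp]: "astar A \<zero> = \<zero>"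
  using star_scale[of \<zero> 0] by simp

declare star_star [simp]

lemma norm_star [simp]:
  assumes "a \<in> carr A"
  shows "\<parallel>astar A a\<parallel> = \<parallel>a\<parallel>"
proof -
  have le: "\<parallel>b\<parallel> \<le> \<parallel>astar A b\<parallel>" if b: "b \<in> carr A" for b
  proof (cases "\<parallel>b\<parallel> = 0")
    case False
    have "\<parallel>b\<parallel> * \<parallel>b\<parallel> \<le> \<parallel>astar A b\<parallel> * \<parallel>b\<parallel>"
      using norm_mult[of "astar A b" b] cstar_identity[of b] b by (simp add: power2_eq_square)
    then show ?thesis using False norm_nonneg[OF b] by (simp add: mult_le_cancel_right)
  qed (use b in simp)
  show ?thesis using le[of a] le[of "astar A a"] assms by simp
qed

lemma mult_diff_right: "\<lbrakk>a \<in> carr A; b \<in> carr A; c \<in> carr A\<rbrakk> \<Longrightarrow> a \<otimes> (b \<ominus> c) = a \<otimes> b \<ominus> a \<otimes> c"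
  by (simp add: mult_add_right mult_scale_right)

lemma star_diff: "\<lbrakk>a \<in> carr A; b \<in> carr A\<rbrakk> \<Longrightarrow> astar A (a \<ominus> b) = astar A a \<ominus> astar A b"
  by (simp add: star_add star_scale)

text \<open>
  With a unit adjoined, the next lemma computes \<open>(1 + w')\<^sup>*(1 + w')\<close> for
  \<open>1 + w' = (1 + z)(1 + w)\<close> and skew-adjoint z: as \<open>(1 + z)\<^sup>*(1 + z) = 1 + z\<^sup>*z\<close>, the first
  order terms cancel.
\<close>

lemma almost_unitary_step:
  assumes w: "w \<in> carr A" and z: "z \<in> carr A" "astar A z = (- 1) \<odot> z"
  defines "d \<equiv> z \<oplus> z \<otimes> w" and "Y \<equiv> \<lambda>w. astar A w \<otimes> w \<oplus> (w \<oplus> astar A w)"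
  shows "Y (w \<oplus> d) = Y w \<oplus> astar A d \<otimes> d"
proof -
  have d: "d \<in> carr A" using w z by (simp add: d_def)
  define q where "q = astar A w \<otimes> d \<oplus> d"
  have q: "q \<in> carr A" using w d by (simp add: q_def)
  have "astar A d \<otimes> w \<oplus> astar A d = (- 1) \<odot> q"
    unfolding q_def d_def using w z
    by (simp add: star_add star_mult mult_add_left mult_add_right mult_scale_left mult_scale_right
        scale_add_right mult_assoc add_ac)
  then have "(astar A w \<otimes> d \<oplus> d) \<oplus> (astar A d \<otimes> w \<oplus> astar A d) = \<zero>"
    using q by (simp flip: q_def)
  moreover have "Y (w \<oplus> d) =
      (Y w \<oplus> astar A d \<otimes> d) \<oplus> ((astar A w \<otimes> d \<oplus> d) \<oplus> (astar A d \<otimes> w \<oplus> astar A d))"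
    unfolding Y_def using w d
    by (simp add: star_add mult_add_left mult_add_right add_ac)
  ultimately show ?thesis using w d by (simp add: Y_def)
qed

text \<open>
  The elements \<open>w k\<close> below are \<open>(1 + z)\<^sup>k - 1\<close> for \<open>z = i t s\<close> with t small, so that
  \<open>1 + w k\<close> is close to the unitary \<open>exp (i k t s)\<close> and \<open>w k\<close> stays bounded. As
  \<open>z (1 + w 0) + \<dots> + z (1 + w (n - 1)) = w n\<close>, the average of the \<open>1 + w k\<close> for
  \<open>k < n\<close> is annihilated by s up to \<open>3 / (n t) = 3 / R\<close>, and e is 1 minus this average.
  This takes the place of functional calculus.
\<close>

lemma selfadjoint_approx:
  assumes s: "s \<in> carr A" "astar A s = s" and R: "R > 0"
  obtains e where "e \<in> carr A" "\<parallel>e\<parallel> \<le> 3" "\<parallel>s \<ominus> s \<otimes> e\<parallel> \<le> 3 / R"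
proof -
  obtain n :: nat where n: "16 * (R * \<parallel>s\<parallel>)\<^sup>2 + 1 < real n" using reals_Archimedean2 by blast
  have n0: "0 < real n" using n by (smt (verit) zero_le_power2)
  define t where "t = R / real n"
  have t: "t > 0" "real n * t = R" using R n0 by (auto simp: t_def)
  define z where "z = (\<i> * complex_of_real t) \<odot> s"
  have z: "z \<in> carr A" "astar A z = (- 1) \<odot> z" using s by (auto simp: z_def star_scale)
  have nz: "\<parallel>z\<parallel> = t * \<parallel>s\<parallel>" using s t by (simp add: z_def norm_scale Real_Vector_Spaces.norm_mult)
  define w where "w = rec_nat \<zero> (\<lambda>k x. x \<oplus> (z \<oplus> z \<otimes> x))"
  have w0: "w 0 = \<zero>" and wS: "w (Suc k) = w k \<oplus> (z \<oplus> z \<otimes> w k)" for k by (simp_all add: w_def)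
  have w: "w k \<in> carr A" for k by (induction k) (auto simp: w0 wS z)
  define Y where "Y x = astar A x \<otimes> x \<oplus> (x \<oplus> astar A x)" for x
  have Y: "Y x \<in> carr A" if "x \<in> carr A" for x using that by (simp add: Y_def)
  \<comment> \<open>\<open>Y x\<close> is \<open>(1 + x)\<^sup>*(1 + x) - 1\<close>, the defect of \<open>1 + x\<close> from being an isometry.\<close>
  have w_le_3: "\<parallel>x\<parallel> \<le> 3" if x: "x \<in> carr A" and "\<parallel>Y x\<parallel> \<le> 3" for x
  proof -
    have "astar A x \<otimes> x = Y x \<ominus> (x \<oplus> astar A x)"
      using x by (simp add: Y_def add_assoc)
    then have "\<parallel>x\<parallel>\<^sup>2 \<le> \<parallel>Y x\<parallel> + \<parallel>x \<oplus> astar A x\<parallel>"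
      using norm_diff_le[of "Y x" "x \<oplus> astar A x"] Y[OF x] x cstar_identity[of x] by simp
    also have "\<parallel>x \<oplus> astar A x\<parallel> \<le> 2 * \<parallel>x\<parallel>"
      using norm_triangle[of x "astar A x"] x by simp
    finally have "(\<parallel>x\<parallel> - 1)\<^sup>2 \<le> 2\<^sup>2" using that(2) by (simp add: power2_eq_square algebra_simps)
    then have "\<parallel>x\<parallel> - 1 \<le> 2" by (rule power2_le_imp_le) simp
    then show ?thesis by simp
  qed
  have small: "16 * real k * \<parallel>z\<parallel>\<^sup>2 \<le> 3" if "k \<le> n" for k
  proof -
    have "16 * real k * \<parallel>z\<parallel>\<^sup>2 \<le> 16 * real n * \<parallel>z\<parallel>\<^sup>2"
      using that by (intro mult_right_mono) auto
    also have "\<dots> = 16 * (R * \<parallel>s\<parallel>)\<^sup>2 / real n"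
      using n0 by (simp add: nz t_def power2_eq_square)
    also have "\<dots> \<le> 1" using n n0 by (simp add: divide_le_eq)
    finally show ?thesis by simp
  qed
  have Yk: "\<parallel>Y (w k)\<parallel> \<le> 16 * real k * \<parallel>z\<parallel>\<^sup>2" if "k \<le> n" for k
    using that
  proof (induction k)
    case 0
    then show ?case by (simp add: w0 Y_def)
  next
    case (Suc k)
    define d where "d = z \<oplus> z \<otimes> w k"
    have d: "d \<in> carr A" using z w by (simp add: d_def)
    have "\<parallel>Y (w k)\<parallel> \<le> 3" using Suc small[of k] by simp
    then have wk: "\<parallel>w k\<parallel> \<le> 3" using w_le_3 w by blast
    have "\<parallel>d\<parallel> \<le> \<parallel>z\<parallel> + \<parallel>z\<parallel> * \<parallel>w k\<parallel>"
      unfolding d_def using norm_triangle[of z "z \<otimes> w k"] norm_mult[of z "w k"] z w[of k]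
      by (simp add: order_trans)
    also have "\<dots> \<le> \<parallel>z\<parallel> + \<parallel>z\<parallel> * 3" using wk z by (intro add_left_mono mult_left_mono) auto
    finally have "\<parallel>d\<parallel>\<^sup>2 \<le> (4 * \<parallel>z\<parallel>)\<^sup>2" using d by (intro power_mono) auto
    moreover have "Y (w (Suc k)) = Y (w k) \<oplus> astar A d \<otimes> d"
      unfolding wS Y_def d_def by (rule almost_unitary_step[OF w z])
    moreover have "\<parallel>Y (w k) \<oplus> astar A d \<otimes> d\<parallel> \<le> \<parallel>Y (w k)\<parallel> + \<parallel>d\<parallel>\<^sup>2"
      using norm_triangle[of "Y (w k)" "astar A d \<otimes> d"] Y[OF w] d cstar_identity[of d] by simp
    ultimately show ?case using Suc by (simp add: algebra_simps)
  qed
  have wk: "\<parallel>w k\<parallel> \<le> 3" if "k \<le> n" for k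
    using order_trans[OF Yk[OF that] small[OF that]] by (rule w_le_3[OF w])
  define c where "c = rec_nat \<zero> (\<lambda>k x. x \<oplus> w k)"
  have c0: "c 0 = \<zero>" and cS: "c (Suc k) = c k \<oplus> w k" for k by (simp_all add: c_def)
  have c: "c k \<in> carr A" for k by (induction k) (auto simp: c0 cS w)
  have w_eq: "w k = complex_of_nat k \<odot> z \<oplus> z \<otimes> c k" for k
  proof (induction k)
    case 0
    then show ?case using z by (simp add: w0 c0)
  next
    case (Suc k)
    have "w (Suc k) = (complex_of_nat k \<odot> z \<oplus> z \<otimes> c k) \<oplus> (z \<oplus> z \<otimes> w k)"
      by (simp only: wS flip: Suc)
    also have "\<dots> = (1 \<odot> z \<oplus> complex_of_nat k \<odot> z) \<oplus> z \<otimes> c (Suc k)"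
      using z c[of k] w[of k] by (simp add: cS mult_add_right add_ac)
    also have "1 \<odot> z \<oplus> complex_of_nat k \<odot> z = complex_of_nat (Suc k) \<odot> z"
      using scale_sum[OF z(1), of 1 "complex_of_nat k"] by simp
    finally show ?case .
  qed
  have cn: "\<parallel>c k\<parallel> \<le> 3 * real k" if "k \<le> n" for k
    using that
  proof (induction k)
    case (Suc k)
    then show ?case using norm_triangle[OF c w, of k k] wk[of k] by (simp add: cS)
  qed (simp add: c0)
  define e where "e = complex_of_real (- 1 / real n) \<odot> c n"
  have e: "e \<in> carr A" using c by (simp add: e_def)
  have "\<parallel>e\<parallel> = \<parallel>c n\<parallel> / real n" using c n0 by (simp add: e_def norm_scale norm_divide)
  then have "\<parallel>e\<parallel> \<le> 3" using cn[of n] n0 by (simp add: divide_le_eq)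
  moreover have "\<parallel>s \<ominus> s \<otimes> e\<parallel> \<le> 3 / R"
  proof -
    define \<gamma> where "\<gamma> = complex_of_real (real n) * (\<i> * complex_of_real t)"
    have "\<gamma> \<odot> (s \<ominus> s \<otimes> e) = complex_of_nat n \<odot> z \<oplus> z \<otimes> c n"
      using s c[of n] n0
      by (simp add: e_def z_def \<gamma>_def scale_add_right mult_scale_left mult_scale_right)
    then have "\<gamma> \<odot> (s \<ominus> s \<otimes> e) = w n" by (simp add: w_eq)
    then have "cmod \<gamma> * \<parallel>s \<ominus> s \<otimes> e\<parallel> = \<parallel>w n\<parallel>"
      using s e norm_scale[of "s \<ominus> s \<otimes> e" \<gamma>] by simp
    moreover have "cmod \<gamma> = R" using t R by (simp add: \<gamma>_def Real_Vector_Spaces.norm_mult)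
    ultimately show ?thesis using wk[of n] R by (simp add: le_divide_eq mult.commute)
  qed
  ultimately show thesis using that e by blast
qed

text \<open>
  For \<open>s = a\<^sup>*a\<close> one has \<open>\<parallel>a - a e\<parallel>\<^sup>2 = \<parallel>(1 - e)\<^sup>*(s - s e)\<parallel>\<close>, so an approximate
  unit for s that is bounded by 3 is one for a, with the error multiplied by 4 and a square root
  taken.
\<close>

lemma right_approx:
  assumes a: "a \<in> carr A" and \<epsilon>: "\<epsilon> > 0"
  obtains e where "e \<in> carr A" "\<parallel>a \<ominus> a \<otimes> e\<parallel> < \<epsilon>"
proof -
  define s where "s = astar A a \<otimes> a"
  have s: "s \<in> carr A" "astar A s = s" using a by (auto simp: s_def star_mult)
  have R: "13 / \<epsilon>\<^sup>2 > 0" using \<epsilon> by simp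
  obtain e where e: "e \<in> carr A" "\<parallel>e\<parallel> \<le> 3" "\<parallel>s \<ominus> s \<otimes> e\<parallel> \<le> 3 / (13 / \<epsilon>\<^sup>2)"
    using selfadjoint_approx[OF s R] by blast
  define r where "r = s \<ominus> s \<otimes> e"
  have r: "r \<in> carr A" using s e by (simp add: r_def)
  have "astar A (a \<ominus> a \<otimes> e) \<otimes> (a \<ominus> a \<otimes> e) = r \<ominus> astar A e \<otimes> r"
    unfolding r_def s_def using a e(1)
    by (simp add: star_diff star_add star_scale star_mult mult_add_left mult_add_right mult_scale_left mult_scale_right
        scale_add_right mult_assoc add_ac)
  then have "\<parallel>a \<ominus> a \<otimes> e\<parallel>\<^sup>2 = \<parallel>r \<ominus> astar A e \<otimes> r\<parallel>"
    using cstar_identity[of "a \<ominus> a \<otimes> e"] a e(1) by simp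
  also have "\<dots> \<le> \<parallel>r\<parallel> + \<parallel>astar A e\<parallel> * \<parallel>r\<parallel>"
    using norm_diff_le[of r "astar A e \<otimes> r"] norm_mult[of "astar A e" r] e(1) r by simp
  also have "\<dots> \<le> \<parallel>r\<parallel> + 3 * \<parallel>r\<parallel>"
    using e(1,2) r by (intro add_left_mono mult_right_mono) auto
  also have "\<dots> \<le> 4 * (3 / (13 / \<epsilon>\<^sup>2))" using e(3) by (simp add: r_def)
  also have "\<dots> < \<epsilon>\<^sup>2" using \<epsilon> by simp
  finally have "\<parallel>a \<ominus> a \<otimes> e\<parallel> < \<epsilon>" by (rule power2_less_imp_less) (use \<epsilon> in simp)
  then show thesis using that e(1) by blast
qed

lemma left_approx:
  assumes a: "a \<in> carr A" and \<epsilon>: "\<epsilon> > 0"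
  obtains e where "e \<in> carr A" "\<parallel>a \<ominus> e \<otimes> a\<parallel> < \<epsilon>"
proof -
  obtain e where e: "e \<in> carr A" "\<parallel>astar A a \<ominus> astar A a \<otimes> e\<parallel> < \<epsilon>"
    using right_approx[OF star_closed[OF a] \<epsilon>] by blast
  have "astar A (astar A a \<ominus> astar A a \<otimes> e) = a \<ominus> astar A e \<otimes> a"
    using a e(1) by (simp add: star_add star_scale star_mult)
  then have "\<parallel>a \<ominus> astar A e \<otimes> a\<parallel> < \<epsilon>"
    using norm_star[of "astar A a \<ominus> astar A a \<otimes> e"] a e by simp
  then show thesis using that e(1) by blast
qed

lemma two_sided_approx:
  assumes a: "a \<in> carr A" and \<epsilon>: "\<epsilon> > 0"
  obtains d e where "d \<in> carr A" "e \<in> carr A" "\<parallel>a \<ominus> d \<otimes> (a \<otimes> e)\<parallel> < \<epsilon>"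
proof -
  obtain e where e: "e \<in> carr A" "\<parallel>a \<ominus> a \<otimes> e\<parallel> < \<epsilon> / 2"
    using right_approx[OF a, of "\<epsilon>/2"] \<epsilon> by auto
  obtain d where d: "d \<in> carr A" "\<parallel>a \<otimes> e \<ominus> d \<otimes> (a \<otimes> e)\<parallel> < \<epsilon> / 2"
    using left_approx[OF mult_closed[OF a e(1)], of "\<epsilon>/2"] \<epsilon> by auto
  have "\<parallel>a \<ominus> d \<otimes> (a \<otimes> e)\<parallel> < \<epsilon>"
    using norm_diff_triangle[of a "a \<otimes> e" "d \<otimes> (a \<otimes> e)"] a d e by simp
  then show thesis using that d(1) e(1) by blast
qed

lemma bounded_op_left: "a \<in> carr A \<Longrightarrow> bounded_op A (\<lambda>b. a \<otimes> b)"
  by (rule bounded_opI[where M = "\<parallel>a\<parallel>"]) (auto simp: mult_add_right mult_scale_right norm_mult)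

lemma bounded_op_right: "a \<in> carr A \<Longrightarrow> bounded_op A (\<lambda>b. b \<otimes> a)"
  by (rule bounded_opI[where M = "\<parallel>a\<parallel>"])
    (use norm_mult in \<open>auto simp: mult_add_left mult_scale_left mult.commute[of "\<parallel>a\<parallel>"]\<close>)

lemma in_ideal_if_right_multiples:
  assumes I: "closed_subspace A I" and j: "j \<in> carr A" and mult: "\<And>a. a \<in> carr A \<Longrightarrow> j \<otimes> a \<in> I"
  shows "j \<in> I"
proof (rule closed_subspace_approx[OF I j])
  fix e :: real assume e: "e > 0"
  show "\<exists>w\<in>I. \<parallel>j \<ominus> w\<parallel> < e" using right_approx[OF j e] mult by metis
qed

lemma in_ideal_if_left_multiples:
  assumes I: "closed_subspace A I" and j: "j \<in> carr A" and mult: "\<And>a. a \<in> carr A \<Longrightarrow> a \<otimes> j \<in> I"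
  shows "j \<in> I"
proof (rule closed_subspace_approx[OF I j])
  fix e :: real assume e: "e > 0"
  show "\<exists>w\<in>I. \<parallel>j \<ominus> w\<parallel> < e" using left_approx[OF j e] mult by metis
qed

end

section \<open>Representations of C*-algebras\<close>

text \<open>
  Iteration gives \<open>r 0 ^ 2\<^sup>n \<le> N ^ (2\<^sup>n - 1) * r n\<close>; in the limit the \<open>2\<^sup>n\<close>-th
  root removes the unspecified constant C.
\<close>

lemma power_trick:
  fixes r :: "nat \<Rightarrow> real"
  assumes r: "\<And>n. 0 \<le> r n" "\<And>n. (r n)\<^sup>2 \<le> N * r (Suc n)" "\<And>n. r n \<le> C * t ^ (2 ^ n)"
    and N: "0 \<le> N" and t: "0 \<le> t"
  shows "r 0 \<le> N * t"
proof (rule ccontr)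
  assume "\<not> r 0 \<le> N * t"
  then have less: "N * t < r 0" by simp
  then have r0: "0 < r 0" using N t by (smt (verit) mult_nonneg_nonneg)
  have iter: "r 0 ^ (2 ^ n) * N \<le> N ^ (2 ^ n) * r n" for n
  proof (induction n)
    case (Suc n)
    show ?case
    proof (cases "N = 0")
      case False
      then have N': "0 < N" using N by simp
      have "(r 0 ^ (2 ^ n) * N)\<^sup>2 \<le> (N ^ (2 ^ n) * r n)\<^sup>2"
        using Suc r0 N by (intro power_mono) auto
      also have "\<dots> = (N ^ (2 ^ n))\<^sup>2 * (r n)\<^sup>2" by (simp add: power_mult_distrib)
      also have "\<dots> \<le> (N ^ (2 ^ n))\<^sup>2 * (N * r (Suc n))" using r(2) by (intro mult_left_mono) auto
      finally have "r 0 ^ (2 ^ Suc n) * N * N \<le> N ^ (2 ^ Suc n) * r (Suc n) * N"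
        by (simp add: power_mult_distrib power_add mult_2 power2_eq_square mult_ac)
      then show ?thesis using N' by simp
    qed (use r in simp)
  qed (simp add: mult.commute)
  show False
  proof (cases "N * t = 0")
    case True
    show False
    proof (cases "N = 0")
      case True
      then have "(r 0)\<^sup>2 \<le> 0" using r(2)[of 0] by simp
      then show False using r0 by simp
    next
      case False
      then have "t = 0" using True by simp
      then have "r 0 \<le> 0 \<or> r (Suc 0) \<le> 0" using r(3)[of "Suc 0"] by simp
      then have "(r 0)\<^sup>2 \<le> 0" using r(2)[of 0] N r0 by (smt (verit) mult_nonneg_nonpos)
      then show False using r0 by simp
    qed
  next
    case False
    then have Nt: "0 < N * t" "0 < N" using N t by (auto simp: less_le)
    define \<rho> where "\<rho> = r 0 / (N * t)"
    have \<rho>: "1 < \<rho>" using less Nt by (simp add: \<rho>_def)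
    have bound: "\<rho> ^ (2 ^ n) \<le> C / N" for n
    proof -
      have "r 0 ^ (2 ^ n) * N \<le> N ^ (2 ^ n) * (C * t ^ (2 ^ n))"
        using iter[of n] r(3)[of n] N by (meson mult_left_mono order_trans zero_le_power)
      then have "r 0 ^ (2 ^ n) * N \<le> C * (N * t) ^ (2 ^ n)"
        by (simp add: power_mult_distrib mult_ac)
      moreover have "0 < (N * t) ^ (2 ^ n)" using Nt by simp
      ultimately show ?thesis
        by (simp only: \<rho>_def power_divide pos_divide_le_eq times_divide_eq_left pos_le_divide_eq Nt(2))
    qed
    obtain k where k: "C / N < \<rho> ^ k" using real_arch_pow[OF \<rho>] by blast
    have "\<rho> ^ k \<le> \<rho> ^ (2 ^ k)" using \<rho> less_exp[of k] by (intro power_increasing) auto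
    then show False using bound[of k] k by simp
  qed
qed

text \<open>
  The power trick applies to \<open>r n = \<parallel>\<pi> (h ^ 2\<^sup>n) x\<parallel>\<close> with \<open>h = a\<^sup>*a\<close>, because \<open>h\<close> is
  self-adjoint. A bound for each orbit map \<open>a \<mapsto> \<pi> a x\<close>, with a constant depending on x, is
  thereby improved to the constant \<open>\<parallel>x\<parallel>\<close>.
\<close>

lemma (in cstar_algebra) representation_contractive:
  assumes V: "hilbert_space V"
    and closed: "\<And>a x. \<lbrakk>a \<in> carr A; x \<in> carr V\<rbrakk> \<Longrightarrow> \<pi> a x \<in> carr V"
    and mult: "\<And>a b x. \<lbrakk>a \<in> carr A; b \<in> carr A; x \<in> carr V\<rbrakk> \<Longrightarrow> \<pi> (a \<otimes> b) x = \<pi> a (\<pi> b x)"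
    and adj: "\<And>a x y. \<lbrakk>a \<in> carr A; x \<in> carr V; y \<in> carr V\<rbrakk>
      \<Longrightarrow> vinner V (\<pi> a x) y = vinner V x (\<pi> (astar A a) y)"
    and bounded: "\<And>x. x \<in> carr V \<Longrightarrow> \<exists>M. \<forall>a\<in>carr A. \<parallel>\<pi> a x\<parallel>\<^bsub>V\<^esub> \<le> M * \<parallel>a\<parallel>"
    and a: "a \<in> carr A" and x: "x \<in> carr V"
  shows "\<parallel>\<pi> a x\<parallel>\<^bsub>V\<^esub> \<le> \<parallel>a\<parallel> * \<parallel>x\<parallel>\<^bsub>V\<^esub>"
proof -
  interpret V: hilbert_space V by (rule V)
  define h where "h = rec_nat (astar A a \<otimes> a) (\<lambda>n y. y \<otimes> y)"
  have h0: "h 0 = astar A a \<otimes> a" and hS: "h (Suc n) = h n \<otimes> h n" for n by (simp_all add: h_def)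
  have h: "h n \<in> carr A \<and> astar A (h n) = h n" for n
    by (induction n) (auto simp: h0 hS a star_mult)
  obtain M where M: "\<And>a. a \<in> carr A \<Longrightarrow> \<parallel>\<pi> a x\<parallel>\<^bsub>V\<^esub> \<le> M * \<parallel>a\<parallel>" using bounded[OF x] by blast
  have nh: "\<parallel>h n\<parallel> \<le> \<parallel>h 0\<parallel> ^ (2 ^ n)" for n
  proof (induction n)
    case (Suc n)
    have "\<parallel>h (Suc n)\<parallel> \<le> \<parallel>h n\<parallel> * \<parallel>h n\<parallel>" using norm_mult h by (simp add: hS)
    also have "\<dots> \<le> \<parallel>h 0\<parallel> ^ (2 ^ n) * \<parallel>h 0\<parallel> ^ (2 ^ n)"
      using Suc h by (intro mult_mono) auto
    finally show ?case by (simp add: power_add[symmetric] mult_2)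
  qed simp
  have sq: "(\<parallel>\<pi> b x\<parallel>\<^bsub>V\<^esub>)\<^sup>2 \<le> \<parallel>x\<parallel>\<^bsub>V\<^esub> * \<parallel>\<pi> (astar A b \<otimes> b) x\<parallel>\<^bsub>V\<^esub>" if b: "b \<in> carr A" for b
  proof -
    have "complex_of_real ((\<parallel>\<pi> b x\<parallel>\<^bsub>V\<^esub>)\<^sup>2) = vinner V x (\<pi> (astar A b \<otimes> b) x)"
      using adj[OF b x closed[OF b x]] mult b x closed V.inner_norm[OF closed[OF b x]] by simp
    then have "(\<parallel>\<pi> b x\<parallel>\<^bsub>V\<^esub>)\<^sup>2 = cmod (vinner V x (\<pi> (astar A b \<otimes> b) x))"
      by (metis norm_of_real abs_power2)
    then show ?thesis using V.inner_cauchy_schwarz[OF x closed[of "astar A b \<otimes> b" x]] b x by simp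
  qed
  have "\<parallel>\<pi> (h 0) x\<parallel>\<^bsub>V\<^esub> \<le> \<parallel>x\<parallel>\<^bsub>V\<^esub> * \<parallel>h 0\<parallel>"
  proof (rule power_trick[of "\<lambda>n. \<parallel>\<pi> (h n) x\<parallel>\<^bsub>V\<^esub>" "\<parallel>x\<parallel>\<^bsub>V\<^esub>" "\<bar>M\<bar>" "\<parallel>h 0\<parallel>"])
    fix n
    show "0 \<le> \<parallel>\<pi> (h n) x\<parallel>\<^bsub>V\<^esub>" using closed h x by simp
    show "(\<parallel>\<pi> (h n) x\<parallel>\<^bsub>V\<^esub>)\<^sup>2 \<le> \<parallel>x\<parallel>\<^bsub>V\<^esub> * \<parallel>\<pi> (h (Suc n)) x\<parallel>\<^bsub>V\<^esub>"
      using sq[of "h n"] h by (simp add: hS)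
    have "\<parallel>\<pi> (h n) x\<parallel>\<^bsub>V\<^esub> \<le> M * \<parallel>h n\<parallel>" using M h by blast
    also have "\<dots> \<le> \<bar>M\<bar> * \<parallel>h 0\<parallel> ^ (2 ^ n)" using nh h by (intro mult_mono) auto
    finally show "\<parallel>\<pi> (h n) x\<parallel>\<^bsub>V\<^esub> \<le> \<bar>M\<bar> * \<parallel>h 0\<parallel> ^ (2 ^ n)" .
  qed (use x h in auto)
  then have "(\<parallel>\<pi> a x\<parallel>\<^bsub>V\<^esub>)\<^sup>2 \<le> \<parallel>x\<parallel>\<^bsub>V\<^esub> * (\<parallel>x\<parallel>\<^bsub>V\<^esub> * \<parallel>h 0\<parallel>)"
    using sq[OF a] mult_left_mono[OF _ V.norm_nonneg[OF x]] unfolding h0 by (meson order_trans)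
  then have "(\<parallel>\<pi> a x\<parallel>\<^bsub>V\<^esub>)\<^sup>2 \<le> (\<parallel>a\<parallel> * \<parallel>x\<parallel>\<^bsub>V\<^esub>)\<^sup>2"
    using cstar_identity[OF a] by (simp add: h0 power_mult_distrib power2_eq_square mult_ac)
  then show ?thesis by (rule power2_le_imp_le) (use a x in simp)
qed

section \<open>Completing a semi-inner product space\<close>

text \<open>
  A Cauchy sequence S is represented by the functional \<open>b \<mapsto> lim (s (S n) b)\<close>, which
  determines it up to null sequences, so that the completion consists of functions. The map q
  moves their arguments to a type of one's choice: irreducible representations of the section
  algebra have to act on functions of sections, not of elements of a fibre.
\<close>

locale hausdorff_completion = semi_inner E s for E :: "('a, 'm) vspace_scheme" (structure) and s +
  fixes q :: "'e \<Rightarrow> 'a"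
  assumes q_onto: "carr E \<subseteq> range q"
begin

definition cauchy :: "(nat \<Rightarrow> 'a) \<Rightarrow> bool" where
  "cauchy S \<longleftrightarrow> range S \<subseteq> carr E \<and> (\<forall>e>0. \<exists>N. \<forall>m\<ge>N. \<forall>n\<ge>N. seminorm (S m \<ominus> S n) < e)"

definition point :: "(nat \<Rightarrow> 'a) \<Rightarrow> 'e \<Rightarrow> complex" where
  "point S = (\<lambda>e. if q e \<in> carr E then lim (\<lambda>n. s (S n) (q e)) else 0)"

definition rep :: "('e \<Rightarrow> complex) \<Rightarrow> nat \<Rightarrow> 'a" where
  "rep F = (SOME S. cauchy S \<and> point S = F)"

definition compl :: "('e \<Rightarrow> complex) ispace" where
  "compl = \<lparr>carr = point ` {S. cauchy S},
     vzero = point (\<lambda>n. \<zero>),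
     vadd = (\<lambda>F G. point (\<lambda>n. rep F n \<oplus> rep G n)),
     vscale = (\<lambda>c F. point (\<lambda>n. c \<odot> rep F n)),
     vnorm = (\<lambda>F. lim (\<lambda>n. seminorm (rep F n))),
     vinner = (\<lambda>F G. lim (\<lambda>n. s (rep F n) (rep G n)))\<rparr>"

lemma cauchy_carr: "cauchy S \<Longrightarrow> S n \<in> carr E"
  by (auto simp: cauchy_def)

lemma cauchy_bounded:
  assumes S: "cauchy S"
  obtains M where "0 \<le> M" "\<And>n. seminorm (S n) \<le> M"
proof -
  obtain N where N: "\<And>n. n \<ge> N \<Longrightarrow> seminorm (S n \<ominus> S N) < 1"
    using S unfolding cauchy_def by (metis le_refl zero_less_one)
  define M where "M = (\<Sum>k\<le>N. seminorm (S k)) + 1"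
  have pos: "0 \<le> seminorm (S k)" for k using cauchy_carr[OF S] by simp
  have le: "seminorm (S k) \<le> (\<Sum>k\<le>N. seminorm (S k))" if "k \<le> N" for k
    using that pos by (intro member_le_sum) auto
  have "seminorm (S n) \<le> M" for n
  proof (cases "n \<le> N")
    case True
    then show ?thesis using le[of n] by (simp add: M_def)
  next
    case False
    then show ?thesis using seminorm_triangle_sub[of "S n" "S N"] N[of n] le[of N] cauchy_carr[OF S]
      by (simp add: M_def)
  qed
  moreover have "0 \<le> M" using pos by (simp add: M_def sum_nonneg add_nonneg_nonneg)
  ultimately show thesis using that by blast
qed

lemma cauchy_add:
  assumes S: "cauchy S" and T: "cauchy T"
  shows "cauchy (\<lambda>n. S n \<oplus> T n)"
  unfolding cauchy_def
proof (intro conjI allI impI)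
  show "range (\<lambda>n. S n \<oplus> T n) \<subseteq> carr E" using cauchy_carr S T by auto
  fix e :: real assume e: "e > 0"
  then obtain N M where N: "\<And>m n. m \<ge> N \<Longrightarrow> n \<ge> N \<Longrightarrow> seminorm (S m \<ominus> S n) < e/2"
    and M: "\<And>m n. m \<ge> M \<Longrightarrow> n \<ge> M \<Longrightarrow> seminorm (T m \<ominus> T n) < e/2"
    using S T unfolding cauchy_def by (meson half_gt_zero)
  have "seminorm ((S m \<oplus> T m) \<ominus> (S n \<oplus> T n)) < e" if "m \<ge> max N M" "n \<ge> max N M" for m n
    using seminorm_triangle[of "S m \<ominus> S n" "T m \<ominus> T n"] N[of m n] M[of m n] that cauchy_carr S T
    by (simp add: diff_add_add)
  then show "\<exists>N. \<forall>m\<ge>N. \<forall>n\<ge>N. seminorm ((S m \<oplus> T m) \<ominus> (S n \<oplus> T n)) < e" by blast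
qed

lemma cauchy_image:
  assumes S: "cauchy S"
    and T: "\<And>x. x \<in> carr E \<Longrightarrow> T x \<in> carr E"
      "\<And>x y. x \<in> carr E \<Longrightarrow> y \<in> carr E \<Longrightarrow> seminorm (T x \<ominus> T y) \<le> M * seminorm (x \<ominus> y)"
  shows "cauchy (\<lambda>n. T (S n))"
  unfolding cauchy_def
proof (intro conjI allI impI)
  show "range (\<lambda>n. T (S n)) \<subseteq> carr E" using cauchy_carr S T by auto
  fix e :: real assume e: "e > 0"
  then have "0 < e / (\<bar>M\<bar> + 1)" by (simp add: add_nonneg_pos)
  then obtain N where N: "\<And>m n. m \<ge> N \<Longrightarrow> n \<ge> N \<Longrightarrow> seminorm (S m \<ominus> S n) < e / (\<bar>M\<bar> + 1)"
    using S unfolding cauchy_def by meson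
  have "seminorm (T (S m) \<ominus> T (S n)) < e" if "m \<ge> N" "n \<ge> N" for m n
  proof -
    have "seminorm (T (S m) \<ominus> T (S n)) \<le> M * seminorm (S m \<ominus> S n)"
      using T(2) cauchy_carr[OF S] by simp
    also have "\<dots> \<le> (\<bar>M\<bar> + 1) * seminorm (S m \<ominus> S n)"
      using cauchy_carr[OF S] by (intro mult_right_mono) auto
    also have "\<dots> < e" using N[OF that] by (simp add: pos_less_divide_eq add_nonneg_pos mult.commute)
    finally show ?thesis .
  qed
  then show "\<exists>N. \<forall>m\<ge>N. \<forall>n\<ge>N. seminorm (T (S m) \<ominus> T (S n)) < e" by blast
qed

lemma cauchy_scale: "cauchy S \<Longrightarrow> cauchy (\<lambda>n. c \<odot> S n)"
  by (rule cauchy_image[where M = "cmod c"]) (auto simp: diff_scale seminorm_scale)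

lemma cauchy_const: "x \<in> carr E \<Longrightarrow> cauchy (\<lambda>n. x)"
  by (auto simp: cauchy_def)

lemma cauchy_diff: "cauchy S \<Longrightarrow> cauchy T \<Longrightarrow> cauchy (\<lambda>n. S n \<ominus> T n)"
  by (intro cauchy_add cauchy_scale)

lemma form_convergent:
  assumes S: "cauchy S" and T: "cauchy T"
  shows "convergent (\<lambda>n. s (S n) (T n))"
proof -
  obtain M where M: "0 \<le> M" "\<And>n. seminorm (S n) \<le> M" using cauchy_bounded[OF S] by blast
  obtain K where K: "0 \<le> K" "\<And>n. seminorm (T n) \<le> K" using cauchy_bounded[OF T] by blast
  note c = cauchy_carr[OF S] cauchy_carr[OF T]
  have "Cauchy (\<lambda>n. s (S n) (T n))"
  proof (rule CauchyI)
    fix e :: real assume e: "e > 0"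
    define \<delta> where "\<delta> = e / (M + K + 1)"
    have \<delta>: "\<delta> > 0" using e M K by (simp add: \<delta>_def)
    obtain N1 N2 where N: "\<And>m n. m \<ge> N1 \<Longrightarrow> n \<ge> N1 \<Longrightarrow> seminorm (S m \<ominus> S n) < \<delta>"
       "\<And>m n. m \<ge> N2 \<Longrightarrow> n \<ge> N2 \<Longrightarrow> seminorm (T m \<ominus> T n) < \<delta>"
      using S T \<delta> unfolding cauchy_def by meson
    have "norm (s (S m) (T m) - s (S n) (T n)) < e" if mn: "m \<ge> max N1 N2" "n \<ge> max N1 N2" for m n
    proof -
      have "s (S m) (T m) - s (S n) (T n) = s (S m \<ominus> S n) (T m) + s (S n) (T m \<ominus> T n)"
        using c by (simp add: form_diff form_diff_right)
      then have "norm (s (S m) (T m) - s (S n) (T n))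
          \<le> seminorm (S m \<ominus> S n) * seminorm (T m) + seminorm (S n) * seminorm (T m \<ominus> T n)"
        using cauchy_schwarz[of "S m \<ominus> S n" "T m"] cauchy_schwarz[of "S n" "T m \<ominus> T n"] c
          norm_triangle_ineq[of "s (S m \<ominus> S n) (T m)" "s (S n) (T m \<ominus> T n)"] by simp
      also have "\<dots> \<le> \<delta> * K + M * \<delta>"
        using N[of m n] mn M K c \<delta> by (intro add_mono mult_mono) auto
      also have "\<dots> < \<delta> * (M + K + 1)" using \<delta> by (simp add: algebra_simps)
      also have "\<dots> = e" using M K by (simp add: \<delta>_def)
      finally show ?thesis .
    qed
    then show "\<exists>N. \<forall>m\<ge>N. \<forall>n\<ge>N. norm (s (S m) (T m) - s (S n) (T n)) < e" by blast
  qed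
  then show ?thesis by (rule Cauchy_convergent)
qed

lemma point_at:
  assumes S: "cauchy S" and "q e = b" "b \<in> carr E"
  shows "(\<lambda>n. s (S n) b) \<longlonglongrightarrow> point S e"
  using form_convergent[OF S cauchy_const[OF assms(3)]] assms(2,3)
  by (simp add: point_def convergent_LIMSEQ_iff)

text \<open>
  A weakly null Cauchy sequence D is null: \<open>s (D n) (D n)\<close> is the sum of \<open>s (D n) (D N)\<close>,
  which tends to 0, and of \<open>s (D n) (D n - D N)\<close>, which is small for large N.
\<close>

lemma point_eq_iff:
  assumes S: "cauchy S" and T: "cauchy T"
  shows "point S = point T \<longleftrightarrow> (\<lambda>n. seminorm (S n \<ominus> T n)) \<longlonglongrightarrow> 0"
proof
  assume eq: "point S = point T"
  define D where "D n = S n \<ominus> T n" for n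
  have D: "cauchy D" unfolding D_def by (rule cauchy_diff[OF S T])
  note c = cauchy_carr[OF D]
  have null: "(\<lambda>n. s (D n) b) \<longlonglongrightarrow> 0" if b: "b \<in> carr E" for b
  proof -
    obtain e where e: "q e = b" using b q_onto by (metis rangeE subsetD)
    have "(\<lambda>n. s (S n) b - s (T n) b) \<longlonglongrightarrow> point S e - point T e"
      using point_at[OF S e b] point_at[OF T e b] by (rule tendsto_diff)
    then show ?thesis using eq cauchy_carr[OF S] cauchy_carr[OF T] b by (simp add: D_def form_diff)
  qed
  obtain M where M: "0 \<le> M" "\<And>n. seminorm (D n) \<le> M" using cauchy_bounded[OF D] by blast
  have "(\<lambda>n. (seminorm (D n))\<^sup>2) \<longlonglongrightarrow> 0"
  proof (rule LIMSEQ_I)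
    fix e :: real assume e: "e > 0"
    define \<delta> where "\<delta> = (e / 2) / (M + 1)"
    have M1: "M + 1 \<noteq> 0" using M by simp
    have \<delta>: "\<delta> > 0" using e M by (simp add: \<delta>_def)
    obtain N where N: "\<And>n. n \<ge> N \<Longrightarrow> seminorm (D n \<ominus> D N) < \<delta>"
      using D \<delta> unfolding cauchy_def by (meson le_refl)
    obtain K where K: "\<And>n. n \<ge> K \<Longrightarrow> norm (s (D n) (D N)) < e / 2"
      using LIMSEQ_D[OF null[OF c[of N]], of "e/2"] e by auto
    have "norm ((seminorm (D n))\<^sup>2 - 0) < e" if n: "n \<ge> max N K" for n
    proof -
      have "s (D n) (D n) = s (D n) (D N) + s (D n) (D n \<ominus> D N)"
        using c by (simp add: form_diff_right)
      then have "(seminorm (D n))\<^sup>2 \<le> norm (s (D n) (D N)) + norm (s (D n) (D n \<ominus> D N))"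
        using c by (metis seminorm_sq complex_Re_le_cmod norm_triangle_ineq order_trans)
      also have "norm (s (D n) (D n \<ominus> D N)) \<le> seminorm (D n) * seminorm (D n \<ominus> D N)"
        using c by (intro cauchy_schwarz) auto
      also have "\<dots> \<le> (M + 1) * \<delta>" using M N[of n] n c \<delta> by (intro mult_mono) (auto simp: add_increasing2)
      also have "\<dots> = e / 2" unfolding \<delta>_def by (rule nonzero_mult_div_cancel_left[OF M1, of "e/2", unfolded times_divide_eq_right[symmetric]])
      finally show ?thesis using K[of n] n by simp
    qed
    then show "\<exists>N. \<forall>n\<ge>N. norm ((seminorm (D n))\<^sup>2 - 0) < e" by blast
  qed
  then have "(\<lambda>n. sqrt ((seminorm (D n))\<^sup>2)) \<longlonglongrightarrow> sqrt 0" by (rule tendsto_real_sqrt)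
  then show "(\<lambda>n. seminorm (S n \<ominus> T n)) \<longlonglongrightarrow> 0" using c by (simp add: D_def)
next
  assume null: "(\<lambda>n. seminorm (S n \<ominus> T n)) \<longlonglongrightarrow> 0"
  show "point S = point T"
  proof
    fix e
    show "point S e = point T e"
    proof (cases "q e \<in> carr E")
      case True
      have "norm (s (S n) (q e) - s (T n) (q e)) \<le> seminorm (S n \<ominus> T n) * seminorm (q e)" for n
        using cauchy_schwarz[of "S n \<ominus> T n" "q e"] True cauchy_carr[OF S] cauchy_carr[OF T]
        by (simp add: form_diff)
      then have "(\<lambda>n. s (S n) (q e) - s (T n) (q e)) \<longlonglongrightarrow> 0"
        by (intro Lim_null_comparison[OF always_eventually tendsto_mult_left_zero[OF null]] allI)
      moreover have "(\<lambda>n. s (S n) (q e) - s (T n) (q e)) \<longlonglongrightarrow> point S e - point T e"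
        using point_at[OF S refl True] point_at[OF T refl True] by (rule tendsto_diff)
      ultimately show ?thesis using LIMSEQ_unique by fastforce
    qed (simp add: point_def)
  qed
qed

lemma rep:
  assumes "cauchy S"
  shows "cauchy (rep (point S))" "point (rep (point S)) = point S"
    "(\<lambda>n. seminorm (rep (point S) n \<ominus> S n)) \<longlonglongrightarrow> 0"
proof -
  have "cauchy (rep (point S)) \<and> point (rep (point S)) = point S"
    unfolding rep_def by (rule someI[of _ S]) (use assms in simp)
  then show "cauchy (rep (point S))" "point (rep (point S)) = point S" by auto
  then show "(\<lambda>n. seminorm (rep (point S) n \<ominus> S n)) \<longlonglongrightarrow> 0"
    using point_eq_iff assms by blast
qed

lemma compl_carr: "F \<in> carr compl \<longleftrightarrow> (\<exists>S. cauchy S \<and> F = point S)"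
  by (auto simp: compl_def)

lemma compl_carrE:
  assumes "F \<in> carr compl" obtains S where "cauchy S" "F = point S"
  using assms compl_carr by blast

lemma point_closed [simp]: "cauchy S \<Longrightarrow> point S \<in> carr compl"
  using compl_carr by blast

lemma compl_zero: "\<zero>\<^bsub>compl\<^esub> = point (\<lambda>n. \<zero>)"
  by (simp add: compl_def)

lemma compl_add:
  assumes S: "cauchy S" and T: "cauchy T"
  shows "point S \<oplus>\<^bsub>compl\<^esub> point T = point (\<lambda>n. S n \<oplus> T n)"
proof -
  note r = rep[OF S] rep[OF T]
  note c = cauchy_carr[OF r(1)] cauchy_carr[OF r(4)] cauchy_carr[OF S] cauchy_carr[OF T]
  have null: "(\<lambda>n. seminorm (rep (point S) n \<ominus> S n) + seminorm (rep (point T) n \<ominus> T n)) \<longlonglongrightarrow> 0"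
    using tendsto_add[OF r(3,6)] by simp
  have le: "seminorm ((rep (point S) n \<oplus> rep (point T) n) \<ominus> (S n \<oplus> T n))
     \<le> seminorm (rep (point S) n \<ominus> S n) + seminorm (rep (point T) n \<ominus> T n)" for n
    using seminorm_triangle c by (simp add: diff_add_add)
  have "(\<lambda>n. seminorm ((rep (point S) n \<oplus> rep (point T) n) \<ominus> (S n \<oplus> T n))) \<longlonglongrightarrow> 0"
    by (rule null_le[OF null _ le]) (use c in simp)
  then have "point (\<lambda>n. rep (point S) n \<oplus> rep (point T) n) = point (\<lambda>n. S n \<oplus> T n)"
    using point_eq_iff cauchy_add r(1,4) S T by blast
  then show ?thesis by (simp add: compl_def)
qed

text \<open>
  Lipschitz maps extend to the completion by acting on representing sequences.
\<close>

lemma compl_map: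
  assumes S: "cauchy S"
    and T: "\<And>x. x \<in> carr E \<Longrightarrow> T x \<in> carr E"
      "\<And>x y. x \<in> carr E \<Longrightarrow> y \<in> carr E \<Longrightarrow> seminorm (T x \<ominus> T y) \<le> M * seminorm (x \<ominus> y)"
  shows "point (\<lambda>n. T (rep (point S) n)) = point (\<lambda>n. T (S n))"
proof -
  note r = rep[OF S]
  have le: "seminorm (T (rep (point S) n) \<ominus> T (S n)) \<le> M * seminorm (rep (point S) n \<ominus> S n)" for n
    using T(2) cauchy_carr r(1) S by blast
  have "(\<lambda>n. seminorm (T (rep (point S) n) \<ominus> T (S n))) \<longlonglongrightarrow> 0"
    by (rule null_le[OF tendsto_mult_right_zero[OF r(3)] _ le])
      (use T(1) cauchy_carr[OF S] cauchy_carr[OF r(1)] in simp)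
  then show ?thesis
    using point_eq_iff[OF cauchy_image[OF r(1) T] cauchy_image[OF S T]] by blast
qed

lemma compl_scale: "cauchy S \<Longrightarrow> c \<odot>\<^bsub>compl\<^esub> point S = point (\<lambda>n. c \<odot> S n)"
  using compl_map[of S "\<lambda>x. c \<odot> x" "cmod c"]
  by (simp add: compl_def diff_scale seminorm_scale)

lemma compl_diff: "cauchy S \<Longrightarrow> cauchy T \<Longrightarrow> point S \<ominus>\<^bsub>compl\<^esub> point T = point (\<lambda>n. S n \<ominus> T n)"
  by (simp add: compl_scale compl_add cauchy_scale)

lemma compl_inner:
  assumes S: "cauchy S" and T: "cauchy T"
  shows "(\<lambda>n. s (S n) (T n)) \<longlonglongrightarrow> vinner compl (point S) (point T)"
proof -
  note r = rep[OF S] rep[OF T]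
  note c = cauchy_carr[OF r(1)] cauchy_carr[OF r(4)] cauchy_carr[OF S] cauchy_carr[OF T]
  obtain M where M: "0 \<le> M" "\<And>n. seminorm (rep (point S) n) \<le> M" using cauchy_bounded[OF r(1)] by blast
  obtain K where K: "0 \<le> K" "\<And>n. seminorm (T n) \<le> K" using cauchy_bounded[OF T] by blast
  have null: "(\<lambda>n. seminorm (rep (point S) n \<ominus> S n) * K + M * seminorm (rep (point T) n \<ominus> T n)) \<longlonglongrightarrow> 0"
    using tendsto_add[OF tendsto_mult_left_zero[OF r(3)] tendsto_mult_right_zero[OF r(6)]] by simp
  have le: "norm (s (rep (point S) n) (rep (point T) n) - s (S n) (T n))
      \<le> seminorm (rep (point S) n \<ominus> S n) * K + M * seminorm (rep (point T) n \<ominus> T n)" for n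
  proof -
    have "s (rep (point S) n) (rep (point T) n) - s (S n) (T n)
      = s (rep (point S) n \<ominus> S n) (T n) + s (rep (point S) n) (rep (point T) n \<ominus> T n)"
      using c by (simp add: form_diff form_diff_right)
    then have "norm (s (rep (point S) n) (rep (point T) n) - s (S n) (T n))
        \<le> seminorm (rep (point S) n \<ominus> S n) * seminorm (T n)
          + seminorm (rep (point S) n) * seminorm (rep (point T) n \<ominus> T n)"
      using cauchy_schwarz[of "rep (point S) n \<ominus> S n" "T n"]
        cauchy_schwarz[of "rep (point S) n" "rep (point T) n \<ominus> T n"] c
        norm_triangle_ineq[of "s (rep (point S) n \<ominus> S n) (T n)" "s (rep (point S) n) (rep (point T) n \<ominus> T n)"]
      by simp
    also have "\<dots> \<le> seminorm (rep (point S) n \<ominus> S n) * K + M * seminorm (rep (point T) n \<ominus> T n)"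
      using M K c by (intro add_mono mult_mono) auto
    finally show ?thesis .
  qed
  have "(\<lambda>n. s (rep (point S) n) (rep (point T) n) - s (S n) (T n)) \<longlonglongrightarrow> 0"
    by (rule null_comparison[OF null le])
  moreover have lim: "(\<lambda>n. s (rep (point S) n) (rep (point T) n)) \<longlonglongrightarrow> vinner compl (point S) (point T)"
    using form_convergent[OF r(1,4)] by (simp add: compl_def convergent_LIMSEQ_iff)
  ultimately have "(\<lambda>n. s (rep (point S) n) (rep (point T) n) - (s (rep (point S) n) (rep (point T) n) - s (S n) (T n)))
      \<longlonglongrightarrow> vinner compl (point S) (point T) - 0"
    by (intro tendsto_diff)
  then show ?thesis by simp
qed

lemma compl_norm:
  assumes S: "cauchy S"
  shows "(\<lambda>n. seminorm (S n)) \<longlonglongrightarrow> \<parallel>point S\<parallel>\<^bsub>compl\<^esub>"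
proof -
  have sq: "(\<lambda>n. seminorm (T n)) \<longlonglongrightarrow> sqrt (Re (vinner compl (point T) (point T)))" if T: "cauchy T" for T
    unfolding seminorm_def
    by (intro tendsto_intros tendsto_Re compl_inner T)
  have "\<parallel>point S\<parallel>\<^bsub>compl\<^esub> = lim (\<lambda>n. seminorm (rep (point S) n))" by (simp add: compl_def)
  also have "\<dots> = sqrt (Re (vinner compl (point S) (point S)))"
    using limI[OF sq[OF rep(1)[OF S]]] rep(2)[OF S] by simp
  finally show ?thesis using sq[OF S] by simp
qed

lemma compl_norm_const: "x \<in> carr E \<Longrightarrow> \<parallel>point (\<lambda>n. x)\<parallel>\<^bsub>compl\<^esub> = seminorm x"
  by (rule LIMSEQ_unique[OF compl_norm[OF cauchy_const] tendsto_const])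

lemma compl_inner_const:
  "x \<in> carr E \<Longrightarrow> y \<in> carr E \<Longrightarrow> vinner compl (point (\<lambda>n. x)) (point (\<lambda>n. y)) = s x y"
  by (rule LIMSEQ_unique[OF compl_inner[OF cauchy_const cauchy_const] tendsto_const])

lemma compl_approx:
  assumes S: "cauchy S" and e: "e > 0"
  shows "\<exists>x\<in>carr E. \<parallel>point S \<ominus>\<^bsub>compl\<^esub> point (\<lambda>n. x)\<parallel>\<^bsub>compl\<^esub> < e"
proof -
  obtain N where N: "\<And>m n. m \<ge> N \<Longrightarrow> n \<ge> N \<Longrightarrow> seminorm (S m \<ominus> S n) < e/2"
    using S e unfolding cauchy_def by (meson half_gt_zero)
  have cs: "cauchy (\<lambda>n. S N)" using cauchy_const cauchy_carr S by blast
  have "(\<lambda>n. seminorm (S n \<ominus> S N)) \<longlonglongrightarrow> \<parallel>point S \<ominus>\<^bsub>compl\<^esub> point (\<lambda>n. S N)\<parallel>\<^bsub>compl\<^esub>"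
    using compl_norm[OF cauchy_diff[OF S cs]] by (simp add: compl_diff[OF S cs])
  then have "\<parallel>point S \<ominus>\<^bsub>compl\<^esub> point (\<lambda>n. S N)\<parallel>\<^bsub>compl\<^esub> \<le> e/2"
    by (rule LIMSEQ_le_const2) (use N[THEN less_imp_le] in blast)
  also have "\<dots> < e" using e by simp
  finally show ?thesis using cauchy_carr[OF S] by blast
qed

lemma compl_complex_space: "complex_space compl"
proof
  show "\<zero>\<^bsub>compl\<^esub> \<in> carr compl" by (simp add: compl_zero cauchy_const)
next
  fix x y assume "x \<in> carr compl" "y \<in> carr compl"
  then show "x \<oplus>\<^bsub>compl\<^esub> y \<in> carr compl" "x \<oplus>\<^bsub>compl\<^esub> y = y \<oplus>\<^bsub>compl\<^esub> x"
    by (auto elim!: compl_carrE simp: compl_add cauchy_add cauchy_carr add_commute)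
next
  fix x c d assume "x \<in> carr compl"
  then show "c \<odot>\<^bsub>compl\<^esub> x \<in> carr compl" "\<zero>\<^bsub>compl\<^esub> \<oplus>\<^bsub>compl\<^esub> x = x" "0 \<odot>\<^bsub>compl\<^esub> x = \<zero>\<^bsub>compl\<^esub>"
    "1 \<odot>\<^bsub>compl\<^esub> x = x" "c \<odot>\<^bsub>compl\<^esub> d \<odot>\<^bsub>compl\<^esub> x = (c * d) \<odot>\<^bsub>compl\<^esub> x"
    "(c + d) \<odot>\<^bsub>compl\<^esub> x = c \<odot>\<^bsub>compl\<^esub> x \<oplus>\<^bsub>compl\<^esub> d \<odot>\<^bsub>compl\<^esub> x"
    by (auto elim!: compl_carrE simp: compl_add compl_scale compl_zero cauchy_add cauchy_scale
        cauchy_const cauchy_carr scale_add_left)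
next
  fix x y z assume "x \<in> carr compl" "y \<in> carr compl" "z \<in> carr compl"
  then show "x \<oplus>\<^bsub>compl\<^esub> y \<oplus>\<^bsub>compl\<^esub> z = x \<oplus>\<^bsub>compl\<^esub> (y \<oplus>\<^bsub>compl\<^esub> z)"
    by (auto elim!: compl_carrE simp: compl_add cauchy_add cauchy_carr add_assoc)
next
  fix x y c assume "x \<in> carr compl" "y \<in> carr compl"
  then show "c \<odot>\<^bsub>compl\<^esub> (x \<oplus>\<^bsub>compl\<^esub> y) = c \<odot>\<^bsub>compl\<^esub> x \<oplus>\<^bsub>compl\<^esub> c \<odot>\<^bsub>compl\<^esub> y"
    by (auto elim!: compl_carrE simp: compl_add compl_scale cauchy_add cauchy_scale
        cauchy_carr scale_add_right)
qed

lemma compl_norm_triangle: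
  assumes "x \<in> carr compl" "y \<in> carr compl"
  shows "\<parallel>x \<oplus>\<^bsub>compl\<^esub> y\<parallel>\<^bsub>compl\<^esub> \<le> \<parallel>x\<parallel>\<^bsub>compl\<^esub> + \<parallel>y\<parallel>\<^bsub>compl\<^esub>"
proof -
  obtain S T where S: "cauchy S" "x = point S" and T: "cauchy T" "y = point T"
    using assms compl_carr by blast
  have "(\<lambda>n. seminorm (S n \<oplus> T n)) \<longlonglongrightarrow> \<parallel>x \<oplus>\<^bsub>compl\<^esub> y\<parallel>\<^bsub>compl\<^esub>"
    using compl_norm[OF cauchy_add[OF S(1) T(1)]] S T by (simp add: compl_add)
  moreover have "(\<lambda>n. seminorm (S n) + seminorm (T n)) \<longlonglongrightarrow> \<parallel>x\<parallel>\<^bsub>compl\<^esub> + \<parallel>y\<parallel>\<^bsub>compl\<^esub>"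
    using S T by (auto intro!: tendsto_add compl_norm)
  ultimately show ?thesis
    by (rule LIMSEQ_le) (use seminorm_triangle cauchy_carr S T in auto)
qed

lemma compl_norm_scale:
  assumes "x \<in> carr compl"
  shows "\<parallel>c \<odot>\<^bsub>compl\<^esub> x\<parallel>\<^bsub>compl\<^esub> = cmod c * \<parallel>x\<parallel>\<^bsub>compl\<^esub>"
proof -
  obtain S where S: "cauchy S" "x = point S"
    using assms compl_carr by blast
  have "(\<lambda>n. seminorm (c \<odot> S n)) \<longlonglongrightarrow> \<parallel>c \<odot>\<^bsub>compl\<^esub> x\<parallel>\<^bsub>compl\<^esub>"
    using compl_norm[OF cauchy_scale[OF S(1)]] S by (simp add: compl_scale)
  moreover have "(\<lambda>n. seminorm (c \<odot> S n)) \<longlonglongrightarrow> cmod c * \<parallel>x\<parallel>\<^bsub>compl\<^esub>"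
    using tendsto_mult_left[OF compl_norm[OF S(1)], of "cmod c"] S cauchy_carr
    by (simp add: seminorm_scale)
  ultimately show ?thesis using LIMSEQ_unique by blast
qed

lemma compl_norm_eq_zero:
  assumes "x \<in> carr compl"
  shows "\<parallel>x\<parallel>\<^bsub>compl\<^esub> = 0 \<longleftrightarrow> x = \<zero>\<^bsub>compl\<^esub>"
proof -
  obtain S where S: "cauchy S" "x = point S"
    using assms compl_carr by blast
  have "x = \<zero>\<^bsub>compl\<^esub> \<longleftrightarrow> (\<lambda>n. seminorm (S n)) \<longlonglongrightarrow> 0"
    using point_eq_iff[OF S(1) cauchy_const[OF zero_closed]] S cauchy_carr by (simp add: compl_zero)
  then show ?thesis using compl_norm[OF S(1)] S(2) LIMSEQ_unique[OF compl_norm[OF S(1)]] by fastforce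
qed

text \<open>
  Each term of a Cauchy sequence in the completion is approximated by an element of E; these
  elements form a Cauchy sequence, and the point it defines is the limit.
\<close>

lemma compl_complete:
  assumes F: "cauchy_in compl F"
  shows "\<exists>l\<in>carr compl. (\<lambda>n. vdist compl (F n) l) \<longlonglongrightarrow> 0"
proof -
  interpret C: complex_space compl by (rule compl_complex_space)
  have FC: "F n \<in> carr compl" for n using F by (auto simp: cauchy_in_def)
  define k where "k x = point (\<lambda>n. x)" for x
  have k: "k x \<in> carr compl" if "x \<in> carr E" for x using that by (simp add: k_def cauchy_const)
  have "\<forall>n. \<exists>x\<in>carr E. \<parallel>F n \<ominus>\<^bsub>compl\<^esub> k x\<parallel>\<^bsub>compl\<^esub> < 1 / real (Suc n)"
    unfolding k_def using FC compl_approx by (metis compl_carr of_nat_0_less_iff zero_less_Suc zero_less_divide_1_iff)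
  then obtain a where a: "\<And>n. a n \<in> carr E" "\<And>n. \<parallel>F n \<ominus>\<^bsub>compl\<^esub> k (a n)\<parallel>\<^bsub>compl\<^esub> < 1 / real (Suc n)"
    by metis
  have comm: "\<parallel>x \<ominus>\<^bsub>compl\<^esub> y\<parallel>\<^bsub>compl\<^esub> = \<parallel>y \<ominus>\<^bsub>compl\<^esub> x\<parallel>\<^bsub>compl\<^esub>"
    if "x \<in> carr compl" "y \<in> carr compl" for x y
    using compl_norm_scale[of "x \<ominus>\<^bsub>compl\<^esub> y" "-1"] that by (simp add: C.diff_commute)
  have tri: "\<parallel>x \<ominus>\<^bsub>compl\<^esub> z\<parallel>\<^bsub>compl\<^esub> \<le> \<parallel>x \<ominus>\<^bsub>compl\<^esub> y\<parallel>\<^bsub>compl\<^esub> + \<parallel>y \<ominus>\<^bsub>compl\<^esub> z\<parallel>\<^bsub>compl\<^esub>"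
    if "x \<in> carr compl" "y \<in> carr compl" "z \<in> carr compl" for x y z
    using compl_norm_triangle[of "x \<ominus>\<^bsub>compl\<^esub> y" "y \<ominus>\<^bsub>compl\<^esub> z"] that by (simp add: C.diff_triangle)
  have k_diff: "\<parallel>k x \<ominus>\<^bsub>compl\<^esub> k y\<parallel>\<^bsub>compl\<^esub> = seminorm (x \<ominus> y)" if "x \<in> carr E" "y \<in> carr E" for x y
    using that compl_norm_const[of "x \<ominus> y"] by (simp add: k_def compl_diff cauchy_const)
  have "cauchy a"
    unfolding cauchy_def
  proof (intro conjI allI impI)
    show "range a \<subseteq> carr E" using a by auto
    fix e :: real assume e: "e > 0"
    obtain N where N: "\<And>m n. m \<ge> N \<Longrightarrow> n \<ge> N \<Longrightarrow> \<parallel>F m \<ominus>\<^bsub>compl\<^esub> F n\<parallel>\<^bsub>compl\<^esub> < e/3"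
      using F e unfolding cauchy_in_def vdist_def by (metis zero_less_divide_iff zero_less_numeral)
    obtain K :: nat where K: "1 / real (Suc K) < e/3" using e nat_approx_posE[of "e/3"] by force
    have "seminorm (a m \<ominus> a n) < e" if mn: "m \<ge> max N K" "n \<ge> max N K" for m n
    proof -
      have le: "1 / real (Suc m) \<le> 1 / real (Suc K)" "1 / real (Suc n) \<le> 1 / real (Suc K)"
        using mn by (auto intro!: divide_left_mono)
      have "seminorm (a m \<ominus> a n) = \<parallel>k (a m) \<ominus>\<^bsub>compl\<^esub> k (a n)\<parallel>\<^bsub>compl\<^esub>"
        using k_diff a(1) by simp
      also have "\<dots> \<le> \<parallel>k (a m) \<ominus>\<^bsub>compl\<^esub> F m\<parallel>\<^bsub>compl\<^esub> + (\<parallel>F m \<ominus>\<^bsub>compl\<^esub> F n\<parallel>\<^bsub>compl\<^esub> + \<parallel>F n \<ominus>\<^bsub>compl\<^esub> k (a n)\<parallel>\<^bsub>compl\<^esub>)"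
        using tri[of "k (a m)" "F m" "k (a n)"] tri[of "F m" "F n" "k (a n)"] k a(1) FC
        by (meson add_left_mono order_trans)
      also have "\<dots> < e/3 + (e/3 + e/3)"
        using a(2)[of m] a(2)[of n] comm[OF k[OF a(1)] FC] N[of m n] mn le K
        by (intro add_strict_mono) auto
      finally show ?thesis by simp
    qed
    then show "\<exists>N. \<forall>m\<ge>N. \<forall>n\<ge>N. seminorm (a m \<ominus> a n) < e" by blast
  qed
  then have l: "point a \<in> carr compl" by simp
  have "(\<lambda>n. \<parallel>point a \<ominus>\<^bsub>compl\<^esub> k (a n)\<parallel>\<^bsub>compl\<^esub>) \<longlonglongrightarrow> 0"
  proof (rule LIMSEQ_I)
    fix e :: real assume e: "e > 0"
    obtain N where N: "\<And>m n. m \<ge> N \<Longrightarrow> n \<ge> N \<Longrightarrow> seminorm (a m \<ominus> a n) < e/2"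
      using \<open>cauchy a\<close> e unfolding cauchy_def by (meson half_gt_zero)
    have "norm (\<parallel>point a \<ominus>\<^bsub>compl\<^esub> k (a m)\<parallel>\<^bsub>compl\<^esub> - 0) < e" if "m \<ge> N" for m
    proof -
      have "(\<lambda>n. seminorm (a n \<ominus> a m)) \<longlonglongrightarrow> \<parallel>point a \<ominus>\<^bsub>compl\<^esub> k (a m)\<parallel>\<^bsub>compl\<^esub>"
        using compl_norm[OF cauchy_diff[OF \<open>cauchy a\<close> cauchy_const[OF a(1)]]]
        by (simp add: k_def compl_diff[OF \<open>cauchy a\<close> cauchy_const[OF a(1)]])
      note lim = this
      have "\<parallel>point a \<ominus>\<^bsub>compl\<^esub> k (a m)\<parallel>\<^bsub>compl\<^esub> \<le> e/2"
        by (rule LIMSEQ_le_const2[OF lim]) (use N[THEN less_imp_le] that in blast)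
      moreover have "0 \<le> \<parallel>point a \<ominus>\<^bsub>compl\<^esub> k (a m)\<parallel>\<^bsub>compl\<^esub>"
        by (rule LIMSEQ_le_const[OF lim]) (use a(1) in simp)
      ultimately show ?thesis using e by simp
    qed
    then show "\<exists>N. \<forall>n\<ge>N. norm (\<parallel>point a \<ominus>\<^bsub>compl\<^esub> k (a n)\<parallel>\<^bsub>compl\<^esub> - 0) < e" by blast
  qed
  from tendsto_add[OF LIMSEQ_Suc[OF lim_1_over_n] this]
  have lim: "(\<lambda>n. 1 / real (Suc n) + \<parallel>point a \<ominus>\<^bsub>compl\<^esub> k (a n)\<parallel>\<^bsub>compl\<^esub>) \<longlonglongrightarrow> 0" by simp
  have nonneg: "0 \<le> \<parallel>x\<parallel>\<^bsub>compl\<^esub>" if "x \<in> carr compl" for x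
    using that by (elim compl_carrE) (auto intro!: LIMSEQ_le_const[OF compl_norm] simp: cauchy_carr)
  have "norm (vdist compl (F n) (point a)) \<le> 1 / real (Suc n) + \<parallel>point a \<ominus>\<^bsub>compl\<^esub> k (a n)\<parallel>\<^bsub>compl\<^esub>" for n
    using tri[OF FC k[OF a(1)] l, of n n] a(2)[of n] comm[OF k[OF a(1)] l, of n] nonneg[of "F n \<ominus>\<^bsub>compl\<^esub> point a"] FC[of n] l
    by (simp add: vdist_def)
  then have "(\<lambda>n. vdist compl (F n) (point a)) \<longlonglongrightarrow> 0"
    by (intro Lim_null_comparison[OF always_eventually lim] allI)
  then show ?thesis using l by blast
qed

lemma compl_hilbert: "hilbert_space compl"
proof -
  interpret C: complex_space compl by (rule compl_complex_space)
  interpret C: banach_space compl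
    by unfold_locales (auto simp: compl_norm_eq_zero compl_norm_triangle compl_norm_scale compl_complete)
  show ?thesis
  proof
    fix x y z assume "x \<in> carr compl" "y \<in> carr compl" "z \<in> carr compl"
    then obtain S T R where *: "cauchy S" "x = point S" "cauchy T" "y = point T" "cauchy R" "z = point R"
      by (auto elim!: compl_carrE)
    note c = cauchy_carr[OF *(1)] cauchy_carr[OF *(3)] cauchy_carr[OF *(5)]
    have "(\<lambda>n. s (S n \<oplus> T n) (R n)) \<longlonglongrightarrow> vinner compl (x \<oplus>\<^bsub>compl\<^esub> y) z"
      using compl_inner[OF cauchy_add[OF *(1,3)] *(5)] * by (simp add: compl_add)
    moreover have "(\<lambda>n. s (S n \<oplus> T n) (R n)) \<longlonglongrightarrow> vinner compl x z + vinner compl y z"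
      using tendsto_add[OF compl_inner[OF *(1,5)] compl_inner[OF *(3,5)]] * c by (simp add: form_add)
    ultimately show "vinner compl (x \<oplus>\<^bsub>compl\<^esub> y) z = vinner compl x z + vinner compl y z"
      using LIMSEQ_unique by blast
  next
    fix x y c assume "x \<in> carr compl" "y \<in> carr compl"
    then obtain S T where *: "cauchy S" "x = point S" "cauchy T" "y = point T"
      by (auto elim!: compl_carrE)
    note cc = cauchy_carr[OF *(1)] cauchy_carr[OF *(3)]
    have "(\<lambda>n. s (c \<odot> S n) (T n)) \<longlonglongrightarrow> vinner compl (c \<odot>\<^bsub>compl\<^esub> x) y"
      using compl_inner[OF cauchy_scale[OF *(1)] *(3)] * by (simp add: compl_scale)
    moreover have "(\<lambda>n. s (c \<odot> S n) (T n)) \<longlonglongrightarrow> c * vinner compl x y"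
      using tendsto_mult_left[OF compl_inner[OF *(1,3)]] * cc by (simp add: form_scale)
    ultimately show "vinner compl (c \<odot>\<^bsub>compl\<^esub> x) y = c * vinner compl x y"
      using LIMSEQ_unique by blast
    have "(\<lambda>n. s (T n) (S n)) \<longlonglongrightarrow> cnj (vinner compl x y)"
      using tendsto_cnj[OF compl_inner[OF *(1,3)]] * form_cnj[OF cc] by simp
    then show "vinner compl y x = cnj (vinner compl x y)"
      using compl_inner[OF *(3,1)] * LIMSEQ_unique by blast
  next
    fix x assume "x \<in> carr compl"
    then obtain S where *: "cauchy S" "x = point S"
      by (auto elim!: compl_carrE)
    have "(\<lambda>n. s (S n) (S n)) \<longlonglongrightarrow> complex_of_real ((\<parallel>x\<parallel>\<^bsub>compl\<^esub>)\<^sup>2)"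
      using tendsto_of_real[OF tendsto_power[OF compl_norm[OF *(1)], of 2]] * form_self[OF cauchy_carr[OF *(1)]]
      by simp
    then show "vinner compl x x = complex_of_real ((\<parallel>x\<parallel>\<^bsub>compl\<^esub>)\<^sup>2)"
      using compl_inner[OF *(1,1)] * LIMSEQ_unique by blast
  qed
qed

end

section \<open>Quasi-states and irreducible representations\<close>

text \<open>
  The inequalities would follow from positivity and norm at most 1 by means of an approximate unit.
  Taken as part of the definition they give the cyclic vector and the boundedness of the GNS
  representation at once, hold trivially for vector functionals, and are preserved by pointwise
  limits and by convex combinations.
\<close>

definition quasi_state :: "('a, 'm) star_alg_scheme \<Rightarrow> ('a \<Rightarrow> complex) \<Rightarrow> bool" where
  "quasi_state A \<phi> \<longleftrightarrow>
     (\<forall>a\<in>carr A. \<forall>b\<in>carr A. \<phi> (a \<oplus>\<^bsub>A\<^esub> b) = \<phi> a + \<phi> b) \<and>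
     (\<forall>c. \<forall>a\<in>carr A. \<phi> (c \<odot>\<^bsub>A\<^esub> a) = c * \<phi> a) \<and>
     (\<forall>a\<in>carr A. \<phi> (astar A a) = cnj (\<phi> a)) \<and>
     (\<forall>a\<in>carr A. (cmod (\<phi> a))\<^sup>2 \<le> Re (\<phi> (astar A a \<otimes>\<^bsub>A\<^esub> a))) \<and>
     (\<forall>a\<in>carr A. \<forall>b\<in>carr A. Re (\<phi> (astar A (a \<otimes>\<^bsub>A\<^esub> b) \<otimes>\<^bsub>A\<^esub> (a \<otimes>\<^bsub>A\<^esub> b)))
        \<le> (\<parallel>a\<parallel>\<^bsub>A\<^esub>)\<^sup>2 * Re (\<phi> (astar A b \<otimes>\<^bsub>A\<^esub> b))) \<and>
     (\<forall>a\<in>carr A. cmod (\<phi> a) \<le> \<parallel>a\<parallel>\<^bsub>A\<^esub>)"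

lemma representationD:
  assumes "representation A V L"
  shows "hilbert_space V"
    and "a \<in> carr A \<Longrightarrow> bounded_op V (L a)"
    and "a \<in> carr A \<Longrightarrow> op_norm V (L a) \<le> \<parallel>a\<parallel>\<^bsub>A\<^esub>"
    and "\<lbrakk>a \<in> carr A; b \<in> carr A; x \<in> carr V\<rbrakk> \<Longrightarrow> L (a \<oplus>\<^bsub>A\<^esub> b) x = L a x \<oplus>\<^bsub>V\<^esub> L b x"
    and "\<lbrakk>a \<in> carr A; b \<in> carr A; x \<in> carr V\<rbrakk> \<Longrightarrow> L (a \<otimes>\<^bsub>A\<^esub> b) x = L a (L b x)"
    and "\<lbrakk>a \<in> carr A; x \<in> carr V\<rbrakk> \<Longrightarrow> L (c \<odot>\<^bsub>A\<^esub> a) x = c \<odot>\<^bsub>V\<^esub> L a x"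
    and "\<lbrakk>a \<in> carr A; x \<in> carr V; y \<in> carr V\<rbrakk> \<Longrightarrow> vinner V (L a x) y = vinner V x (L (astar A a) y)"
    and "\<lbrakk>a \<in> carr A; x \<in> carr V\<rbrakk> \<Longrightarrow> L a x \<in> carr V"
proof -
  show bounded: "bounded_op V (L a)" if "a \<in> carr A" for a
    using assms that by (simp add: representation_def)
  show "\<lbrakk>a \<in> carr A; x \<in> carr V\<rbrakk> \<Longrightarrow> L a x \<in> carr V"
    using bounded_opD(1)[OF bounded] .
qed (use assms in \<open>simp_all add: representation_def\<close>)

lemma representation_norm_le:
  assumes L: "representation A V L" and a: "a \<in> carr A" and x: "x \<in> carr V"
  shows "\<parallel>L a x\<parallel>\<^bsub>V\<^esub> \<le> \<parallel>a\<parallel>\<^bsub>A\<^esub> * \<parallel>x\<parallel>\<^bsub>V\<^esub>"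
proof -
  interpret hilbert_space V using representationD(1)[OF L] .
  have "\<parallel>L a x\<parallel>\<^bsub>V\<^esub> \<le> op_norm V (L a) * \<parallel>x\<parallel>\<^bsub>V\<^esub>"
    using op_norm_bound representationD(2)[OF L a] x by blast
  also have "\<dots> \<le> \<parallel>a\<parallel>\<^bsub>A\<^esub> * \<parallel>x\<parallel>\<^bsub>V\<^esub>"
    using representationD(3)[OF L a] x by (intro mult_right_mono) auto
  finally show ?thesis .
qed

lemma (in cstar_algebra) vector_state:
  assumes L: "representation A V L" and \<xi>: "\<xi> \<in> carr V" "\<parallel>\<xi>\<parallel>\<^bsub>V\<^esub> \<le> 1"
  shows "quasi_state A (\<lambda>a. vinner V (L a \<xi>) \<xi>)"
proof -
  interpret V: hilbert_space V using representationD(1)[OF L] .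
  note Ld = representationD[OF L]
  have pos: "Re (vinner V (L (astar A a \<otimes> a) \<xi>) \<xi>) = (\<parallel>L a \<xi>\<parallel>\<^bsub>V\<^esub>)\<^sup>2" if a: "a \<in> carr A" for a
    using Ld(5)[of "astar A a" a \<xi>] Ld(7)[of "astar A a" "L a \<xi>" \<xi>] a \<xi> Ld(8)
      V.inner_norm[of "L a \<xi>"] by simp
  have le: "cmod (vinner V (L a \<xi>) \<xi>) \<le> \<parallel>L a \<xi>\<parallel>\<^bsub>V\<^esub>" if a: "a \<in> carr A" for a
  proof -
    have "cmod (vinner V (L a \<xi>) \<xi>) \<le> \<parallel>L a \<xi>\<parallel>\<^bsub>V\<^esub> * \<parallel>\<xi>\<parallel>\<^bsub>V\<^esub>"
      using V.inner_cauchy_schwarz Ld(8) a \<xi>(1) by blast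
    also have "\<dots> \<le> \<parallel>L a \<xi>\<parallel>\<^bsub>V\<^esub> * 1"
      using Ld(8) a \<xi> by (intro mult_left_mono) auto
    finally show ?thesis by simp
  qed
  show ?thesis
    unfolding quasi_state_def
  proof (intro conjI ballI allI)
    fix a b c assume a: "a \<in> carr A" and b: "b \<in> carr A"
    show "vinner V (L (a \<oplus> b) \<xi>) \<xi> = vinner V (L a \<xi>) \<xi> + vinner V (L b \<xi>) \<xi>"
      using Ld a b \<xi> by (simp add: V.inner_add)
    show "Re (vinner V (L (astar A (a \<otimes> b) \<otimes> (a \<otimes> b)) \<xi>) \<xi>)
        \<le> \<parallel>a\<parallel>\<^sup>2 * Re (vinner V (L (astar A b \<otimes> b) \<xi>) \<xi>)"
    proof -
      have "\<parallel>L (a \<otimes> b) \<xi>\<parallel>\<^bsub>V\<^esub> \<le> \<parallel>a\<parallel> * \<parallel>L b \<xi>\<parallel>\<^bsub>V\<^esub>"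
        using representation_norm_le[OF L a Ld(8)[OF b \<xi>(1)]] Ld(5)[OF a b \<xi>(1)] by simp
      then have "(\<parallel>L (a \<otimes> b) \<xi>\<parallel>\<^bsub>V\<^esub>)\<^sup>2 \<le> (\<parallel>a\<parallel> * \<parallel>L b \<xi>\<parallel>\<^bsub>V\<^esub>)\<^sup>2"
        using Ld(8) a b \<xi>(1) by (intro power_mono) auto
      then show ?thesis using pos[of "a \<otimes> b"] pos[of b] a b by (simp add: power_mult_distrib)
    qed
  next
    fix a c assume a: "a \<in> carr A"
    show "vinner V (L (c \<odot> a) \<xi>) \<xi> = c * vinner V (L a \<xi>) \<xi>"
      using Ld a \<xi> by (simp add: V.inner_scale)
    show "vinner V (L (astar A a) \<xi>) \<xi> = cnj (vinner V (L a \<xi>) \<xi>)"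
      using Ld(7)[OF a \<xi>(1,1)] V.inner_cnj[of "L (astar A a) \<xi>" \<xi>] Ld(8) a \<xi> by simp
    show "(cmod (vinner V (L a \<xi>) \<xi>))\<^sup>2 \<le> Re (vinner V (L (astar A a \<otimes> a) \<xi>) \<xi>)"
      using le[OF a] pos[OF a] by (simp add: power_mono)
    have "\<parallel>L a \<xi>\<parallel>\<^bsub>V\<^esub> \<le> \<parallel>a\<parallel> * \<parallel>\<xi>\<parallel>\<^bsub>V\<^esub>"
      using representation_norm_le[OF L a \<xi>(1)] .
    also have "\<dots> \<le> \<parallel>a\<parallel> * 1" using \<xi> a by (intro mult_left_mono) auto
    finally show "cmod (vinner V (L a \<xi>) \<xi>) \<le> \<parallel>a\<parallel>" using le[OF a] by simp
  qed
qed

locale gns = cstar_algebra A for A :: "('a, 'm) star_alg_scheme" (structure) +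
  fixes \<phi> :: "'a \<Rightarrow> complex" and q :: "'e \<Rightarrow> 'a"
  assumes qs: "quasi_state A \<phi>" and q_range: "carr A \<subseteq> range q"
begin

lemma phi_add: "\<lbrakk>a \<in> carr A; b \<in> carr A\<rbrakk> \<Longrightarrow> \<phi> (a \<oplus> b) = \<phi> a + \<phi> b"
  and phi_scale: "a \<in> carr A \<Longrightarrow> \<phi> (c \<odot> a) = c * \<phi> a"
  and phi_star: "a \<in> carr A \<Longrightarrow> \<phi> (astar A a) = cnj (\<phi> a)"
  and phi_sq: "a \<in> carr A \<Longrightarrow> (cmod (\<phi> a))\<^sup>2 \<le> Re (\<phi> (astar A a \<otimes> a))"
  and phi_mult: "\<lbrakk>a \<in> carr A; b \<in> carr A\<rbrakk>
    \<Longrightarrow> Re (\<phi> (astar A (a \<otimes> b) \<otimes> (a \<otimes> b))) \<le> \<parallel>a\<parallel>\<^sup>2 * Re (\<phi> (astar A b \<otimes> b))"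
  using qs unfolding quasi_state_def by blast+

end

sublocale gns \<subseteq> H: hausdorff_completion A "\<lambda>a b. \<phi> (astar A b \<otimes> a)" q
proof
  fix x y z c assume x: "x \<in> carr A" and y: "y \<in> carr A"
  show "\<phi> (astar A y \<otimes> c \<odot> x) = c * \<phi> (astar A y \<otimes> x)"
    using x y by (simp add: mult_scale_right phi_scale)
  show "\<phi> (astar A x \<otimes> y) = cnj (\<phi> (astar A y \<otimes> x))"
    using phi_star[of "astar A y \<otimes> x"] x y by (simp add: star_mult)
  assume z: "z \<in> carr A"
  show "\<phi> (astar A z \<otimes> (x \<oplus> y)) = \<phi> (astar A z \<otimes> x) + \<phi> (astar A z \<otimes> y)"
    using x y z by (simp add: mult_add_right phi_add)
next
  fix x assume x: "x \<in> carr A"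
  show "0 \<le> Re (\<phi> (astar A x \<otimes> x))"
    by (rule order_trans[OF zero_le_power2 phi_sq[OF x]])
qed (rule q_range)

context gns
begin

definition \<rho> :: "'a \<Rightarrow> ('e \<Rightarrow> complex) \<Rightarrow> 'e \<Rightarrow> complex" where
  "\<rho> a F = H.point (\<lambda>n. a \<otimes> H.rep F n)"

abbreviation \<kappa> :: "'a \<Rightarrow> 'e \<Rightarrow> complex" where
  "\<kappa> a \<equiv> H.point (\<lambda>n. a)"

lemma seminorm_mult: "\<lbrakk>a \<in> carr A; x \<in> carr A\<rbrakk> \<Longrightarrow> H.seminorm (a \<otimes> x) \<le> \<parallel>a\<parallel> * H.seminorm x"
  using real_sqrt_le_mono[OF phi_mult[of a x]]
  by (simp add: H.seminorm_def real_sqrt_mult)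

lemma lipschitz: "\<lbrakk>a \<in> carr A; x \<in> carr A; y \<in> carr A\<rbrakk>
    \<Longrightarrow> H.seminorm (a \<otimes> x \<ominus> a \<otimes> y) \<le> \<parallel>a\<parallel> * H.seminorm (x \<ominus> y)"
  using seminorm_mult[of a "x \<ominus> y"] by (simp add: mult_diff_right)

lemma cauchy_mult: "\<lbrakk>a \<in> carr A; H.cauchy S\<rbrakk> \<Longrightarrow> H.cauchy (\<lambda>n. a \<otimes> S n)"
  by (rule H.cauchy_image[where M = "\<parallel>a\<parallel>"]) (auto intro: lipschitz)

lemma rho_point: "\<lbrakk>a \<in> carr A; H.cauchy S\<rbrakk> \<Longrightarrow> \<rho> a (H.point S) = H.point (\<lambda>n. a \<otimes> S n)"
  unfolding \<rho>_def by (rule H.compl_map[where M = "\<parallel>a\<parallel>"]) (auto intro: lipschitz)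

lemma rho_closed: "\<lbrakk>a \<in> carr A; F \<in> carr H.compl\<rbrakk> \<Longrightarrow> \<rho> a F \<in> carr H.compl"
  by (auto elim!: H.compl_carrE simp: rho_point cauchy_mult)

lemma rho_norm:
  assumes a: "a \<in> carr A" and F: "F \<in> carr H.compl"
  shows "\<parallel>\<rho> a F\<parallel>\<^bsub>H.compl\<^esub> \<le> \<parallel>a\<parallel> * \<parallel>F\<parallel>\<^bsub>H.compl\<^esub>"
proof -
  obtain S where S: "H.cauchy S" "F = H.point S" using F by (rule H.compl_carrE)
  show ?thesis
    unfolding S(2) rho_point[OF a S(1)]
    by (rule LIMSEQ_le[OF H.compl_norm[OF cauchy_mult[OF a S(1)]] tendsto_mult_left[OF H.compl_norm[OF S(1)]]])
      (use seminorm_mult[OF a] H.cauchy_carr[OF S(1)] in blast)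
qed

lemma rho_representation: "representation A H.compl \<rho>"
proof -
  interpret V: hilbert_space H.compl by (rule H.compl_hilbert)
  have bounded: "bounded_op H.compl (\<rho> a)" if a: "a \<in> carr A" for a
  proof (rule bounded_opI)
    fix x y c assume x: "x \<in> carr H.compl" and y: "y \<in> carr H.compl"
    obtain S T where *: "H.cauchy S" "x = H.point S" "H.cauchy T" "y = H.point T"
      using x y H.compl_carr by blast
    note cc = H.cauchy_carr[OF *(1)] H.cauchy_carr[OF *(3)]
    show "\<rho> a (x \<oplus>\<^bsub>H.compl\<^esub> y) = \<rho> a x \<oplus>\<^bsub>H.compl\<^esub> \<rho> a y"
      using a cc * by (simp add: rho_point H.compl_add H.cauchy_add cauchy_mult mult_add_right)
  next
    fix x c assume x: "x \<in> carr H.compl"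
    obtain S where *: "H.cauchy S" "x = H.point S"
      using x H.compl_carr by blast
    show "\<rho> a (c \<odot>\<^bsub>H.compl\<^esub> x) = c \<odot>\<^bsub>H.compl\<^esub> \<rho> a x"
      using a H.cauchy_carr[OF *(1)] *
      by (simp add: rho_point H.compl_scale H.cauchy_scale cauchy_mult mult_scale_right)
  qed (use rho_closed rho_norm a in auto)
  show ?thesis
    unfolding representation_def
  proof (intro conjI ballI allI)
    show "hilbert_space H.compl" by (rule H.compl_hilbert)
    fix a assume a: "a \<in> carr A"
    show "bounded_op H.compl (\<rho> a)" by (rule bounded[OF a])
    show "op_norm H.compl (\<rho> a) \<le> \<parallel>a\<parallel>"
      by (rule V.op_norm_le[OF rho_norm[OF a]]) (use a in auto)
    fix x assume x: "x \<in> carr H.compl"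
    obtain S where S: "H.cauchy S" "x = H.point S" using x by (rule H.compl_carrE)
    note Sc = H.cauchy_carr[OF S(1)]
    show "\<rho> (c \<odot> a) x = c \<odot>\<^bsub>H.compl\<^esub> \<rho> a x" for c
      using a S Sc by (simp add: rho_point H.compl_scale cauchy_mult mult_scale_left)
    show "\<rho> (a \<oplus> b) x = \<rho> a x \<oplus>\<^bsub>H.compl\<^esub> \<rho> b x" if b: "b \<in> carr A" for b
      using a b S Sc by (simp add: rho_point H.compl_add cauchy_mult mult_add_left)
    show "\<rho> (a \<otimes> b) x = \<rho> a (\<rho> b x)" if b: "b \<in> carr A" for b
      using a b S Sc by (simp add: rho_point cauchy_mult mult_assoc)
    fix y assume "y \<in> carr H.compl"
    then obtain T where T: "H.cauchy T" "y = H.point T" by (rule H.compl_carrE)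
    have "(\<lambda>n. \<phi> (astar A (T n) \<otimes> (a \<otimes> S n))) \<longlonglongrightarrow> vinner H.compl (\<rho> a x) y"
      using H.compl_inner[OF cauchy_mult[OF a S(1)] T(1)] a S T by (simp add: rho_point)
    moreover have "(\<lambda>n. \<phi> (astar A (astar A a \<otimes> T n) \<otimes> S n)) \<longlonglongrightarrow> vinner H.compl x (\<rho> (astar A a) y)"
      using H.compl_inner[OF S(1) cauchy_mult[OF star_closed[OF a] T(1)]] a S T by (simp add: rho_point)
    ultimately show "vinner H.compl (\<rho> a x) y = vinner H.compl x (\<rho> (astar A a) y)"
      using a Sc H.cauchy_carr[OF T(1)] LIMSEQ_unique by (simp add: star_mult mult_assoc)
  qed
qed

lemma kappa_closed: "a \<in> carr A \<Longrightarrow> \<kappa> a \<in> carr H.compl"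
  by (simp add: H.cauchy_const)

lemma kappa_dense:
  assumes y: "y \<in> carr H.compl" and orth: "\<And>a. a \<in> carr A \<Longrightarrow> vinner H.compl (\<kappa> a) y = 0"
  shows "y = \<zero>\<^bsub>H.compl\<^esub>"
proof -
  interpret V: hilbert_space H.compl by (rule H.compl_hilbert)
  obtain S where S: "H.cauchy S" "y = H.point S" using y by (rule H.compl_carrE)
  have "H.point S e = H.point (\<lambda>n. \<zero>) e" for e
  proof (cases "q e \<in> carr A")
    case True
    have "vinner H.compl y (\<kappa> (q e)) = 0"
      using V.inner_cnj[OF kappa_closed[OF True] y] orth[OF True] by simp
    moreover have "(\<lambda>n. \<phi> (astar A (q e) \<otimes> S n)) \<longlonglongrightarrow> vinner H.compl y (\<kappa> (q e))"
      using H.compl_inner[OF S(1) H.cauchy_const[OF True]] S by simp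
    ultimately have "H.point S e = 0"
      using LIMSEQ_unique[OF H.point_at[OF S(1) refl True]] by simp
    moreover have "H.point (\<lambda>n. \<zero>) e = 0"
      using True phi_scale[of \<zero> 0] by (simp add: H.point_def)
    ultimately show ?thesis by simp
  qed (simp add: H.point_def)
  then show ?thesis using S(2) H.compl_zero by auto
qed

text \<open>
  By \<open>\<bar>\<phi> a\<bar>\<^sup>2 \<le> \<phi> (a\<^sup>*a)\<close> the functional \<open>\<phi>\<close> is bounded on the image of the algebra in
  its completion, and \<open>\<xi>\<close> is the vector that represents it. It plays the role of the class of
  a unit.
\<close>

lemma cyclic_vector:
  obtains \<xi> where "\<xi> \<in> carr H.compl" "\<parallel>\<xi>\<parallel>\<^bsub>H.compl\<^esub> \<le> 1"
    "\<And>a. a \<in> carr A \<Longrightarrow> \<rho> a \<xi> = \<kappa> a" "\<And>a. a \<in> carr A \<Longrightarrow> \<phi> a = vinner H.compl (\<rho> a \<xi>) \<xi>"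
proof -
  interpret V: hilbert_space H.compl by (rule H.compl_hilbert)
  note R = representationD[OF rho_representation]
  define D where "D = \<kappa> ` carr A"
  define \<psi> where "\<psi> d = \<phi> (inv_into (carr A) \<kappa> d)" for d
  have le: "cmod (\<phi> a) \<le> \<parallel>\<kappa> a\<parallel>\<^bsub>H.compl\<^esub>" if a: "a \<in> carr A" for a
    using real_sqrt_le_mono[OF phi_sq[OF a]] H.compl_norm_const[OF a] by (simp add: H.seminorm_def)
  have k_add: "\<kappa> a \<oplus>\<^bsub>H.compl\<^esub> \<kappa> b = \<kappa> (a \<oplus> b)" and k_scale: "c \<odot>\<^bsub>H.compl\<^esub> \<kappa> a = \<kappa> (c \<odot> a)"
    if "a \<in> carr A" "b \<in> carr A" for a b c
    using that by (auto simp: H.compl_add H.compl_scale H.cauchy_const)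
  have \<psi>: "\<psi> (\<kappa> a) = \<phi> a" if a: "a \<in> carr A" for a
  proof -
    define b where "b = inv_into (carr A) \<kappa> (\<kappa> a)"
    have b: "b \<in> carr A" "\<kappa> b = \<kappa> a"
      using a by (auto simp: b_def intro: inv_into_into f_inv_into_f)
    have "\<kappa> (b \<ominus> a) = \<zero>\<^bsub>H.compl\<^esub>"
      using a b V.add_minus[OF kappa_closed[OF a]] by (simp add: k_add[symmetric] k_scale[symmetric])
    then have "\<phi> (b \<ominus> a) = 0" using le[of "b \<ominus> a"] a b by simp
    then show ?thesis using a b phi_add[of b "(-1) \<odot> a"] by (simp add: phi_scale \<psi>_def flip: b_def)
  qed
  obtain \<xi> S where \<xi>: "\<xi> \<in> carr H.compl" "range S \<subseteq> D" "(\<lambda>n. vdist H.compl (S n) \<xi>) \<longlonglongrightarrow> 0"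
    "\<And>d. d \<in> D \<Longrightarrow> \<psi> d = vinner H.compl d \<xi>"
  proof (rule V.riesz[of D \<psi> 1])
    show "D \<subseteq> carr H.compl" using kappa_closed by (auto simp: D_def)
    show "\<zero>\<^bsub>H.compl\<^esub> \<in> D" using H.compl_zero by (auto simp: D_def)
    show "x \<oplus>\<^bsub>H.compl\<^esub> y \<in> D" if "x \<in> D" "y \<in> D" for x y
      using that by (auto simp: D_def k_add)
    show "c \<odot>\<^bsub>H.compl\<^esub> x \<in> D" if "x \<in> D" for c x
      using that by (auto simp: D_def k_scale)
    show "\<psi> (x \<oplus>\<^bsub>H.compl\<^esub> y) = \<psi> x + \<psi> y" if "x \<in> D" "y \<in> D" for x y
      using that by (auto simp: D_def k_add \<psi> phi_add)
    show "\<psi> (c \<odot>\<^bsub>H.compl\<^esub> x) = c * \<psi> x" if "x \<in> D" for c x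
      using that by (auto simp: D_def k_scale \<psi> phi_scale)
    show "cmod (\<psi> x) \<le> 1 * \<parallel>x\<parallel>\<^bsub>H.compl\<^esub>" if "x \<in> D" for x
      using that le by (auto simp: D_def \<psi>)
  qed blast
  have \<phi>_eq: "\<phi> a = vinner H.compl (\<kappa> a) \<xi>" if a: "a \<in> carr A" for a
    using \<xi>(4)[of "\<kappa> a"] \<psi>[OF a] a by (simp add: D_def)
  have SV: "S n \<in> carr H.compl" for n
  proof -
    have "S n \<in> D" using subsetD[OF \<xi>(2) rangeI] .
    then show ?thesis unfolding D_def using kappa_closed by (elim imageE) simp
  qed
  have "cmod (vinner H.compl (S n) \<xi>) \<le> \<parallel>S n\<parallel>\<^bsub>H.compl\<^esub>" for n
  proof -
    have "S n \<in> D" using subsetD[OF \<xi>(2) rangeI] .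
    then obtain a where "S n = \<kappa> a" "a \<in> carr A" unfolding D_def by (rule imageE)
    then show ?thesis using le[of a] \<phi>_eq[of a] by simp
  qed
  then have "cmod (vinner H.compl \<xi> \<xi>) \<le> \<parallel>\<xi>\<parallel>\<^bsub>H.compl\<^esub>"
    using SV \<xi> by (intro LIMSEQ_le[OF tendsto_norm[OF V.inner_tendsto] V.norm_tendsto]) auto
  then have "(\<parallel>\<xi>\<parallel>\<^bsub>H.compl\<^esub>)\<^sup>2 \<le> \<parallel>\<xi>\<parallel>\<^bsub>H.compl\<^esub>" using \<xi>(1) by (simp add: V.inner_norm norm_power)
  then have n1: "\<parallel>\<xi>\<parallel>\<^bsub>H.compl\<^esub> \<le> 1"
    using V.norm_nonneg[OF \<xi>(1)] by (cases "\<parallel>\<xi>\<parallel>\<^bsub>H.compl\<^esub> = 0") (auto simp: power2_eq_square mult_le_cancel_right)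
  have \<rho>_eq: "\<rho> a \<xi> = \<kappa> a" if a: "a \<in> carr A" for a
  proof -
    have "vinner H.compl (\<kappa> b) (\<rho> a \<xi>) = vinner H.compl (\<kappa> b) (\<kappa> a)" if b: "b \<in> carr A" for b
    proof -
      have "vinner H.compl (\<kappa> b) (\<rho> a \<xi>) = vinner H.compl (\<rho> (astar A a) (\<kappa> b)) \<xi>"
        using R(7)[OF star_closed[OF a] kappa_closed[OF b] \<xi>(1)] a by simp
      also have "\<rho> (astar A a) (\<kappa> b) = \<kappa> (astar A a \<otimes> b)"
        using a b by (simp add: rho_point H.cauchy_const)
      also have "vinner H.compl \<dots> \<xi> = \<phi> (astar A a \<otimes> b)" using \<phi>_eq a b by simp
      also have "\<dots> = vinner H.compl (\<kappa> b) (\<kappa> a)" using H.compl_inner_const[OF b a] by simp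
      finally show ?thesis .
    qed
    then have "\<rho> a \<xi> \<ominus>\<^bsub>H.compl\<^esub> \<kappa> a = \<zero>\<^bsub>H.compl\<^esub>"
      using R(8)[OF a \<xi>(1)] kappa_closed a by (intro kappa_dense) (auto simp: V.form.form_diff_right)
    then show ?thesis using V.diff_eq_zero R(8)[OF a \<xi>(1)] kappa_closed[OF a] by blast
  qed
  show thesis using that[OF \<xi>(1) n1 \<rho>_eq] \<phi>_eq \<rho>_eq by simp
qed

end

lemma (in cstar_algebra) gns_construction:
  fixes q :: "'e \<Rightarrow> 'a"
  assumes "quasi_state A \<phi>" "carr A \<subseteq> range q"
  obtains V :: "('e \<Rightarrow> complex) ispace" and \<rho> \<xi> where "representation A V \<rho>" "\<xi> \<in> carr V" "\<parallel>\<xi>\<parallel>\<^bsub>V\<^esub> \<le> 1"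
    "\<And>a. a \<in> carr A \<Longrightarrow> \<phi> a = vinner V (\<rho> a \<xi>) \<xi>"
    "\<And>y. \<lbrakk>y \<in> carr V; \<And>a. a \<in> carr A \<Longrightarrow> vinner V (\<rho> a \<xi>) y = 0\<rbrakk> \<Longrightarrow> y = \<zero>\<^bsub>V\<^esub>"
proof -
  interpret gns A \<phi> q by unfold_locales (use assms in auto)
  obtain \<xi> where \<xi>: "\<xi> \<in> carr H.compl" "\<parallel>\<xi>\<parallel>\<^bsub>H.compl\<^esub> \<le> 1"
    "\<And>a. a \<in> carr A \<Longrightarrow> \<rho> a \<xi> = \<kappa> a" "\<And>a. a \<in> carr A \<Longrightarrow> \<phi> a = vinner H.compl (\<rho> a \<xi>) \<xi>"
    using cyclic_vector by blast
  show thesis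
    by (rule that[OF rho_representation \<xi>(1,2,4)]) (use kappa_dense \<xi>(3) in auto)
qed

subsection \<open>Extreme points\<close>

definition extreme_in :: "('a \<Rightarrow> complex) set \<Rightarrow> ('a \<Rightarrow> complex) \<Rightarrow> bool" where
  "extreme_in C \<phi> \<longleftrightarrow> \<phi> \<in> C \<and> (\<forall>\<psi>\<in>C. \<forall>\<omega>\<in>C. \<forall>t. 0 < t \<and> t < 1 \<and>
     \<phi> = (\<lambda>a. complex_of_real t * \<psi> a + complex_of_real (1 - t) * \<omega> a) \<longrightarrow> \<psi> = \<phi>)"

definition face_of_set :: "('a \<Rightarrow> complex) set \<Rightarrow> ('a \<Rightarrow> complex) set \<Rightarrow> bool" where
  "face_of_set C F \<longleftrightarrow> closed F \<and> F \<noteq> {} \<and> F \<subseteq> C \<and> (\<forall>\<psi>\<in>C. \<forall>\<omega>\<in>C. \<forall>t. 0 < t \<and> t < 1 \<and>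
     (\<lambda>a. complex_of_real t * \<psi> a + complex_of_real (1 - t) * \<omega> a) \<in> F \<longrightarrow> \<psi> \<in> F \<and> \<omega> \<in> F)"

lemma maximizing_face:
  fixes F :: "('a \<Rightarrow> complex) set"
  assumes C: "compact C" and F: "face_of_set C F"
  shows "face_of_set C {\<phi>\<in>F. \<forall>\<psi>\<in>F. Re (c * \<psi> a) \<le> Re (c * \<phi> a)}" (is "face_of_set C ?M")
proof -
  define l where "l \<phi> = Re (c * \<phi> a)" for \<phi> :: "'a \<Rightarrow> complex"
  have cont: "continuous_on F l" for F
    unfolding l_def by (intro continuous_intros continuous_on_subset[OF continuous_on_product_coordinates]) auto
  have Fd: "closed F" "F \<noteq> {}" "F \<subseteq> C" using F by (auto simp: face_of_set_def)
  have "compact (F \<inter> C)" using Fd(1) C by (rule closed_Int_compact)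
  then have "compact F" using Fd(3) by (simp add: Int_absorb2)
  obtain \<phi>0 where \<phi>0: "\<phi>0 \<in> F" "\<And>\<psi>. \<psi> \<in> F \<Longrightarrow> l \<psi> \<le> l \<phi>0"
    using continuous_attains_sup[OF \<open>compact F\<close> Fd(2) cont] by blast
  have M: "?M = {\<phi>\<in>F. l \<phi>0 \<le> l \<phi>}"
    using \<phi>0 by (force simp: l_def)
  have "closed {\<phi>. l \<phi>0 \<le> l \<phi>}"
    by (intro closed_Collect_le continuous_on_const cont)
  then have "closed ({\<phi>. l \<phi>0 \<le> l \<phi>} \<inter> F)" using Fd(1) by (rule closed_Int)
  then have "closed ?M" unfolding M by (simp add: Int_def conj_commute)
  moreover have "\<psi> \<in> ?M \<and> \<omega> \<in> ?M"
    if \<psi>: "\<psi> \<in> C" "\<omega> \<in> C" "0 < t" "t < 1"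
      and mix: "(\<lambda>a. complex_of_real t * \<psi> a + complex_of_real (1 - t) * \<omega> a) \<in> ?M" for \<psi> \<omega> t
  proof -
    have in_F: "\<psi> \<in> F" "\<omega> \<in> F" using F that unfolding face_of_set_def by blast+
    have "l \<phi>0 \<le> l (\<lambda>a. complex_of_real t * \<psi> a + complex_of_real (1 - t) * \<omega> a)" using mix M by blast
    also have "\<dots> = t * l \<psi> + (1 - t) * l \<omega>" by (simp add: l_def algebra_simps)
    finally have le: "l \<phi>0 \<le> t * l \<psi> + (1 - t) * l \<omega>" .
    have "t * l \<psi> \<le> t * l \<phi>0" "(1 - t) * l \<omega> \<le> (1 - t) * l \<phi>0"
      using \<phi>0 in_F \<psi> by (auto intro!: mult_left_mono)
    then have "t * l \<phi>0 \<le> t * l \<psi>" "(1 - t) * l \<phi>0 \<le> (1 - t) * l \<omega>" using le by (auto simp: algebra_simps)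
    then have "l \<phi>0 \<le> l \<psi>" "l \<phi>0 \<le> l \<omega>" using \<psi> by auto
    then show ?thesis unfolding M using in_F by blast
  qed
  moreover have "?M \<noteq> {}" unfolding M using \<phi>0(1) by blast
  moreover have "?M \<subseteq> C" using Fd(3) by blast
  ultimately show ?thesis
    unfolding face_of_set_def by (intro conjI ballI allI impI) (blast | simp only:)+
qed

text \<open>
  The complements of faces are ordered by inclusion; the union of a chain of them is again the
  complement of a face, since by compactness the faces in a chain intersect.
\<close>

lemma minimal_face:
  fixes F1 :: "('a \<Rightarrow> complex) set"
  assumes C: "compact C" and F1: "face_of_set C F1"
  obtains F where "face_of_set C F" "F \<subseteq> F1" "\<And>F'. face_of_set C F' \<Longrightarrow> F' \<subseteq> F \<Longrightarrow> F' = F"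
proof -
  define \<A> where "\<A> = uminus ` {F. face_of_set C F \<and> F \<subseteq> F1}"
  have "\<exists>M\<in>\<A>. \<forall>X\<in>\<A>. M \<subseteq> X \<longrightarrow> X = M"
  proof (rule subset_Zorn_nonempty)
    show "\<A> \<noteq> {}" using F1 by (auto simp: \<A>_def)
    fix \<C> assume ne: "\<C> \<noteq> {}" and chain: "subset.chain \<A> \<C>"
    define I where "I = \<Inter>(uminus ` \<C>)"
    have face: "face_of_set C (- X) \<and> - X \<subseteq> F1" if "X \<in> \<C>" for X
      using that chain by (auto simp: \<A>_def subset.chain_def)
    obtain X0 where X0: "X0 \<in> \<C>" using ne by blast
    have closed: "closed (- X)" if "X \<in> \<C>" for X using face[OF that] by (simp add: face_of_set_def)
    have "compact (- X0 \<inter> C)" using closed[OF X0] C by (rule closed_Int_compact)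
    then have cpt: "compact (- X0)" using face[OF X0] by (simp add: face_of_set_def Int_absorb2)
    have fin: "\<B> \<subseteq> \<C> \<Longrightarrow> \<exists>Y\<in>\<C>. - Y \<subseteq> - X0 \<inter> \<Inter>(uminus ` \<B>)" if "finite \<B>" for \<B>
      using that
    proof (induction \<B>)
      case empty
      then show ?case using X0 by auto
    next
      case (insert Z \<B>)
      then obtain Y where Y: "Y \<in> \<C>" "- Y \<subseteq> - X0 \<inter> \<Inter>(uminus ` \<B>)" by blast
      consider "Y \<subseteq> Z" | "Z \<subseteq> Y" using chain Y(1) insert.prems by (auto simp: subset.chain_def)
      then show ?case
      proof cases
        case 1
        then have "- Z \<subseteq> - X0 \<inter> \<Inter>(uminus ` insert Z \<B>)" using Y(2) by auto
        then show ?thesis using insert.prems by blast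
      next
        case 2
        then have "- Y \<subseteq> - X0 \<inter> \<Inter>(uminus ` insert Z \<B>)" using Y(2) by auto
        then show ?thesis using Y(1) by blast
      qed
    qed
    have "- X0 \<inter> \<Inter>(uminus ` \<C>) \<noteq> {}"
    proof (rule compact_imp_fip[OF cpt])
      show "closed T" if "T \<in> uminus ` \<C>" for T using that closed by auto
      fix \<F> assume \<F>: "finite \<F>" "\<F> \<subseteq> uminus ` \<C>"
      then obtain \<B> where \<B>: "finite \<B>" "\<B> \<subseteq> \<C>" "\<F> = uminus ` \<B>"
        by (meson finite_subset_image)
      obtain Y where Y: "Y \<in> \<C>" "- Y \<subseteq> - X0 \<inter> \<Inter>(uminus ` \<B>)" using fin[OF \<B>(1,2)] by blast
      have "- Y \<noteq> {}" using face[OF Y(1)] by (simp add: face_of_set_def)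
      then show "- X0 \<inter> \<Inter>\<F> \<noteq> {}" using Y(2) \<B>(3) by blast
    qed
    then have "I \<noteq> {}" by (auto simp: I_def)
    moreover have "closed I" unfolding I_def using closed by auto
    moreover have "I \<subseteq> F1" "I \<subseteq> C"
      using face[OF X0] X0 unfolding I_def face_of_set_def by blast+
    moreover have "\<psi> \<in> I \<and> \<omega> \<in> I" if *: "\<psi> \<in> C" "\<omega> \<in> C" "0 < t \<and> t < 1 \<and>
      (\<lambda>a. complex_of_real t * \<psi> a + complex_of_real (1 - t) * \<omega> a) \<in> I" for \<psi> \<omega> t
    proof -
      have "\<psi> \<in> - X \<and> \<omega> \<in> - X" if X: "X \<in> \<C>" for X
      proof -
        have "(\<lambda>a. complex_of_real t * \<psi> a + complex_of_real (1 - t) * \<omega> a) \<in> - X"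
          using *(3) X by (auto simp: I_def)
        then show ?thesis using face[OF X] *(1-3) unfolding face_of_set_def by blast
      qed
      then show ?thesis unfolding I_def by blast
    qed
    ultimately have "face_of_set C I \<and> I \<subseteq> F1"
      unfolding face_of_set_def by (intro conjI ballI allI impI) (blast | simp only:)+
    then have "- I \<in> \<A>" by (auto simp: \<A>_def)
    moreover have "- I = \<Union>\<C>" by (auto simp: I_def)
    ultimately show "\<Union>\<C> \<in> \<A>" by simp
  qed
  then obtain M where M: "M \<in> \<A>" "\<And>X. X \<in> \<A> \<Longrightarrow> M \<subseteq> X \<Longrightarrow> X = M" by blast
  show thesis
  proof (rule that[of "- M"])
    show face: "face_of_set C (- M)" "- M \<subseteq> F1" using M(1) by (auto simp: \<A>_def)
    fix F' assume F': "face_of_set C F'" "F' \<subseteq> - M"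
    then have "- F' \<in> \<A>" using face by (auto simp: \<A>_def)
    then have "- F' = M" using M(2) F'(2) by blast
    then show "F' = - M" by blast
  qed
qed

text \<open>
  On a minimal face inside the face where \<open>Re (\<phi> h)\<close> is maximal, the real and imaginary parts
  of all evaluations are constant, so it is a single point.
\<close>

lemma extreme_point_exists:
  fixes C :: "('a \<Rightarrow> complex) set"
  assumes C: "compact C" "closed C" and \<phi>0: "\<phi>0 \<in> C"
  obtains \<phi> where "extreme_in C \<phi>" "Re (\<phi>0 h) \<le> Re (\<phi> h)"
proof -
  have "face_of_set C C" using C \<phi>0 by (auto simp: face_of_set_def)
  from maximizing_face[OF C(1) this, of 1 h]
  have F1: "face_of_set C {\<phi>\<in>C. \<forall>\<psi>\<in>C. Re (\<psi> h) \<le> Re (\<phi> h)}" by simp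
  obtain F where F: "face_of_set C F" "F \<subseteq> {\<phi>\<in>C. \<forall>\<psi>\<in>C. Re (\<psi> h) \<le> Re (\<phi> h)}"
    "\<And>F'. face_of_set C F' \<Longrightarrow> F' \<subseteq> F \<Longrightarrow> F' = F"
    using minimal_face[OF C(1) F1] by blast
  obtain \<phi> where \<phi>: "\<phi> \<in> F" using F(1) by (auto simp: face_of_set_def)
  have single: "\<psi> = \<phi>" if \<psi>: "\<psi> \<in> F" for \<psi>
  proof
    fix a
    have const: "Re (c * \<psi> a) = Re (c * \<phi> a)" for c
    proof -
      have "{\<phi>\<in>F. \<forall>\<psi>\<in>F. Re (c * \<psi> a) \<le> Re (c * \<phi> a)} = F"
        by (rule F(3)[OF maximizing_face[OF C(1) F(1)]]) blast
      then have "\<forall>\<phi>\<in>F. \<forall>\<psi>\<in>F. Re (c * \<psi> a) \<le> Re (c * \<phi> a)" by blast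
      then show ?thesis using \<psi> \<phi> by (meson order_antisym)
    qed
    show "\<psi> a = \<phi> a"
      using const[of 1] const[of "- \<i>"] by (simp add: complex_eq_iff)
  qed
  have "extreme_in C \<phi>"
    unfolding extreme_in_def
  proof (intro conjI ballI allI impI)
    show "\<phi> \<in> C" using \<phi> F by (auto simp: face_of_set_def)
    fix \<psi> \<omega> t
    assume "\<psi> \<in> C" "\<omega> \<in> C" and *: "0 < t \<and> t < 1 \<and> \<phi> = (\<lambda>a. complex_of_real t * \<psi> a + complex_of_real (1 - t) * \<omega> a)"
    then have "(\<lambda>a. complex_of_real t * \<psi> a + complex_of_real (1 - t) * \<omega> a) \<in> F" using \<phi> by metis
    then have "\<psi> \<in> F" using F(1) * \<open>\<psi> \<in> C\<close> \<open>\<omega> \<in> C\<close> unfolding face_of_set_def by blast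
    then show "\<psi> = \<phi>" by (rule single)
  qed
  moreover have "Re (\<phi>0 h) \<le> Re (\<phi> h)" using F(2) \<phi> \<phi>0 by blast
  ultimately show thesis using that by blast
qed

text \<open>
  The functionals vanish off the carrier, so that equality of functionals on the algebra is equality
  of functions.
\<close>

definition quasi_states :: "('a, 'm) star_alg_scheme \<Rightarrow> 'a set \<Rightarrow> ('a \<Rightarrow> complex) set" where
  "quasi_states A K = {\<phi>. quasi_state A \<phi> \<and> (\<forall>a\<in>K. \<phi> a = 0) \<and> (\<forall>a. a \<notin> carr A \<longrightarrow> \<phi> a = 0)}"

lemma closed_quasi_states: "closed (quasi_states A K)"
proof -
  have coord: "continuous_on UNIV (\<lambda>\<phi> :: 'a \<Rightarrow> complex. \<phi> a)" for a by simp
  show ?thesis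
    unfolding quasi_states_def quasi_state_def Ball_def
    by (intro closed_Collect_conj closed_Collect_all closed_Collect_imp closed_Collect_eq closed_Collect_le
        continuous_intros coord open_Collect_const)
qed

text \<open>
  Tychonoff's theorem for the product of the discs of radius \<open>\<parallel>a\<parallel>\<close>.
\<close>

lemma compact_quasi_states: "compact (quasi_states A K)"
proof -
  have "compact (PiE UNIV (\<lambda>a. cball (0::complex) (if a \<in> carr A then \<parallel>a\<parallel>\<^bsub>A\<^esub> else 0)))"
    unfolding compactin_euclidean_iff[symmetric] euclidean_product_topology[symmetric] compactin_PiE
    by auto
  with closed_quasi_states have "compact (quasi_states A K \<inter> PiE UNIV (\<lambda>a. cball (0::complex) (if a \<in> carr A then \<parallel>a\<parallel>\<^bsub>A\<^esub> else 0)))"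
    by (rule closed_Int_compact)
  moreover have "quasi_states A K \<subseteq> PiE UNIV (\<lambda>a. cball (0::complex) (if a \<in> carr A then \<parallel>a\<parallel>\<^bsub>A\<^esub> else 0))"
    by (auto simp: quasi_states_def quasi_state_def)
  ultimately show ?thesis by (simp add: Int_absorb2)
qed

text \<open>
  Decomposing the cyclic vector along an invariant subspace W and its orthogonal complement writes
  \<open>\<phi>\<close> as a convex combination of two quasi-states. Extremality forces the component \<open>\<eta>\<close>
  in W to be a multiple \<open>t \<xi>\<close> of the cyclic vector with \<open>t = t\<^sup>2\<close>, so W is trivial.
\<close>

lemma (in cstar_algebra) extreme_quasi_state_irreducible:
  fixes q :: "'e \<Rightarrow> 'a"
  assumes q: "carr A \<subseteq> range q"
    and K: "K \<subseteq> carr A" "\<And>a k. \<lbrakk>a \<in> carr A; k \<in> K\<rbrakk> \<Longrightarrow> a \<otimes> k \<in> K \<and> k \<otimes> a \<in> K"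
    and ext: "extreme_in (quasi_states A K) \<phi>"
    and h: "h \<in> carr A" "\<phi> h \<noteq> 0"
  obtains V :: "('e \<Rightarrow> complex) ispace" and \<rho> where "irreducible_rep A V \<rho>" "K \<subseteq> rep_kernel A V \<rho>"
    "h \<notin> rep_kernel A V \<rho>"
proof -
  have \<phi>: "quasi_state A \<phi>" "\<And>a. a \<in> K \<Longrightarrow> \<phi> a = 0" "\<And>a. a \<notin> carr A \<Longrightarrow> \<phi> a = 0"
    using ext by (auto simp: extreme_in_def quasi_states_def)
  obtain V :: "('e \<Rightarrow> complex) ispace" and \<rho> \<xi> where V: "representation A V \<rho>" "\<xi> \<in> carr V" "\<parallel>\<xi>\<parallel>\<^bsub>V\<^esub> \<le> 1"
    "\<And>a. a \<in> carr A \<Longrightarrow> \<phi> a = vinner V (\<rho> a \<xi>) \<xi>"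
    "\<And>y. \<lbrakk>y \<in> carr V; \<And>a. a \<in> carr A \<Longrightarrow> vinner V (\<rho> a \<xi>) y = 0\<rbrakk> \<Longrightarrow> y = \<zero>\<^bsub>V\<^esub>"
    using gns_construction[OF \<phi>(1) q] by blast
  note R = representationD[OF V(1)]
  interpret V: hilbert_space V by (rule R(1))
  have kernel: "\<rho> k y = \<zero>\<^bsub>V\<^esub>" if k: "k \<in> K" and y: "y \<in> carr V" for k y
  proof (rule V(5))
    have kA: "k \<in> carr A" using k K by blast
    show "\<rho> k y \<in> carr V" using R(8) kA y by blast
    fix a assume a: "a \<in> carr A"
    have "complex_of_real ((\<parallel>\<rho> (astar A k \<otimes> a) \<xi>\<parallel>\<^bsub>V\<^esub>)\<^sup>2) = vinner V (\<rho> (astar A k \<otimes> a) \<xi>) (\<rho> (astar A k \<otimes> a) \<xi>)"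
      using V.inner_norm[OF R(8)[OF _ V(2)]] kA a by simp
    also have "\<dots> = vinner V (\<rho> (astar A (astar A k \<otimes> a)) (\<rho> (astar A k \<otimes> a) \<xi>)) \<xi>"
      using R(7)[of "astar A (astar A k \<otimes> a)" "\<rho> (astar A k \<otimes> a) \<xi>" \<xi>] kA a V(2) R(8) by simp
    also have "\<dots> = \<phi> (astar A (astar A k \<otimes> a) \<otimes> (astar A k \<otimes> a))"
      using V(4) R(5) kA a V(2) by simp
    also have "astar A (astar A k \<otimes> a) \<otimes> (astar A k \<otimes> a) = (astar A a \<otimes> k) \<otimes> (astar A k \<otimes> a)"
      using kA a by (simp add: star_mult)
    also have "\<phi> \<dots> = 0" using K(2)[of "astar A a" k] K(2)[of "astar A k \<otimes> a" "astar A a \<otimes> k"] k kA a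
      by (intro \<phi>(2)) auto
    finally have "\<rho> (astar A k) (\<rho> a \<xi>) = \<zero>\<^bsub>V\<^esub>"
      using V.norm_eq_zero[OF R(8)[of "astar A k \<otimes> a" \<xi>]] R(5)[of "astar A k" a \<xi>] kA a V(2) by simp
    then show "vinner V (\<rho> a \<xi>) (\<rho> k y) = 0"
      using R(7)[of "astar A k" "\<rho> a \<xi>" y] R(8) kA a y V(2) by simp
  qed
  have h_ker: "h \<notin> rep_kernel A V \<rho>"
  proof
    assume "h \<in> rep_kernel A V \<rho>"
    then have "\<rho> h \<xi> = \<zero>\<^bsub>V\<^esub>" using V(2) by (simp add: kernel_on_def)
    then show False using V(2) V(4)[OF h(1)] h(2) by simp
  qed
  have \<xi>0: "\<parallel>\<xi>\<parallel>\<^bsub>V\<^esub> > 0"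
  proof -
    have "\<xi> \<noteq> \<zero>\<^bsub>V\<^esub>" using h V(4)[OF h(1)] V.bounded_op_zero[OF R(2)[OF h(1)]] V(2) by auto
    then show ?thesis using V.norm_eq_zero[OF V(2)] V.norm_nonneg[OF V(2)] by linarith
  qed
  have "W = {\<zero>\<^bsub>V\<^esub>} \<or> W = carr V" if W: "invariant_subspace A V \<rho> W" for W
  proof -
    have W': "closed_subspace V W" "\<And>a x. \<lbrakk>a \<in> carr A; x \<in> W\<rbrakk> \<Longrightarrow> \<rho> a x \<in> W"
      using W by (auto simp: invariant_subspace_def)
    have WV: "w \<in> W \<Longrightarrow> w \<in> carr V" for w using W'(1) by (auto simp: closed_subspace_def)
    have W0: "\<zero>\<^bsub>V\<^esub> \<in> W" using W'(1) by (auto simp: closed_subspace_def)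
    obtain \<eta> where \<eta>: "\<eta> \<in> W" "\<And>w. w \<in> W \<Longrightarrow> vinner V w \<xi> = vinner V w \<eta>"
      using V.projection[OF W'(1) V(2)] by blast
    have \<eta>V: "\<eta> \<in> carr V" using \<eta>(1) WV by blast
    define \<zeta> where "\<zeta> = \<xi> \<ominus>\<^bsub>V\<^esub> \<eta>"
    have \<zeta>V: "\<zeta> \<in> carr V" using \<eta>V V(2) by (simp add: \<zeta>_def)
    have orth: "vinner V w \<zeta> = 0" if "w \<in> W" for w
      using \<eta>(2)[OF that] WV[OF that] \<eta>V V(2) by (simp add: \<zeta>_def V.form.form_diff_right)
    have orth': "vinner V (\<rho> a \<zeta>) w = 0" if "w \<in> W" "a \<in> carr A" for w a
      using R(7)[OF that(2) \<zeta>V WV[OF that(1)]] orth[OF W'(2)[of "astar A a" w]] that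
        V.inner_cnj[OF WV[OF W'(2)[of "astar A a" w]] \<zeta>V] by simp
    have \<xi>_sum: "\<eta> \<oplus>\<^bsub>V\<^esub> \<zeta> = \<xi>" using V.diff_add_cancel[OF V(2) \<eta>V] V.add_commute[OF \<eta>V \<zeta>V] by (simp add: \<zeta>_def)
    have split: "\<rho> a \<xi> = \<rho> a \<eta> \<oplus>\<^bsub>V\<^esub> \<rho> a \<zeta>" if "a \<in> carr A" for a
      using bounded_opD(2)[OF R(2)[OF that] \<eta>V \<zeta>V] \<xi>_sum by simp
    have inner_\<eta>: "vinner V (\<rho> a \<xi>) \<eta> = vinner V (\<rho> a \<eta>) \<eta>" if a: "a \<in> carr A" for a
      using split[OF a] orth'[OF \<eta>(1) a] R(8)[OF a] \<eta>V \<zeta>V by (simp add: V.inner_add)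
    have inner_\<xi>: "vinner V (\<rho> a \<xi>) \<xi> = vinner V (\<rho> a \<eta>) \<eta> + vinner V (\<rho> a \<zeta>) \<zeta>" if a: "a \<in> carr A" for a
    proof -
      have "vinner V (\<rho> a \<xi>) \<xi> = vinner V (\<rho> a \<eta>) \<xi> + vinner V (\<rho> a \<zeta>) \<xi>"
        using split[OF a] R(8)[OF a] \<eta>V \<zeta>V V(2) by (simp add: V.inner_add)
      also have "vinner V (\<rho> a \<eta>) \<xi> = vinner V (\<rho> a \<eta>) \<eta>" using \<eta>(2) W'(2)[OF a \<eta>(1)] by blast
      also have "vinner V (\<rho> a \<zeta>) \<xi> = vinner V (\<rho> a \<zeta>) \<eta> + vinner V (\<rho> a \<zeta>) \<zeta>"
        using V.form.form_add_right[OF \<eta>V \<zeta>V R(8)[OF a \<zeta>V]] \<xi>_sum by simp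
      finally show ?thesis using orth'[OF \<eta>(1) a] by simp
    qed
    show ?thesis
    proof (cases "\<eta> = \<zero>\<^bsub>V\<^esub> \<or> \<zeta> = \<zero>\<^bsub>V\<^esub>")
      case True
      then show ?thesis
      proof
        assume \<eta>0: "\<eta> = \<zero>\<^bsub>V\<^esub>"
        have "w = \<zero>\<^bsub>V\<^esub>" if w: "w \<in> W" for w
        proof (rule V(5)[OF WV[OF w]])
          fix a assume a: "a \<in> carr A"
          have "vinner V (\<rho> (astar A a) w) \<xi> = 0"
            using \<eta>(2)[OF W'(2)[of "astar A a" w]] \<eta>0 w a WV[OF W'(2)[of "astar A a" w]] by simp
          then show "vinner V (\<rho> a \<xi>) w = 0"
            using R(7)[OF a V(2) WV[OF w]] V.inner_cnj[OF R(8)[of "astar A a" w] V(2)] a WV[OF w] by simp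
        qed
        then show ?thesis using W0 by blast
      next
        assume "\<zeta> = \<zero>\<^bsub>V\<^esub>"
        then have "\<xi> \<in> W" using \<xi>_sum \<eta>(1) \<eta>V by simp
        have "x \<in> W" if x: "x \<in> carr V" for x
        proof (rule V.in_closed_subspace_if_orthogonal[OF W'(1) x])
          fix y assume y: "y \<in> carr V" "\<And>w. w \<in> W \<Longrightarrow> vinner V w y = 0"
          have "y = \<zero>\<^bsub>V\<^esub>" using V(5)[OF y(1)] y(2) W'(2) \<open>\<xi> \<in> W\<close> by blast
          then show "vinner V x y = 0" using x by simp
        qed
        then show ?thesis using WV by blast
      qed
    next
      case False
      have n_pos: "\<parallel>\<eta>\<parallel>\<^bsub>V\<^esub> > 0" "\<parallel>\<zeta>\<parallel>\<^bsub>V\<^esub> > 0"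
        using False V.norm_eq_zero V.norm_nonneg \<eta>V \<zeta>V by (metis less_le)+
      define N where "N = (\<parallel>\<xi>\<parallel>\<^bsub>V\<^esub>)\<^sup>2"
      have N: "N = (\<parallel>\<eta>\<parallel>\<^bsub>V\<^esub>)\<^sup>2 + (\<parallel>\<zeta>\<parallel>\<^bsub>V\<^esub>)\<^sup>2" "0 < N"
      proof -
        have "complex_of_real N = vinner V \<eta> \<xi> + vinner V \<zeta> \<xi>"
          using V.inner_norm[OF V(2)] V.inner_add[OF \<eta>V \<zeta>V V(2)] \<xi>_sum by (simp add: N_def)
        also have "vinner V \<eta> \<xi> = vinner V \<eta> \<eta>" using \<eta> by blast
        also have "vinner V \<zeta> \<xi> = vinner V \<zeta> \<eta> + vinner V \<zeta> \<zeta>"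
          using V.form.form_add_right[OF \<eta>V \<zeta>V \<zeta>V] \<xi>_sum by simp
        also have "vinner V \<zeta> \<eta> = 0" using V.inner_cnj[OF \<eta>V \<zeta>V] orth[OF \<eta>(1)] by simp
        finally have "complex_of_real N = complex_of_real ((\<parallel>\<eta>\<parallel>\<^bsub>V\<^esub>)\<^sup>2 + (\<parallel>\<zeta>\<parallel>\<^bsub>V\<^esub>)\<^sup>2)"
          using V.inner_norm \<eta>V \<zeta>V by simp
        then show "N = (\<parallel>\<eta>\<parallel>\<^bsub>V\<^esub>)\<^sup>2 + (\<parallel>\<zeta>\<parallel>\<^bsub>V\<^esub>)\<^sup>2" unfolding of_real_eq_iff .
        show "0 < N" using \<xi>0 by (simp add: N_def)
      qed
      define t where "t = (\<parallel>\<eta>\<parallel>\<^bsub>V\<^esub>)\<^sup>2 / N"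
      have t: "0 < t" "t < 1" "1 - t = (\<parallel>\<zeta>\<parallel>\<^bsub>V\<^esub>)\<^sup>2 / N"
        using N n_pos by (auto simp: t_def field_simps)
      \<comment> \<open>A component of the cyclic vector in a summand, rescaled, defines another quasi-state.\<close>
      have vec: "(\<lambda>a. if a \<in> carr A then vinner V (\<rho> a v) v / complex_of_real r else 0) \<in> quasi_states A K"
        if v: "v \<in> carr V" "r = (\<parallel>v\<parallel>\<^bsub>V\<^esub>)\<^sup>2 / N" "r > 0" for v r
      proof -
        define v' where "v' = complex_of_real (1 / sqrt r) \<odot>\<^bsub>V\<^esub> v"
        have v': "v' \<in> carr V" using v by (simp add: v'_def)
        have "(\<parallel>v'\<parallel>\<^bsub>V\<^esub>)\<^sup>2 = (\<parallel>v\<parallel>\<^bsub>V\<^esub>)\<^sup>2 / r"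
          using v by (simp add: v'_def V.norm_scale norm_divide power_mult_distrib power_divide)
        also have "\<dots> = N" using v N by (auto simp: field_simps)
        finally have "\<parallel>v'\<parallel>\<^bsub>V\<^esub> = \<parallel>\<xi>\<parallel>\<^bsub>V\<^esub>" using v' V(2) by (simp add: N_def)
        then have "quasi_state A (\<lambda>a. vinner V (\<rho> a v') v')" using vector_state[OF V(1) v'] V(3) by simp
        moreover have eq: "vinner V (\<rho> a v') v' = vinner V (\<rho> a v) v / complex_of_real r" if a: "a \<in> carr A" for a
        proof -
          have "vinner V (\<rho> a v') v' = complex_of_real (1 / sqrt r) * complex_of_real (1 / sqrt r) * vinner V (\<rho> a v) v"
            using bounded_opD(3)[OF R(2)[OF a] v(1)] R(8)[OF a v(1)] v(1)
            by (simp add: v'_def V.inner_scale V.form.form_scale_right)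
          also have "complex_of_real (1 / sqrt r) * complex_of_real (1 / sqrt r) = complex_of_real (1 / r)"
            using v(3) by (simp flip: of_real_mult)
          finally show ?thesis by simp
        qed
        ultimately have "quasi_state A (\<lambda>a. if a \<in> carr A then vinner V (\<rho> a v) v / complex_of_real r else 0)"
          unfolding quasi_state_def by simp
        moreover have "vinner V (\<rho> a v) v / complex_of_real r = 0" if "a \<in> K" for a
          using kernel[OF that v(1)] v(1) by simp
        ultimately show ?thesis by (simp add: quasi_states_def)
      qed
      define \<psi> where "\<psi> = (\<lambda>a. if a \<in> carr A then vinner V (\<rho> a \<eta>) \<eta> / complex_of_real t else 0)"
      define \<omega> where "\<omega> = (\<lambda>a. if a \<in> carr A then vinner V (\<rho> a \<zeta>) \<zeta> / complex_of_real (1 - t) else 0)"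
      have "\<psi> \<in> quasi_states A K" "\<omega> \<in> quasi_states A K"
        unfolding \<psi>_def \<omega>_def using t by (auto intro!: vec \<eta>V \<zeta>V simp: t_def)
      moreover have "\<phi> = (\<lambda>a. complex_of_real t * \<psi> a + complex_of_real (1 - t) * \<omega> a)"
      proof
        fix a
        show "\<phi> a = complex_of_real t * \<psi> a + complex_of_real (1 - t) * \<omega> a"
        proof (cases "a \<in> carr A")
          case True
          have "complex_of_real t \<noteq> 0" "complex_of_real (1 - t) \<noteq> 0"
            using t(1,2) by (simp_all only: of_real_eq_0_iff)
          then show ?thesis using V(4)[OF True] inner_\<xi>[OF True] True by (simp add: \<psi>_def \<omega>_def del: of_real_diff)
        qed (simp add: \<phi>(3) \<psi>_def \<omega>_def)
      qed
      ultimately have "\<psi> = \<phi>" using ext t(1,2) unfolding extreme_in_def by blast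
      have "\<eta> \<ominus>\<^bsub>V\<^esub> complex_of_real t \<odot>\<^bsub>V\<^esub> \<xi> = \<zero>\<^bsub>V\<^esub>"
      proof (rule V(5))
        show "\<eta> \<ominus>\<^bsub>V\<^esub> complex_of_real t \<odot>\<^bsub>V\<^esub> \<xi> \<in> carr V" using \<eta>V V(2) by simp
        fix a assume a: "a \<in> carr A"
        have "vinner V (\<rho> a \<eta>) \<eta> = complex_of_real t * \<phi> a"
          using fun_cong[OF \<open>\<psi> = \<phi>\<close>, of a] a t(1) by (simp add: \<psi>_def field_simps)
        then show "vinner V (\<rho> a \<xi>) (\<eta> \<ominus>\<^bsub>V\<^esub> complex_of_real t \<odot>\<^bsub>V\<^esub> \<xi>) = 0"
          using inner_\<eta>[OF a] V(4)[OF a] R(8)[OF a V(2)] \<eta>V V(2)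
          by (simp add: V.form.form_add_right V.form.form_scale_right)
      qed
      then have "\<eta> = complex_of_real t \<odot>\<^bsub>V\<^esub> \<xi>" using V.diff_eq_zero[of \<eta> "complex_of_real t \<odot>\<^bsub>V\<^esub> \<xi>"] \<eta>V V(2) by blast
      then have "(\<parallel>\<eta>\<parallel>\<^bsub>V\<^esub>)\<^sup>2 = t\<^sup>2 * N"
        using t V(2) by (simp add: V.norm_scale power_mult_distrib N_def)
      moreover have "(\<parallel>\<eta>\<parallel>\<^bsub>V\<^esub>)\<^sup>2 = t * N" using N by (simp add: t_def)
      ultimately show ?thesis using t N(2) by (simp add: power2_eq_square)
    qed
  qed
  moreover have "rep_kernel A V \<rho> \<noteq> carr A" using h_ker h(1) by blast
  ultimately have "irreducible_rep A V \<rho>" using V(1) by (simp add: irreducible_rep_def)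
  moreover have "K \<subseteq> rep_kernel A V \<rho>" using kernel K(1) by (auto simp: kernel_on_def)
  ultimately show thesis using that h_ker by blast
qed

text \<open>
  A representation on W with kernel K need not contain irreducible ones; the set of quasi-states
  vanishing on K is compact and contains a vector state that does not vanish on \<open>j\<^sup>*j\<close>, so it has
  an extreme point with this property.
\<close>

lemma (in cstar_algebra) irreducible_rep_separating:
  fixes q :: "'e \<Rightarrow> 'a"
  assumes q: "carr A \<subseteq> range q" and L: "representation A V L"
    and W: "invariant_subspace A V L W" and j: "j \<in> carr A" "j \<notin> kernel_on A V L W"
  obtains H :: "('e \<Rightarrow> complex) ispace" and \<rho> where "irreducible_rep A H \<rho>"
    "kernel_on A V L W \<subseteq> rep_kernel A H \<rho>" "j \<notin> rep_kernel A H \<rho>"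
proof -
  note R = representationD[OF L]
  interpret V: hilbert_space V by (rule R(1))
  define K where "K = kernel_on A V L W"
  have W': "\<And>a x. \<lbrakk>a \<in> carr A; x \<in> W\<rbrakk> \<Longrightarrow> L a x \<in> W" "\<And>w. w \<in> W \<Longrightarrow> w \<in> carr V"
    "\<And>c w. w \<in> W \<Longrightarrow> c \<odot>\<^bsub>V\<^esub> w \<in> W"
    using W by (auto simp: invariant_subspace_def closed_subspace_def)
  have K: "K \<subseteq> carr A" "\<And>a k. \<lbrakk>a \<in> carr A; k \<in> K\<rbrakk> \<Longrightarrow> a \<otimes> k \<in> K \<and> k \<otimes> a \<in> K"
    using W' R V.bounded_op_zero by (auto simp: K_def kernel_on_def)
  obtain w where w: "w \<in> W" "L j w \<noteq> \<zero>\<^bsub>V\<^esub>" using j by (auto simp: kernel_on_def)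
  have w0: "\<parallel>w\<parallel>\<^bsub>V\<^esub> > 0"
    using w W'(2) V.bounded_op_zero[OF R(2)[OF j(1)]] V.norm_eq_zero V.norm_nonneg by (metis less_le)
  define \<xi> where "\<xi> = complex_of_real (1 / \<parallel>w\<parallel>\<^bsub>V\<^esub>) \<odot>\<^bsub>V\<^esub> w"
  have \<xi>: "\<xi> \<in> W" "\<xi> \<in> carr V" "\<parallel>\<xi>\<parallel>\<^bsub>V\<^esub> \<le> 1"
    using W'(2,3)[OF w(1)] w0 by (auto simp: \<xi>_def V.norm_scale norm_divide)
  have L\<xi>: "\<parallel>L j \<xi>\<parallel>\<^bsub>V\<^esub> > 0"
  proof -
    have "\<parallel>L j \<xi>\<parallel>\<^bsub>V\<^esub> = 1 / \<parallel>w\<parallel>\<^bsub>V\<^esub> * \<parallel>L j w\<parallel>\<^bsub>V\<^esub>"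
      using bounded_opD(3)[OF R(2)[OF j(1)] W'(2)[OF w(1)]] R(8)[OF j(1) W'(2)[OF w(1)]] w0
      by (simp add: \<xi>_def V.norm_scale norm_divide)
    moreover have "\<parallel>L j w\<parallel>\<^bsub>V\<^esub> > 0"
      using w R(8)[OF j(1) W'(2)[OF w(1)]] V.norm_eq_zero V.norm_nonneg by (metis less_le)
    ultimately show ?thesis using w0 by simp
  qed
  define h where "h = astar A j \<otimes> j"
  have h: "h \<in> carr A" using j by (simp add: h_def)
  define \<phi>0 where "\<phi>0 a = (if a \<in> carr A then vinner V (L a \<xi>) \<xi> else 0)" for a
  have "quasi_state A \<phi>0"
    using vector_state[OF L \<xi>(2,3)] unfolding \<phi>0_def quasi_state_def by simp
  moreover have "\<phi>0 a = 0" if "a \<in> K" for a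
    using that \<xi> by (auto simp: \<phi>0_def K_def kernel_on_def)
  ultimately have \<phi>0: "\<phi>0 \<in> quasi_states A K" by (auto simp: quasi_states_def \<phi>0_def)
  have "\<phi>0 h = complex_of_real ((\<parallel>L j \<xi>\<parallel>\<^bsub>V\<^esub>)\<^sup>2)"
    using R(5)[of "astar A j" j \<xi>] R(7)[of "astar A j" "L j \<xi>" \<xi>] j \<xi> R(8)[OF j(1) \<xi>(2)]
      V.inner_norm[of "L j \<xi>"] h by (simp add: \<phi>0_def h_def)
  then have pos: "Re (\<phi>0 h) > 0" using L\<xi> by simp
  obtain \<phi> where \<phi>: "extreme_in (quasi_states A K) \<phi>" "Re (\<phi>0 h) \<le> Re (\<phi> h)"
    using extreme_point_exists[OF compact_quasi_states closed_quasi_states \<phi>0] by blast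
  have "\<phi> h \<noteq> 0" using \<phi>(2) pos by auto
  from extreme_quasi_state_irreducible[OF q K \<phi>(1) h this]
  obtain H :: "('e \<Rightarrow> complex) ispace" and \<rho> where H: "irreducible_rep A H \<rho>" "K \<subseteq> rep_kernel A H \<rho>"
    "h \<notin> rep_kernel A H \<rho>" by blast
  have "j \<notin> rep_kernel A H \<rho>"
  proof
    assume "j \<in> rep_kernel A H \<rho>"
    moreover have rho: "representation A H \<rho>" using H(1) by (simp add: irreducible_rep_def)
    moreover have "\<rho> (astar A j) \<zero>\<^bsub>H\<^esub> = \<zero>\<^bsub>H\<^esub>"
      using banach_space.bounded_op_zero[OF hilbert_space.axioms(1)[OF representationD(1)[OF rho]]]
        representationD(2)[OF rho] j by blast
    ultimately have "h \<in> rep_kernel A H \<rho>"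
      using j h representationD(5)[OF rho, of "astar A j" j] by (auto simp: kernel_on_def h_def)
    then show False using H(3) by blast
  qed
  then show thesis using that H(1,2) by (simp add: K_def)
qed

section \<open>Continuous sections of Banach bundles\<close>

text \<open>
  A bump function is the Urysohn function of x and the complement of N, steepened so that it is
  constant near x and its support lies inside N.
\<close>

lemma bump_function:
  fixes x :: "'g::t2_space"
  assumes lc: "locally_compact_space (euclidean :: 'g topology)" and N: "open N" "x \<in> N"
  obtains k :: "'g \<Rightarrow> real" and M C where "continuous_on UNIV k" "\<And>y. 0 \<le> k y" "\<And>y. k y \<le> 1"
    "open M" "x \<in> M" "\<And>y. y \<in> M \<Longrightarrow> k y = 1" "closed C" "C \<subseteq> N" "\<And>y. y \<notin> C \<Longrightarrow> k y = 0"
proof -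
  have haus: "Hausdorff_space (euclidean :: 'g topology)"
    unfolding Hausdorff_space_def disjnt_def using hausdorff by (auto simp: open_openin[symmetric])
  have "completely_regular_space (euclidean :: 'g topology)"
    using lc locally_compact_Hausdorff_imp_regular_space[OF lc haus]
    by (simp add: completely_regular_eq_regular_space)
  then obtain f :: "'g \<Rightarrow> real" where f: "continuous_map euclidean (top_of_set {0..1}) f" "f x = 0" "f ` (- N) \<subseteq> {1}"
    using N unfolding completely_regular_space_def by (metis Compl_iff Diff_iff UNIV_I closed_Compl closed_closedin topspace_euclidean)
  have cont: "continuous_on UNIV f" and range: "\<And>y. 0 \<le> f y \<and> f y \<le> 1"
    using f(1) by (auto simp: continuous_map_in_subtopology)
  define k where "k y = max 0 (min 1 (2 - 3 * f y))" for y
  show thesis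
  proof (rule that[of k "{y. f y < 1/3}" "{y. f y \<le> 2/3}"])
    show "continuous_on UNIV k" unfolding k_def by (intro continuous_intros cont)
    show "open {y. f y < 1/3}" by (intro open_Collect_less cont continuous_intros)
    show "closed {y. f y \<le> 2/3}" by (intro closed_Collect_le cont continuous_intros)
    show "{y. f y \<le> 2/3} \<subseteq> N"
    proof
      fix y assume y: "y \<in> {y. f y \<le> 2/3}"
      show "y \<in> N"
      proof (rule ccontr)
        assume "y \<notin> N"
        then have "f y = 1" using f(3) by auto
        then show False using y by simp
      qed
    qed
  qed (use f(2) in \<open>auto simp: k_def\<close>)
qed

locale lc_banach_bundle = usc_banach_bundle B
  for B :: "('g::t2_space, 'b::topological_space) banach_bundle" +
  assumes lc_base: "locally_compact_space (euclidean :: 'g topology)"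

context usc_banach_bundle
begin

lemma fibre_simps [simp]: "carr (fibre B x) = {b. proj B b = x}" "vzero (fibre B x) = bzero B x"
  "vadd (fibre B x) = badd B" "vscale (fibre B x) = bscale B" "vnorm (fibre B x) = bnorm B"
  "amult (fibre B x) = bmul B" "astar (fibre B x) = bstar B"
  by (simp_all add: fibre_def)

definition bdist :: "'b \<Rightarrow> 'b \<Rightarrow> real" where
  "bdist a b = bnorm B (badd B a (bscale B (- 1) b))"

lemma vdist_fibre: "vdist (fibre B x) a b = bdist a b"
  by (simp add: vdist_def bdist_def)

lemma proj_zero [simp]: "proj B (bzero B x) = x"
proof -
  interpret banach_space "fibre B x" by (rule fibre_banach)
  show ?thesis using zero_closed by simp
qed

lemma proj_add [simp]: "proj B a = proj B b \<Longrightarrow> proj B (badd B a b) = proj B b"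
proof -
  assume *: "proj B a = proj B b"
  interpret banach_space "fibre B (proj B b)" by (rule fibre_banach)
  show ?thesis using add_closed[of a b] * by simp
qed

lemma proj_scale [simp]: "proj B (bscale B c a) = proj B a"
proof -
  interpret banach_space "fibre B (proj B a)" by (rule fibre_banach)
  show ?thesis using scale_closed[of a c] by simp
qed

lemma bnorm_nonneg [simp]: "0 \<le> bnorm B a"
proof -
  interpret banach_space "fibre B (proj B a)" by (rule fibre_banach)
  show ?thesis using norm_nonneg[of a] by simp
qed

lemma bnorm_zero [simp]: "bnorm B (bzero B x) = 0"
proof -
  interpret banach_space "fibre B x" by (rule fibre_banach)
  show ?thesis using norm_zero by simp
qed

lemma bscale_simps [simp]: "bscale B 1 a = a" "bscale B c (bscale B d a) = bscale B (c * d) a"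
  "bscale B c (bzero B x) = bzero B x"
proof -
  interpret banach_space "fibre B (proj B a)" by (rule fibre_banach)
  show "bscale B 1 a = a" "bscale B c (bscale B d a) = bscale B (c * d) a"
    using scale_one[of a] scale_scale[of a c d] by auto
  interpret x: banach_space "fibre B x" by (rule fibre_banach)
  show "bscale B c (bzero B x) = bzero B x" using x.scale_zero_right by simp
qed

lemma bscale_zero: "bscale B 0 a = bzero B (proj B a)"
proof -
  interpret banach_space "fibre B (proj B a)" by (rule fibre_banach)
  show ?thesis using scale_zero[of a] by simp
qed

lemma badd_zero: "proj B a = x \<Longrightarrow> badd B a (bzero B x) = a" "proj B a = x \<Longrightarrow> badd B (bzero B x) a = a"
proof -
  assume *: "proj B a = x"
  interpret banach_space "fibre B x" by (rule fibre_banach)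
  show "badd B a (bzero B x) = a" "badd B (bzero B x) a = a" using add_zero[of a] zero_add[of a] * by auto
qed

lemma bscale_add: "badd B (bscale B c a) (bscale B d a) = bscale B (c + d) a"
proof -
  interpret banach_space "fibre B (proj B a)" by (rule fibre_banach)
  show ?thesis using scale_sum[of a c d] by simp
qed

lemma bnorm_scale: "bnorm B (bscale B c a) = cmod c * bnorm B a"
proof -
  interpret banach_space "fibre B (proj B a)" by (rule fibre_banach)
  show ?thesis using norm_scale[of a c] by simp
qed

lemma bdist_nonneg [simp]: "0 \<le> bdist a b"
  by (simp add: bdist_def)

lemma bdist_self [simp]: "bdist a a = 0"
proof -
  interpret banach_space "fibre B (proj B a)" by (rule fibre_banach)
  show ?thesis using add_minus[of a] by (simp add: bdist_def)
qed

lemma bdist_zero: "proj B a = x \<Longrightarrow> bdist a (bzero B x) = bnorm B a"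
  by (simp add: bdist_def badd_zero)

lemma bdist_commute: "proj B a = proj B b \<Longrightarrow> bdist a b = bdist b a"
proof -
  assume *: "proj B a = proj B b"
  interpret banach_space "fibre B (proj B b)" by (rule fibre_banach)
  show ?thesis using norm_diff_commute[of a b] * by (simp add: bdist_def)
qed

lemma bdist_triangle:
  "\<lbrakk>proj B a = proj B b; proj B c = proj B b\<rbrakk> \<Longrightarrow> bdist a c \<le> bdist a b + bdist b c"
proof -
  assume *: "proj B a = proj B b" "proj B c = proj B b"
  interpret banach_space "fibre B (proj B b)" by (rule fibre_banach)
  show ?thesis using norm_diff_triangle[of a b c] * by (simp add: bdist_def)
qed

lemma bdist_eq_zero: "\<lbrakk>proj B a = proj B b; bdist a b = 0\<rbrakk> \<Longrightarrow> a = b"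
proof -
  assume *: "proj B a = proj B b" "bdist a b = 0"
  interpret banach_space "fibre B (proj B b)" by (rule fibre_banach)
  show ?thesis using norm_eq_zero[of "badd B a (bscale B (-1) b)"] diff_eq_zero[of a b] * by (simp add: bdist_def)
qed

lemma bnorm_bdist: "proj B a = proj B b \<Longrightarrow> bnorm B a \<le> bnorm B b + bdist a b"
  using bdist_triangle[of a b "bzero B (proj B b)"] by (simp add: bdist_zero)

lemma bdist_add:
  assumes "proj B a = x" "proj B b = x" "proj B a' = x" "proj B b' = x"
  shows "bdist (badd B a b) (badd B a' b') \<le> bdist a a' + bdist b b'"
proof -
  interpret banach_space "fibre B x" by (rule fibre_banach)
  show ?thesis
    using norm_triangle[of "badd B a (bscale B (-1) a')" "badd B b (bscale B (-1) b')"] diff_add_add[of a b a' b'] assms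
    by (simp add: bdist_def)
qed

lemma bdist_scale: "proj B a = proj B b \<Longrightarrow> bdist (bscale B c a) (bscale B c b) = cmod c * bdist a b"
proof -
  assume *: "proj B a = proj B b"
  interpret banach_space "fibre B (proj B b)" by (rule fibre_banach)
  show ?thesis
    using norm_scale[of "badd B a (bscale B (-1) b)" c] diff_scale[of a b c] * by (simp add: bdist_def)
qed

lemma bdist_scale_left: "bdist (bscale B c a) (bscale B d a) = cmod (c - d) * bnorm B a"
  by (simp add: bdist_def bscale_add bnorm_scale)

lemma bdist_add_cancel: "proj B a = proj B b \<Longrightarrow> badd B a (badd B b (bscale B (- 1) a)) = b"
proof -
  assume *: "proj B a = proj B b"
  interpret banach_space "fibre B (proj B b)" by (rule fibre_banach)
  show ?thesis using diff_add_cancel[of b a] add_commute[of a "badd B b (bscale B (-1) a)"] * by simp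
qed

lemma continuous_on_badd:
  assumes "continuous_on X f" "continuous_on X g" "\<And>x. x \<in> X \<Longrightarrow> proj B (f x) = proj B (g x)"
  shows "continuous_on X (\<lambda>x. badd B (f x) (g x))"
proof -
  have "continuous_on X (\<lambda>x. (\<lambda>(a, b). badd B a b) (f x, g x))"
    by (rule continuous_on_compose2[OF continuous_add]) (use assms in \<open>auto intro!: continuous_on_Pair\<close>)
  then show ?thesis by simp
qed

lemma continuous_on_bscale:
  "continuous_on X f \<Longrightarrow> continuous_on X (\<lambda>x. bscale B c (f x))"
  using continuous_on_compose2[OF continuous_scale] by blast

text \<open>
  The distance within fibres is upper semicontinuous on the fibred product of the total space with
  itself.
\<close>

lemma bdist_near:
  assumes "proj B a = proj B b" "bdist a b < \<epsilon>"
  obtains U U' where "open U" "a \<in> U" "open U'" "b \<in> U'"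
    "\<And>c c'. \<lbrakk>c \<in> U; c' \<in> U'; proj B c = proj B c'\<rbrakk> \<Longrightarrow> bdist c c' < \<epsilon>"
proof -
  define S where "S = {(a, b). proj B a = proj B b}"
  have cont: "continuous_on S (\<lambda>p. badd B (fst p) (bscale B (- 1) (snd p)))"
    by (rule continuous_on_badd)
      (auto simp: S_def intro!: continuous_on_bscale continuous_on_fst continuous_on_snd continuous_on_id)
  obtain A where A: "open A"
    "A \<inter> S = (\<lambda>p. badd B (fst p) (bscale B (- 1) (snd p))) -` {b. bnorm B b < \<epsilon>} \<inter> S"
    using continuous_on_open_invariant[THEN iffD1, OF cont, rule_format, OF norm_usc[of \<epsilon>]] by blast
  have "(a, b) \<in> A \<inter> S" unfolding A(2) using assms by (simp add: S_def bdist_def)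
  then have "(a, b) \<in> A" by blast
  then obtain U U' where U: "open U" "open U'" "(a, b) \<in> U \<times> U'" "U \<times> U' \<subseteq> A"
    using open_prod_elim[OF A(1)] by metis
  show thesis
  proof (rule that[OF U(1) _ U(2)])
    fix c c' assume "c \<in> U" "c' \<in> U'" "proj B c = proj B c'"
    then have "(c, c') \<in> A \<inter> S" using U(4) by (auto simp: S_def)
    then show "bdist c c' < \<epsilon>" unfolding A(2) by (simp add: bdist_def)
  qed (use U(3) in auto)
qed

text \<open>
  The axiom on convergence to zero says that the tubes around the zero section form a
  neighbourhood base at each of its points.
\<close>

lemma zero_neighbourhood:
  assumes U: "open U" "bzero B x \<in> U"
  obtains N \<delta> where "open N" "x \<in> N" "\<delta> > 0" "\<And>d. \<lbrakk>proj B d \<in> N; bnorm B d < \<delta>\<rbrakk> \<Longrightarrow> d \<in> U"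
proof -
  define F where "F = inf (filtercomap (proj B) (nhds x)) (filtercomap (bnorm B) (nhds 0))"
  have "F \<le> nhds (bzero B x)"
    by (rule zero_limit) (auto simp: F_def filterlim_iff_le_filtercomap)
  then have "eventually (\<lambda>d. d \<in> U) F"
    by (rule filter_leD[OF _ eventually_nhds_in_open[OF U]])
  then obtain Q R where Q: "eventually Q (nhds x)" and R: "eventually R (nhds 0)"
    and QR: "\<And>d. Q (proj B d) \<Longrightarrow> R (bnorm B d) \<Longrightarrow> d \<in> U"
    unfolding F_def eventually_inf eventually_filtercomap by metis
  obtain N where N: "open N" "x \<in> N" "\<And>y. y \<in> N \<Longrightarrow> Q y" using Q by (auto simp: eventually_nhds)
  obtain \<delta> where \<delta>: "\<delta> > 0" "\<And>t. \<bar>t\<bar> < \<delta> \<Longrightarrow> R t"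
    using R by (auto simp: eventually_nhds_metric dist_real_def)
  show thesis by (rule that[OF N(1,2) \<delta>(1)]) (use QR N(3) \<delta>(2) in auto)
qed

text \<open>
  A discontinuous section may be continuous up to \<open>\<epsilon>\<close>: near x its values are
  within \<open>\<epsilon>\<close> of points close to its value at x in the topology of the total space.
\<close>

definition econt :: "real \<Rightarrow> ('g \<Rightarrow> 'b) \<Rightarrow> 'g \<Rightarrow> bool" where
  "econt \<epsilon> f x \<longleftrightarrow> (\<forall>U. open U \<longrightarrow> f x \<in> U \<longrightarrow>
     (\<forall>d>\<epsilon>. \<forall>\<^sub>F y in nhds x. \<exists>c\<in>U. proj B c = y \<and> bdist c (f y) < d))"

lemma econtD:
  "\<lbrakk>econt \<epsilon> f x; open U; f x \<in> U; \<epsilon> < d\<rbrakk> \<Longrightarrow> \<forall>\<^sub>F y in nhds x. \<exists>c\<in>U. proj B c = y \<and> bdist c (f y) < d"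
  unfolding econt_def by blast

text \<open>
  If b is at distance less than \<open>\<eta>\<close> from some a in U, then by openness of the projection each
  element near b shares its fibre with an element of U near a.
\<close>

lemma open_thickening:
  assumes U: "open U"
  shows "open {c'. \<exists>c\<in>U. proj B c = proj B c' \<and> bdist c c' < \<eta>}" (is "open ?T")
proof (subst open_subopen, rule ballI)
  fix b assume "b \<in> ?T"
  then obtain a where a: "a \<in> U" "proj B a = proj B b" "bdist a b < \<eta>" by blast
  obtain U1 U2 where U12: "open U1" "a \<in> U1" "open U2" "b \<in> U2"
    "\<And>c c'. \<lbrakk>c \<in> U1; c' \<in> U2; proj B c = proj B c'\<rbrakk> \<Longrightarrow> bdist c c' < \<eta>"
    using bdist_near[OF a(2,3)] by metis
  define T where "T = U2 \<inter> proj B -` (proj B ` (U1 \<inter> U))"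
  have "open T"
    unfolding T_def by (intro open_Int U12 open_vimage continuous_proj open_proj U)
  moreover have "b \<in> T"
    using a(1) U12(2,4) imageI[of a "U1 \<inter> U" "proj B"] unfolding T_def by (simp add: a(2))
  moreover have "T \<subseteq> ?T"
  proof
    fix c' assume "c' \<in> T"
    then obtain c where "c' \<in> U2" "c \<in> U1" "c \<in> U" "proj B c = proj B c'" unfolding T_def by auto
    then show "c' \<in> ?T" using U12(5) by blast
  qed
  ultimately show "\<exists>T. open T \<and> b \<in> T \<and> T \<subseteq> ?T" by blast
qed

text \<open>
  If c is close to \<open>f x\<close> in the total space and close to \<open>f y\<close> in the fibre over y, then
  \<open>f y = c + (f y - c)\<close> is close to \<open>f x\<close>, as addition is continuous and \<open>f y - c\<close> is
  close to the zero section.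
\<close>

lemma econt_imp_tendsto:
  assumes f: "\<And>y. proj B (f y) = y" and e: "\<And>\<epsilon>. \<epsilon> > 0 \<Longrightarrow> econt \<epsilon> f x"
  shows "(f \<longlongrightarrow> f x) (nhds x)"
  unfolding tendsto_def
proof (intro allI impI)
  fix S assume S: "open S" "f x \<in> S"
  have cont: "continuous_on {(a, b). proj B a = proj B b} (\<lambda>p. badd B (fst p) (snd p))"
    using continuous_add by (simp add: case_prod_beta)
  obtain A where A: "open A" "A \<inter> {(a, b). proj B a = proj B b}
      = (\<lambda>p. badd B (fst p) (snd p)) -` S \<inter> {(a, b). proj B a = proj B b}"
    using continuous_on_open_invariant[THEN iffD1, OF cont, rule_format, OF S(1)] by blast
  have "(f x, bzero B x) \<in> A" using A(2) S f by (auto simp: badd_zero)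
  then obtain U U' where U: "open U" "open U'" "(f x, bzero B x) \<in> U \<times> U'" "U \<times> U' \<subseteq> A"
    using open_prod_elim[OF A(1)] by metis
  obtain N \<delta> where N: "open N" "x \<in> N" "\<delta> > 0" "\<And>d. \<lbrakk>proj B d \<in> N; bnorm B d < \<delta>\<rbrakk> \<Longrightarrow> d \<in> U'"
    using zero_neighbourhood[OF U(2)] U(3) by blast
  have "\<forall>\<^sub>F y in nhds x. \<exists>c\<in>U. proj B c = y \<and> bdist c (f y) < \<delta>"
    using econtD[OF e[of "\<delta>/2"] U(1)] U(3) N(3) by simp
  moreover have "\<forall>\<^sub>F y in nhds x. y \<in> N" using N by (simp add: eventually_nhds_in_open)
  ultimately show "\<forall>\<^sub>F y in nhds x. f y \<in> S"
  proof eventually_elim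
    case (elim y)
    then obtain c where c: "c \<in> U" "proj B c = y" "bdist c (f y) < \<delta>" by blast
    define d where "d = badd B (f y) (bscale B (- 1) c)"
    have "d \<in> U'"
      using N(4)[of d] c elim(2) f bdist_commute[of c "f y"] by (simp add: d_def bdist_def)
    then have "(c, d) \<in> A \<inter> {(a, b). proj B a = proj B b}" using c U(4) f by (auto simp: d_def)
    then have "badd B c d \<in> S" unfolding A(2) by simp
    then show ?case using bdist_add_cancel[of c "f y"] c f by (simp add: d_def)
  qed
qed

lemma econt_cong:
  assumes "econt \<epsilon> f x" "\<forall>\<^sub>F y in nhds x. f y = g y"
  shows "econt \<epsilon> g x"
  unfolding econt_def
proof (intro allI impI)
  fix U d assume U: "open U" "g x \<in> U" "\<epsilon> < d"
  have "f x = g x" using eventually_nhds_x_imp_x[OF assms(2)] .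
  then have "\<forall>\<^sub>F y in nhds x. \<exists>c\<in>U. proj B c = y \<and> bdist c (f y) < d"
    using econtD[OF assms(1) U(1) _ U(3)] U(2) by simp
  with assms(2) show "\<forall>\<^sub>F y in nhds x. \<exists>c\<in>U. proj B c = y \<and> bdist c (g y) < d"
    by eventually_elim auto
qed

lemma econt_mono: "econt \<epsilon> f x \<Longrightarrow> \<epsilon> \<le> \<epsilon>' \<Longrightarrow> econt \<epsilon>' f x"
  unfolding econt_def by auto

lemma econt_perturb:
  assumes f: "\<And>y. proj B (f y) = y" and g: "\<And>y. proj B (g y) = y" and e: "econt \<epsilon> f x"
    and near: "\<forall>\<^sub>F y in nhds x. bdist (f y) (g y) \<le> \<eta>"
  shows "econt (\<epsilon> + 2 * \<eta>) g x"
  unfolding econt_def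
proof (intro allI impI)
  fix U d assume U: "open U" "g x \<in> U" "\<epsilon> + 2 * \<eta> < d"
  define t where "t = (d - \<epsilon> - 2 * \<eta>) / 3"
  have t: "t > 0" "\<epsilon> + 2 * \<eta> + 3 * t = d" using U(3) by (auto simp: t_def field_simps)
  define U' where "U' = {c'. \<exists>c\<in>U. proj B c = proj B c' \<and> bdist c c' < \<eta> + t}"
  have "bdist (g x) (f x) < \<eta> + t"
    using eventually_nhds_x_imp_x[OF near] bdist_commute[of "g x" "f x"] f g t by simp
  then have "f x \<in> U'" using U f g unfolding U'_def by auto
  moreover have "open U'" unfolding U'_def using open_thickening[OF U(1)] .
  ultimately have "\<forall>\<^sub>F y in nhds x. \<exists>c\<in>U'. proj B c = y \<and> bdist c (f y) < \<epsilon> + t"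
    using econtD[OF e] t by simp
  with near show "\<forall>\<^sub>F y in nhds x. \<exists>c\<in>U. proj B c = y \<and> bdist c (g y) < d"
  proof eventually_elim
    case (elim y)
    then obtain c' where c': "c' \<in> U'" "proj B c' = y" "bdist c' (f y) < \<epsilon> + t" by blast
    then obtain c where c: "c \<in> U" "proj B c = y" "bdist c c' < \<eta> + t" unfolding U'_def by auto
    have "bdist c (g y) \<le> bdist c c' + (bdist c' (f y) + bdist (f y) (g y))"
      using bdist_triangle[of c c' "g y"] bdist_triangle[of c' "f y" "g y"] c c' f g by simp
    also have "\<dots> < d" using c c' elim(1) t by simp
    finally show ?case using c by blast
  qed
qed

lemma econt_add:
  assumes f: "\<And>y. proj B (f y) = y" and g: "\<And>y. proj B (g y) = y"
    and e: "econt \<epsilon> f x" "econt \<eta> g x"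
  shows "econt (\<epsilon> + \<eta>) (\<lambda>y. badd B (f y) (g y)) x"
  unfolding econt_def
proof (intro allI impI)
  fix S d assume S: "open S" "badd B (f x) (g x) \<in> S" "\<epsilon> + \<eta> < d"
  define t where "t = (d - \<epsilon> - \<eta>) / 2"
  have t: "t > 0" "\<epsilon> + \<eta> + 2 * t = d" using S(3) by (auto simp: t_def field_simps)
  have cont: "continuous_on {(a, b). proj B a = proj B b} (\<lambda>p. badd B (fst p) (snd p))"
    using continuous_add by (simp add: case_prod_beta)
  obtain A where A: "open A" "A \<inter> {(a, b). proj B a = proj B b}
      = (\<lambda>p. badd B (fst p) (snd p)) -` S \<inter> {(a, b). proj B a = proj B b}"
    using continuous_on_open_invariant[THEN iffD1, OF cont, rule_format, OF S(1)] by blast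
  have "(f x, g x) \<in> A" using A(2) S f g by auto
  then obtain U U' where U: "open U" "open U'" "(f x, g x) \<in> U \<times> U'" "U \<times> U' \<subseteq> A"
    using open_prod_elim[OF A(1)] by metis
  have "\<forall>\<^sub>F y in nhds x. \<exists>c\<in>U. proj B c = y \<and> bdist c (f y) < \<epsilon> + t"
    "\<forall>\<^sub>F y in nhds x. \<exists>c\<in>U'. proj B c = y \<and> bdist c (g y) < \<eta> + t"
    using econtD[OF e(1) U(1)] econtD[OF e(2) U(2)] U(3) t by auto
  then show "\<forall>\<^sub>F y in nhds x. \<exists>c\<in>S. proj B c = y \<and> bdist c (badd B (f y) (g y)) < d"
  proof eventually_elim
    case (elim y)
    then obtain c c' where c: "c \<in> U" "proj B c = y" "bdist c (f y) < \<epsilon> + t"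
      and c': "c' \<in> U'" "proj B c' = y" "bdist c' (g y) < \<eta> + t" by blast
    have "(c, c') \<in> A \<inter> {(a, b). proj B a = proj B b}" using c c' U(4) by auto
    then have "badd B c c' \<in> S" unfolding A(2) by simp
    moreover have "bdist (badd B c c') (badd B (f y) (g y)) < d"
      using bdist_add[of c y c' "f y" "g y"] c c' f g t by simp
    ultimately show ?case using c c' by (intro bexI[of _ "badd B c c'"]) auto
  qed
qed

text \<open>
  Multiplication by the fixed scalar \<open>h x\<close> is continuous; the variation of h is absorbed by the
  local boundedness of f.
\<close>

lemma econt_scale:
  assumes f: "\<And>y. proj B (f y) = y" and e: "econt \<epsilon> f x" and \<epsilon>: "0 \<le> \<epsilon>"
    and h: "continuous_on UNIV h"
  shows "econt (cmod (h x) * \<epsilon>) (\<lambda>y. bscale B (h y) (f y)) x"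
  unfolding econt_def
proof (intro allI impI)
  fix U d assume U: "open U" "bscale B (h x) (f x) \<in> U" "cmod (h x) * \<epsilon> < d"
  define t where "t = (d - cmod (h x) * \<epsilon>) / 3"
  have t: "t > 0" "cmod (h x) * \<epsilon> + 3 * t = d" using U(3) by (auto simp: t_def field_simps)
  define M where "M = bnorm B (f x) + \<epsilon> + 2"
  have M: "M > 0" using \<epsilon> by (simp add: M_def add_nonneg_pos)
  define d' where "d' = \<epsilon> + t / (cmod (h x) + 1)"
  have d': "\<epsilon> < d'" using t by (simp add: d'_def add_nonneg_pos)
  have hd': "cmod (h x) * d' \<le> cmod (h x) * \<epsilon> + t"
  proof -
    have "cmod (h x) * (t / (cmod (h x) + 1)) \<le> t"
      using t mult_left_mono[of "cmod (h x)" "cmod (h x) + 1" t] by (simp add: pos_divide_le_eq add_nonneg_pos mult.commute)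
    then show ?thesis by (simp add: d'_def distrib_left)
  qed
  have "\<forall>\<^sub>F y in nhds x. \<exists>c\<in>{b. bnorm B b < bnorm B (f x) + 1}. proj B c = y \<and> bdist c (f y) < \<epsilon> + 1"
    by (rule econtD[OF e norm_usc]) auto
  then have bound: "\<forall>\<^sub>F y in nhds x. bnorm B (f y) < M"
  proof eventually_elim
    case (elim y)
    then obtain c where "bnorm B c < bnorm B (f x) + 1" "proj B c = y" "bdist c (f y) < \<epsilon> + 1" by blast
    then show ?case using bnorm_bdist[of "f y" c] bdist_commute[of c "f y"] f by (simp add: M_def)
  qed
  have "open (bscale B (h x) -` U)" using continuous_scale U(1) by (rule open_vimage[rotated])
  then have near: "\<forall>\<^sub>F y in nhds x. \<exists>c\<in>bscale B (h x) -` U. proj B c = y \<and> bdist c (f y) < d'"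
    using econtD[OF e] U(2) d' by simp
  have "open (h -` ball (h x) (t / M))" by (rule open_vimage[OF open_ball h])
  then have "\<forall>\<^sub>F y in nhds x. y \<in> h -` ball (h x) (t / M)"
    using t M by (intro eventually_nhds_in_open) auto
  then have "\<forall>\<^sub>F y in nhds x. dist (h y) (h x) < t / M"
    by eventually_elim (simp add: dist_commute)
  with near bound show "\<forall>\<^sub>F y in nhds x. \<exists>c\<in>U. proj B c = y \<and> bdist c (bscale B (h y) (f y)) < d"
  proof eventually_elim
    case (elim y)
    then obtain c where c: "bscale B (h x) c \<in> U" "proj B c = y" "bdist c (f y) < d'" by auto
    have "bdist (bscale B (h x) c) (bscale B (h y) (f y))
        \<le> bdist (bscale B (h x) c) (bscale B (h x) (f y)) + bdist (bscale B (h x) (f y)) (bscale B (h y) (f y))"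
      using c f by (intro bdist_triangle) auto
    also have "\<dots> = cmod (h x) * bdist c (f y) + cmod (h x - h y) * bnorm B (f y)"
      using c f by (simp add: bdist_scale bdist_scale_left)
    also have "\<dots> \<le> cmod (h x) * d' + t / M * M"
      using c(3) elim(2,3) M t by (intro add_mono mult_mono) (auto simp: dist_norm norm_minus_commute less_imp_le)
    also have "\<dots> < d" using hd' M t by simp
    finally show ?case using c by (intro bexI[of _ "bscale B (h x) c"]) auto
  qed
qed

lemma econt_zero:
  assumes \<epsilon>: "0 \<le> \<epsilon>"
  shows "econt \<epsilon> (bzero B) x"
  unfolding econt_def
proof (intro allI impI)
  fix U d assume U: "open U" "bzero B x \<in> U" "\<epsilon> < d"
  obtain N \<delta> where N: "open N" "x \<in> N" "\<delta> > 0" "\<And>d. \<lbrakk>proj B d \<in> N; bnorm B d < \<delta>\<rbrakk> \<Longrightarrow> d \<in> U"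
    using zero_neighbourhood[OF U(1,2)] by blast
  have "\<forall>\<^sub>F y in nhds x. y \<in> N" using N by (simp add: eventually_nhds_in_open)
  then show "\<forall>\<^sub>F y in nhds x. \<exists>c\<in>U. proj B c = y \<and> bdist c (bzero B y) < d"
  proof eventually_elim
    case (elim y)
    then show ?case using N(3) N(4)[of "bzero B y"] U(3) \<epsilon> by (intro bexI[of _ "bzero B y"]) auto
  qed
qed

text \<open>
  All values of g are taken in a neighbourhood of \<open>f x\<close> whose intersections with the
  fibres have small diameter.
\<close>

lemma econt_refine_local:
  assumes f: "\<And>y. proj B (f y) = y" and e: "econt \<epsilon> f x" and d: "\<epsilon> < d" and \<epsilon>': "0 < \<epsilon>'"
  obtains g N where "open N" "x \<in> N" "\<And>y. proj B (g y) = y" "g x = f x"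
    "\<And>y. y \<in> N \<Longrightarrow> bdist (g y) (f y) < d" "\<And>y. y \<in> N \<Longrightarrow> econt \<epsilon>' g y"
proof -
  have "bdist (f x) (f x) < \<epsilon>'" using \<epsilon>' by simp
  then obtain U1 U2 where U12: "open U1" "f x \<in> U1" "open U2" "f x \<in> U2"
    "\<And>c c'. \<lbrakk>c \<in> U1; c' \<in> U2; proj B c = proj B c'\<rbrakk> \<Longrightarrow> bdist c c' < \<epsilon>'"
    using bdist_near[OF refl] by metis
  define U where "U = U1 \<inter> U2"
  have U: "open U" "f x \<in> U" "\<And>c c'. \<lbrakk>c \<in> U; c' \<in> U; proj B c = proj B c'\<rbrakk> \<Longrightarrow> bdist c c' < \<epsilon>'"
    using U12 by (auto simp: U_def)
  obtain N where N: "open N" "x \<in> N" "\<And>y. y \<in> N \<Longrightarrow> \<exists>c\<in>U. proj B c = y \<and> bdist c (f y) < d"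
    using econtD[OF e U(1,2) d] by (auto simp: eventually_nhds)
  define g where "g y = (if y = x then f x else if y \<in> N
    then SOME c. c \<in> U \<and> proj B c = y \<and> bdist c (f y) < d else bzero B y)" for y
  have gN: "g y \<in> U \<and> proj B (g y) = y \<and> bdist (g y) (f y) < d" if y: "y \<in> N" for y
  proof (cases "y = x")
    case True
    have "0 < d" using N(3)[OF N(2)] bdist_nonneg order_le_less_trans by blast
    then show ?thesis using True U(2) f by (simp add: g_def)
  next
    case False
    then show ?thesis using someI_ex[of "\<lambda>c. c \<in> U \<and> proj B c = y \<and> bdist c (f y) < d"] N(3)[OF y] y
      by (auto simp: g_def)
  qed
  have proj_g: "proj B (g y) = y" for y
    using gN[of y] N(2) by (cases "y \<in> N") (auto simp: g_def)
  have "econt \<epsilon>' g y" if y: "y \<in> N" for y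
    unfolding econt_def
  proof (intro allI impI)
    fix W d' assume W: "open W" "g y \<in> W" "\<epsilon>' < d'"
    define Z where "Z = N \<inter> proj B ` (U \<inter> W)"
    have Z: "open Z" "y \<in> Z"
      using N(1) open_proj[OF open_Int[OF U(1) W(1)]] gN[OF y] y W(2) by (auto simp: Z_def image_iff intro!: bexI[of _ "g y"])
    then have "\<forall>\<^sub>F z in nhds y. z \<in> Z" by (rule eventually_nhds_in_open)
    then show "\<forall>\<^sub>F z in nhds y. \<exists>c\<in>W. proj B c = z \<and> bdist c (g z) < d'"
    proof eventually_elim
      case (elim z)
      then obtain c where c: "c \<in> U" "c \<in> W" "proj B c = z" "z \<in> N" by (auto simp: Z_def)
      then have "bdist c (g z) < \<epsilon>'" using U(3)[of c "g z"] gN[of z] by simp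
      then show ?case using c W(3) by (intro bexI[of _ c]) auto
    qed
  qed
  note econt_g = this
  have gx: "g x = f x" by (simp add: g_def)
  show thesis by (rule that[OF N(1,2) proj_g gx]) (use gN econt_g in blast)+
qed

end

context lc_banach_bundle
begin

text \<open>
  The local refinements are patched by successive convex combinations over a finite cover of K.
  The refinement through \<open>f x\<close> for x other than x0 is used off x0 only, so that the value at x0 is
  not changed.
\<close>

lemma econt_refine:
  assumes f: "\<And>y. proj B (f y) = y" and K: "compact K" and e: "\<And>x. x \<in> K \<Longrightarrow> econt \<epsilon> f x"
    and d: "\<epsilon> < d" and \<epsilon>': "0 < \<epsilon>'"
  obtains g where "\<And>y. proj B (g y) = y" "g x0 = f x0" "\<And>y. y \<in> K \<Longrightarrow> bdist (g y) (f y) < d"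
    "\<And>x. x \<in> K \<Longrightarrow> econt \<epsilon>' g x"
proof (cases "K = {}")
  case True
  then show thesis using that[of f] f by simp
next
  case False
  define Q where "Q x g N k M C \<longleftrightarrow> open N \<and> x \<in> N \<and> (\<forall>y. proj B (g y) = y) \<and> g x = f x \<and>
      (\<forall>y\<in>N. bdist (g y) (f y) < d) \<and> (\<forall>y\<in>N. econt \<epsilon>' g y) \<and> (x0 \<in> N \<longrightarrow> x = x0) \<and>
      continuous_on UNIV k \<and> (\<forall>y. 0 \<le> k y \<and> k y \<le> (1::real)) \<and> open M \<and> x \<in> M \<and> (\<forall>y\<in>M. k y = 1) \<and>
      closed C \<and> C \<subseteq> N \<and> (\<forall>y. y \<notin> C \<longrightarrow> k y = 0)" for x and g :: "'g \<Rightarrow> 'b" and N k M C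
  have "\<exists>g N k M C. Q x g N k M C" if x: "x \<in> K" for x
  proof -
    obtain g N where g: "open N" "x \<in> N" "\<And>y. proj B (g y) = y" "g x = f x"
      "\<And>y. y \<in> N \<Longrightarrow> bdist (g y) (f y) < d" "\<And>y. y \<in> N \<Longrightarrow> econt \<epsilon>' g y"
      using econt_refine_local[OF f e[OF x] d \<epsilon>'] by metis
    define N' where "N' = (if x = x0 then N else N - {x0})"
    have N': "open N'" "x \<in> N'" "N' \<subseteq> N" "x0 \<in> N' \<longrightarrow> x = x0"
      using g(1,2) by (auto simp: N'_def open_delete)
    obtain k :: "'g \<Rightarrow> real" and M C where k: "continuous_on UNIV k" "\<And>y. 0 \<le> k y" "\<And>y. k y \<le> 1"
      "open M" "x \<in> M" "\<And>y. y \<in> M \<Longrightarrow> k y = 1" "closed C" "C \<subseteq> N'" "\<And>y. y \<notin> C \<Longrightarrow> k y = 0"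
      using bump_function[OF lc_base N'(1,2)] by metis
    have "\<forall>y\<in>N'. bdist (g y) (f y) < d \<and> econt \<epsilon>' g y" using g(5,6) N'(3) by blast
    then have "Q x g N' k M C" unfolding Q_def by (intro conjI) (simp_all add: g(3,4) N' k)
    then show ?thesis by blast
  qed
  then obtain g N k M C where "\<And>x. x \<in> K \<Longrightarrow> Q x (g x) (N x) (k x) (M x) (C x)" by metis
  note loc = this[unfolded Q_def]
  have "\<exists>h. (\<forall>y. proj B (h y) = y) \<and> h x0 = f x0 \<and> (\<forall>y\<in>K. bdist (h y) (f y) < d) \<and>
      (\<forall>x\<in>F. \<forall>y\<in>M x \<inter> K. econt \<epsilon>' h y)" if "finite F" "F \<subseteq> K" for F
    using that
  proof (induction F)
    case empty
    have "0 < d" using False e d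
    proof -
      obtain x where x: "x \<in> K" using False by blast
      have "bdist (g x x) (f x) < d" using loc[OF x] by blast
      then show ?thesis using bdist_nonneg order_le_less_trans by blast
    qed
    then show ?case using f by (intro exI[of _ f]) auto
  next
    case (insert z F)
    then obtain h where hh: "(\<forall>y. proj B (h y) = y) \<and> h x0 = f x0 \<and> (\<forall>y\<in>K. bdist (h y) (f y) < d) \<and>
      (\<forall>x\<in>F. \<forall>y\<in>M x \<inter> K. econt \<epsilon>' h y)" by blast
    then have h: "\<And>y. proj B (h y) = y" "h x0 = f x0" "\<And>y. y \<in> K \<Longrightarrow> bdist (h y) (f y) < d"
      "\<And>x y. x \<in> F \<Longrightarrow> y \<in> M x \<Longrightarrow> y \<in> K \<Longrightarrow> econt \<epsilon>' h y" by simp_all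
    have zK: "z \<in> K" using insert.prems by simp
    have z: "\<And>y. proj B (g z y) = y" "g z z = f z" "\<And>y. y \<in> N z \<Longrightarrow> bdist (g z y) (f y) < d"
      "\<And>y. y \<in> N z \<Longrightarrow> econt \<epsilon>' (g z) y" "x0 \<in> N z \<Longrightarrow> z = x0" "continuous_on UNIV (k z)"
      "\<And>y. 0 \<le> k z y" "\<And>y. k z y \<le> 1" "open (M z)" "\<And>y. y \<in> M z \<Longrightarrow> k z y = 1" "closed (C z)"
      "C z \<subseteq> N z" "\<And>y. y \<notin> C z \<Longrightarrow> k z y = 0" "open (N z)"
      using loc[OF zK] by auto
    define h' where "h' y = badd B (bscale B (complex_of_real (1 - k z y)) (h y)) (bscale B (complex_of_real (k z y)) (g z y))" for y
    have proj_h': "proj B (h' y) = y" for y using h(1) z(1) by (simp add: h'_def)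
    have h'0: "h' y = h y" if "k z y = 0" for y
      using that h(1)[of y] z(1)[of y] by (simp add: h'_def bscale_zero badd_zero)
    have h'1: "h' y = g z y" if "k z y = 1" for y
      using that h(1)[of y] z(1)[of y] by (simp add: h'_def bscale_zero badd_zero)
    have Nk: "k z y = 0" if "y \<notin> N z" for y using z(12,13) that by blast
    have "h' x0 = f x0"
    proof (cases "x0 \<in> N z")
      case True
      then have "g z x0 = f x0" using z(2,5) by simp
      then show ?thesis using h(2) bscale_add[of "complex_of_real (1 - k z x0)" "f x0" "complex_of_real (k z x0)"]
        by (simp add: h'_def)
    qed (use h'0 Nk h(2) in simp)
    moreover have "bdist (h' y) (f y) < d" if y: "y \<in> K" for y
    proof (cases "y \<in> N z")
      case True
      have "f y = badd B (bscale B (complex_of_real (1 - k z y)) (f y)) (bscale B (complex_of_real (k z y)) (f y))"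
        using bscale_add[of "complex_of_real (1 - k z y)" "f y" "complex_of_real (k z y)"] by simp
      then have "bdist (h' y) (f y) \<le> bdist (bscale B (complex_of_real (1 - k z y)) (h y)) (bscale B (complex_of_real (1 - k z y)) (f y))
         + bdist (bscale B (complex_of_real (k z y)) (g z y)) (bscale B (complex_of_real (k z y)) (f y))"
        using bdist_add[of "bscale B (complex_of_real (1 - k z y)) (h y)" y "bscale B (complex_of_real (k z y)) (g z y)"
            "bscale B (complex_of_real (1 - k z y)) (f y)" "bscale B (complex_of_real (k z y)) (f y)"] h(1) z(1) f
        by (simp add: h'_def del: of_real_diff)
      also have "\<dots> = (1 - k z y) * bdist (h y) (f y) + k z y * bdist (g z y) (f y)"
        using h(1) z(1) f z(7,8)[of y] by (simp add: bdist_scale del: of_real_diff)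
      also have "\<dots> < d"
      proof (cases "k z y = 1")
        case True
        then show ?thesis using z(3)[OF \<open>y \<in> N z\<close>] by simp
      next
        case False
        have "(1 - k z y) * bdist (h y) (f y) < (1 - k z y) * d"
          using h(3)[OF y] z(8)[of y] False by (intro mult_strict_left_mono) auto
        moreover have "k z y * bdist (g z y) (f y) \<le> k z y * d"
          using z(3)[OF True] z(7)[of y] by (intro mult_left_mono) auto
        ultimately show ?thesis by (simp add: algebra_simps)
      qed
      finally show ?thesis .
    qed (use h'0 Nk h(3) y in simp)
    moreover have "econt \<epsilon>' h' y" if x: "x \<in> insert z F" "y \<in> M x \<inter> K" for x y
    proof (cases "x = z")
      case True
      have yN: "y \<in> N z" using Nk[of y] z(10)[of y] x True by auto
      have "\<forall>\<^sub>F w in nhds y. w \<in> M z" using x True z(9) by (simp add: eventually_nhds_in_open)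
      then have "\<forall>\<^sub>F w in nhds y. g z w = h' w" by eventually_elim (use h'1 z(10) in simp)
      then show ?thesis using econt_cong[OF z(4)[OF yN]] by blast
    next
      case False
      then have hy: "econt \<epsilon>' h y" using h(4) x by blast
      show ?thesis
      proof (cases "y \<in> N z")
        case True
        have "econt (cmod (complex_of_real (1 - k z y)) * \<epsilon>' + cmod (complex_of_real (k z y)) * \<epsilon>') h' y"
          unfolding h'_def
          by (intro econt_add econt_scale hy z(4)[OF True] continuous_intros z(6)) (use h(1) z(1) \<epsilon>' in auto)
        moreover have "cmod (complex_of_real (1 - k z y)) * \<epsilon>' + cmod (complex_of_real (k z y)) * \<epsilon>' = \<epsilon>'"
          using z(7,8)[of y] by (simp only: norm_of_real) (simp add: algebra_simps)
        ultimately show ?thesis by simp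
      next
        case False
        then have "y \<in> - C z" using z(12) by blast
        then have "\<forall>\<^sub>F w in nhds y. w \<in> - C z" using z(11) by (intro eventually_nhds_in_open) auto
        then have "\<forall>\<^sub>F w in nhds y. h w = h' w" by eventually_elim (use h'0 z(13) in simp)
        then show ?thesis using econt_cong[OF hy] by blast
      qed
    qed
    ultimately show ?case using proj_h' by (intro exI[of _ h']) blast
  qed
  note patch = this
  have "\<And>x. x \<in> K \<Longrightarrow> open (M x)" "K \<subseteq> (\<Union>x\<in>K. M x)" using loc by auto
  then obtain F where F: "F \<subseteq> K" "finite F" "K \<subseteq> (\<Union>x\<in>F. M x)"
    using compactE_image[OF K, of K M] by metis
  obtain h where h: "\<And>y. proj B (h y) = y" "h x0 = f x0" "\<And>y. y \<in> K \<Longrightarrow> bdist (h y) (f y) < d"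
      "\<And>x y. x \<in> F \<Longrightarrow> y \<in> M x \<inter> K \<Longrightarrow> econt \<epsilon>' h y"
    using patch[OF F(2,1)] by metis
  show thesis by (rule that[OF h(1,2,3)]) (use h(4) F(3) in blast)+
qed

text \<open>
  The construction of Douady and dal Soglio-Herault: sections through b that are continuous up to
  \<open>(1/2)\<^sup>n\<close> on a fixed compact neighbourhood of the base point are refined successively, each
  differing from the previous one by at most \<open>2 * (1/2)\<^sup>n\<close>, so that they converge uniformly to a
  section that is continuous up to every positive error; a bump function extends it by zero.
\<close>

theorem enough_sections:
  obtains f where "\<And>x. proj B (f x) = x" "continuous_on UNIV f" "f (proj B b) = b"
    "\<exists>K. compact K \<and> (\<forall>x. x \<notin> K \<longrightarrow> f x = bzero B x)"
proof -
  define x0 where "x0 = proj B b"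
  define e where "e = (\<lambda>n::nat. (1/2) ^ n :: real)"
  have e: "0 < e n" "e (Suc n) = e n / 2" for n by (simp_all add: e_def)
  define f00 where "f00 y = (if y = x0 then b else bzero B y)" for y
  have f00: "proj B (f00 y) = y" for y by (simp add: f00_def x0_def)
  \<comment> \<open>Any bound on the oscillation of the initial section at x0 will do.\<close>
  have e0: "econt (bnorm B b) f00 x0"
    unfolding econt_def
  proof (intro allI impI)
    fix U d assume U: "open U" "f00 x0 \<in> U" "bnorm B b < d"
    define W where "W = U \<inter> {c. bnorm B c < d}"
    have W: "open W" "b \<in> W" using U norm_usc by (auto simp: W_def f00_def)
    have "\<forall>\<^sub>F y in nhds x0. y \<in> proj B ` W"
      using open_proj[OF W(1)] W(2) by (intro eventually_nhds_in_open) (auto simp: x0_def)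
    then show "\<forall>\<^sub>F y in nhds x0. \<exists>c\<in>U. proj B c = y \<and> bdist c (f00 y) < d"
    proof eventually_elim
      case (elim y)
      show ?case
      proof (cases "y = x0")
        case True
        have "0 < d" using U(3) bnorm_nonneg order_le_less_trans by blast
        then show ?thesis using True U(2) f00 by (intro bexI[of _ "f00 x0"]) auto
      next
        case False
        obtain c where "c \<in> W" "proj B c = y" using elim by auto
        then show ?thesis using False bdist_zero[of c y] by (auto simp: W_def f00_def intro!: bexI[of _ c])
      qed
    qed
  qed
  have "f00 x0 = b" "bnorm B b < bnorm B b + 1" by (simp_all add: f00_def)
  then obtain f0 N where f0: "open N" "x0 \<in> N" "\<And>y. proj B (f0 y) = y" "f0 x0 = b" "\<And>y. y \<in> N \<Longrightarrow> econt 1 f0 y"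
    using econt_refine_local[OF f00 e0 _ zero_less_one] by metis
  have haus: "Hausdorff_space (euclidean :: 'g topology)"
    unfolding Hausdorff_space_def disjnt_def using hausdorff by (auto simp: open_openin[symmetric])
  obtain V K where K: "open V" "compact K" "x0 \<in> V" "V \<subseteq> K" "K \<subseteq> N"
    using locally_compact_imp_neighbourhood_base[OF lc_base locally_compact_Hausdorff_imp_regular_space[OF lc_base haus]]
      f0(1,2) unfolding neighbourhood_base_of by (force simp: open_openin[symmetric])
  define P where "P n f \<longleftrightarrow> (\<forall>y. proj B (f y) = y) \<and> f x0 = b \<and> (\<forall>x\<in>K. econt (e n) f x)" for n and f :: "'g \<Rightarrow> 'b"
  define Q where "Q n f f' \<longleftrightarrow> (\<forall>y\<in>K. bdist (f' y) (f y) < 2 * e n)" for n :: nat and f f' :: "'g \<Rightarrow> 'b"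
  have P0: "P 0 f0" using f0 K(5) by (auto simp: P_def e_def)
  have step: "\<exists>f'. P (Suc n) f' \<and> Q n f f'" if "P n f" for n f
  proof -
    have f: "\<And>y. proj B (f y) = y" "f x0 = b" "\<And>x. x \<in> K \<Longrightarrow> econt (e n) f x" using that by (auto simp: P_def)
    have lt: "e n < 2 * e n" using e(1)[of n] by simp
    obtain g where "\<And>y. proj B (g y) = y" "g x0 = f x0" "\<And>y. y \<in> K \<Longrightarrow> bdist (g y) (f y) < 2 * e n"
      "\<And>x. x \<in> K \<Longrightarrow> econt (e (Suc n)) g x"
      using econt_refine[where ?x0.0 = x0, OF f(1) K(2) f(3) lt e(1)[of "Suc n"]] by metis
    then show ?thesis using f(2) by (intro exI[of _ g]) (simp add: P_def Q_def)
  qed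
  have "\<exists>F. \<forall>n. P n (F n) \<and> Q n (F n) (F (Suc n))"
    by (rule dependent_nat_choice) (use P0 step in blast)+
  then obtain F where F: "\<And>n. P n (F n)" "\<And>n. Q n (F n) (F (Suc n))" by metis
  have pF: "proj B (F n y) = y" and F0: "F n x0 = b" and eF: "x \<in> K \<Longrightarrow> econt (e n) (F n) x" for n x y
    using F(1)[of n] by (auto simp: P_def)
  have close: "bdist (F m y) (F n y) \<le> 4 * e n" if y: "y \<in> K" and "n \<le> m" for m n y
  proof -
    have "bdist (F m y) (F n y) \<le> 4 * e n - 4 * e m"
      using \<open>n \<le> m\<close>
    proof (induction m rule: dec_induct)
      case (step m)
      have "bdist (F (Suc m) y) (F n y) \<le> bdist (F (Suc m) y) (F m y) + bdist (F m y) (F n y)"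
        using pF by (intro bdist_triangle) auto
      then show ?case using step F(2)[of m] y e(2)[of m] by (auto simp: Q_def)
    qed simp
    then show ?thesis using e(1)[of m] by simp
  qed
  have e_null: "e \<longlonglongrightarrow> 0" unfolding e_def by (rule LIMSEQ_realpow_zero) auto
  have e_small: "\<exists>n. e n < r" if "0 < r" for r
    using order_tendstoD(2)[OF e_null that] by (auto simp: eventually_sequentially)
  have "\<exists>l. proj B l = y \<and> (\<forall>n. bdist (F n y) l \<le> 4 * e n)" if y: "y \<in> K" for y
  proof -
    interpret banach_space "fibre B y" by (rule fibre_banach)
    have "cauchy_in (fibre B y) (\<lambda>n. F n y)"
      unfolding cauchy_in_def vdist_fibre
    proof (intro conjI allI impI)
      fix r :: real assume r: "r > 0"
      obtain n where n: "e n < r / 8" using e_small[of "r/8"] r by auto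
      have "bdist (F i y) (F j y) < r" if "i \<ge> n" "j \<ge> n" for i j
        using bdist_triangle[of "F i y" "F n y" "F j y"] bdist_commute[of "F n y" "F j y"]
          close[OF y that(1)] close[OF y that(2)] pF n by simp
      then show "\<exists>N. \<forall>m\<ge>N. \<forall>n\<ge>N. bdist (F m y) (F n y) < r" by blast
    qed (use pF in auto)
    then obtain l where l: "proj B l = y" "(\<lambda>n. bdist (F n y) l) \<longlonglongrightarrow> 0"
      using complete[of "\<lambda>n. F n y"] by (auto simp: vdist_fibre)
    have "bdist (F n y) l \<le> 4 * e n" for n
    proof (rule LIMSEQ_le_const)
      show "(\<lambda>m. 4 * e n + bdist (F m y) l) \<longlonglongrightarrow> 4 * e n"
        using tendsto_add[OF tendsto_const l(2), of "4 * e n"] by simp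
      have "bdist (F n y) l \<le> 4 * e n + bdist (F m y) l" if "n \<le> m" for m
        using bdist_triangle[of "F n y" "F m y" l] close[OF y that] bdist_commute[of "F n y" "F m y"] pF l(1) by simp
      then show "\<exists>N. \<forall>m\<ge>N. bdist (F n y) l \<le> 4 * e n + bdist (F m y) l" by blast
    qed
    then show ?thesis using l(1) by blast
  qed
  then obtain l where l: "\<And>y. y \<in> K \<Longrightarrow> proj B (l y) = y" "\<And>y n. y \<in> K \<Longrightarrow> bdist (F n y) (l y) \<le> 4 * e n"
    by metis
  define f where "f y = (if y \<in> K then l y else bzero B y)" for y
  have pf: "proj B (f y) = y" for y using l(1) by (simp add: f_def)
  have x0K: "x0 \<in> K" using K by blast
  have fx0: "f x0 = b"
  proof -
    have "bdist b (f x0) \<le> 4 * e n" for n using l(2)[OF x0K, of n] F0 x0K by (simp add: f_def)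
    then have "bdist b (f x0) \<le> 0"
      using LIMSEQ_le_const[OF tendsto_mult_right_zero[OF e_null, of 4]] by blast
    then have "bdist b (f x0) = 0" using bdist_nonneg order_antisym by blast
    then show ?thesis using bdist_eq_zero[of b "f x0"] pf by (simp add: x0_def)
  qed
  have ef: "econt \<epsilon> f y" if y: "y \<in> V" and \<epsilon>: "0 < \<epsilon>" for y \<epsilon>
  proof -
    obtain n where n: "e n < \<epsilon> / 9" using e_small[of "\<epsilon>/9"] \<epsilon> by auto
    have "\<forall>\<^sub>F z in nhds y. z \<in> V" using K(1) y by (rule eventually_nhds_in_open)
    then have "\<forall>\<^sub>F z in nhds y. bdist (F n z) (f z) \<le> 4 * e n"
      by eventually_elim (use l(2) K(4) in \<open>auto simp: f_def\<close>)
    then have "econt (e n + 2 * (4 * e n)) f y"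
      using econt_perturb[OF pF pf eF[of y n]] y K(4) by blast
    then show ?thesis by (rule econt_mono) (use n in simp)
  qed
  obtain k :: "'g \<Rightarrow> real" and M C where k: "continuous_on UNIV k" "\<And>y. 0 \<le> k y" "\<And>y. k y \<le> 1"
    "open M" "x0 \<in> M" "\<And>y. y \<in> M \<Longrightarrow> k y = 1" "closed C" "C \<subseteq> V" "\<And>y. y \<notin> C \<Longrightarrow> k y = 0"
    using bump_function[OF lc_base K(1,3)] by metis
  define g where "g y = bscale B (complex_of_real (k y)) (f y)" for y
  have pg: "proj B (g y) = y" for y using pf by (simp add: g_def)
  have g0: "g y = bzero B y" if "y \<notin> C" for y using that k(9) pf[of y] by (simp add: g_def bscale_zero)
  have "econt \<epsilon> g y" if \<epsilon>: "0 < \<epsilon>" for \<epsilon> y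
  proof (cases "y \<in> V")
    case True
    have "econt (cmod (complex_of_real (k y)) * \<epsilon>) g y"
      unfolding g_def by (rule econt_scale[OF pf ef[OF True \<epsilon>]]) (use \<epsilon> k(1) in \<open>auto intro!: continuous_intros\<close>)
    moreover have "k y * \<epsilon> \<le> \<epsilon>" using k(3)[of y] \<epsilon> by (simp add: mult_le_cancel_right1)
    ultimately show ?thesis using k(2)[of y] by (auto intro: econt_mono)
  next
    case False
    then have "\<forall>\<^sub>F z in nhds y. z \<in> - C" using k(7,8) by (intro eventually_nhds_in_open) auto
    then have "\<forall>\<^sub>F z in nhds y. bzero B z = g z" by eventually_elim (use g0 in simp)
    then show ?thesis using econt_cong[OF econt_zero[of \<epsilon>]] \<epsilon> by (meson less_imp_le)
  qed
  then have "(g \<longlongrightarrow> g y) (nhds y)" for y using econt_imp_tendsto[OF pg] by blast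
  then have "continuous_on UNIV g"
    by (simp add: continuous_on_def tendsto_at_iff_tendsto_nhds)
  moreover have "g x0 = b" using fx0 k(5,6) by (simp add: g_def)
  moreover have "\<forall>x. x \<notin> K \<longrightarrow> g x = bzero B x" using g0 k(8) K(4) by blast
  ultimately show thesis using that[of g] pg K(2) by (auto simp: x0_def)
qed

end

section \<open>Representations of enveloping algebras\<close>

text \<open>
  The universal norm of an algebra is only a seminorm. Its positivity and symmetry follow from the
  two inequalities below.
\<close>

locale seminormed_space = complex_space X for X :: "('a, 'm) star_alg_scheme" (structure) +
  assumes snorm_triangle: "\<lbrakk>x \<in> carr X; y \<in> carr X\<rbrakk> \<Longrightarrow> \<parallel>x \<oplus> y\<parallel> \<le> \<parallel>x\<parallel> + \<parallel>y\<parallel>"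
    and snorm_scale: "x \<in> carr X \<Longrightarrow> \<parallel>c \<odot> x\<parallel> \<le> cmod c * \<parallel>x\<parallel>"
begin

lemma snorm_zero: "\<parallel>\<zero>\<parallel> = 0"
  using snorm_scale[of \<zero> 0] snorm_triangle[of \<zero> \<zero>] by simp

lemma snorm_minus: "x \<in> carr X \<Longrightarrow> \<parallel>(- 1) \<odot> x\<parallel> = \<parallel>x\<parallel>"
  using snorm_scale[of x "-1"] snorm_scale[of "(-1) \<odot> x" "-1"] by simp

lemma snorm_nonneg: "x \<in> carr X \<Longrightarrow> 0 \<le> \<parallel>x\<parallel>"
  using snorm_triangle[of x "(-1) \<odot> x"] snorm_minus[of x] snorm_zero by simp

lemma vdist_nonneg: "\<lbrakk>x \<in> carr X; y \<in> carr X\<rbrakk> \<Longrightarrow> 0 \<le> vdist X x y"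
  by (simp add: vdist_def snorm_nonneg)

lemma vdist_self: "x \<in> carr X \<Longrightarrow> vdist X x x = 0"
  by (simp add: vdist_def snorm_zero)

lemma vdist_commute: "\<lbrakk>x \<in> carr X; y \<in> carr X\<rbrakk> \<Longrightarrow> vdist X x y = vdist X y x"
  unfolding vdist_def using snorm_minus[of "x \<ominus> y"] by (simp add: diff_commute)

lemma vdist_triangle: "\<lbrakk>x \<in> carr X; y \<in> carr X; z \<in> carr X\<rbrakk> \<Longrightarrow> vdist X x z \<le> vdist X x y + vdist X y z"
  unfolding vdist_def using snorm_triangle[of "x \<ominus> y" "y \<ominus> z"] by (simp add: diff_triangle)

lemma vdist_add:
  "\<lbrakk>x \<in> carr X; y \<in> carr X; x' \<in> carr X; y' \<in> carr X\<rbrakk>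
    \<Longrightarrow> vdist X (x \<oplus> y) (x' \<oplus> y') \<le> vdist X x x' + vdist X y y'"
  unfolding vdist_def using snorm_triangle[of "x \<ominus> x'" "y \<ominus> y'"] by (simp add: diff_add_add)

lemma vdist_scale: "\<lbrakk>x \<in> carr X; y \<in> carr X\<rbrakk> \<Longrightarrow> vdist X (c \<odot> x) (c \<odot> y) \<le> cmod c * vdist X x y"
  unfolding vdist_def using snorm_scale[of "x \<ominus> y" c] by (simp add: diff_scale)

lemma cauchy_carr: "cauchy_in X S \<Longrightarrow> S n \<in> carr X"
  by (auto simp: cauchy_in_def)

lemma cauchy_const: "x \<in> carr X \<Longrightarrow> cauchy_in X (\<lambda>n. x)"
  by (auto simp: cauchy_in_def vdist_self)

lemma cauchy_add:
  assumes S: "cauchy_in X S" and T: "cauchy_in X T"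
  shows "cauchy_in X (\<lambda>n. S n \<oplus> T n)"
  unfolding cauchy_in_def
proof (intro conjI allI impI)
  show "range (\<lambda>n. S n \<oplus> T n) \<subseteq> carr X" using cauchy_carr S T by auto
  fix e :: real assume e: "e > 0"
  then obtain N M where N: "\<And>m n. m \<ge> N \<Longrightarrow> n \<ge> N \<Longrightarrow> vdist X (S m) (S n) < e/2"
    and M: "\<And>m n. m \<ge> M \<Longrightarrow> n \<ge> M \<Longrightarrow> vdist X (T m) (T n) < e/2"
    using S T unfolding cauchy_in_def by (meson half_gt_zero)
  have "vdist X (S m \<oplus> T m) (S n \<oplus> T n) < e" if "m \<ge> max N M" "n \<ge> max N M" for m n
    using vdist_add[of "S m" "T m" "S n" "T n"] N[of m n] M[of m n] that cauchy_carr S T by simp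
  then show "\<exists>N. \<forall>m\<ge>N. \<forall>n\<ge>N. vdist X (S m \<oplus> T m) (S n \<oplus> T n) < e" by blast
qed

lemma cauchy_minus:
  assumes S: "cauchy_in X S"
  shows "cauchy_in X (\<lambda>n. (- 1) \<odot> S n)"
  unfolding cauchy_in_def
proof (intro conjI allI impI)
  show "range (\<lambda>n. (- 1) \<odot> S n) \<subseteq> carr X" using cauchy_carr S by auto
  fix e :: real assume e: "e > 0"
  then obtain N where N: "\<And>m n. m \<ge> N \<Longrightarrow> n \<ge> N \<Longrightarrow> vdist X (S m) (S n) < e"
    using S unfolding cauchy_in_def by meson
  have "vdist X ((- 1) \<odot> S m) ((- 1) \<odot> S n) < e" if "m \<ge> N" "n \<ge> N" for m n
    using vdist_scale[of "S m" "S n" "-1"] N[OF that] cauchy_carr S by simp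
  then show "\<exists>N. \<forall>m\<ge>N. \<forall>n\<ge>N. vdist X ((- 1) \<odot> S m) ((- 1) \<odot> S n) < e" by blast
qed

lemma class_self: "cauchy_in X S \<Longrightarrow> S \<in> cauchy_class X S"
  using vdist_self cauchy_carr by (simp add: cauchy_class_def)

lemma class_eq:
  assumes S: "cauchy_in X S" and T: "T \<in> cauchy_class X S"
  shows "cauchy_class X T = cauchy_class X S"
proof -
  have T': "cauchy_in X T" "(\<lambda>n. vdist X (S n) (T n)) \<longlonglongrightarrow> 0" using T by (auto simp: cauchy_class_def)
  have sub: "(\<lambda>n. vdist X (P n) (R n)) \<longlonglongrightarrow> 0"
    if "cauchy_in X P" "cauchy_in X Q" "cauchy_in X R"
      "(\<lambda>n. vdist X (P n) (Q n)) \<longlonglongrightarrow> 0" "(\<lambda>n. vdist X (Q n) (R n)) \<longlonglongrightarrow> 0" for P Q R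
  proof (rule null_le)
    show "(\<lambda>n. vdist X (P n) (Q n) + vdist X (Q n) (R n)) \<longlonglongrightarrow> 0"
      using tendsto_add[OF that(4,5)] by simp
  qed (use that vdist_triangle vdist_nonneg cauchy_carr in auto)
  have "(\<lambda>n. vdist X (T n) (S n)) \<longlonglongrightarrow> 0"
    using T'(2) vdist_commute[OF cauchy_carr[OF S] cauchy_carr[OF T'(1)]] by simp
  then show ?thesis
    using sub S T' unfolding cauchy_class_def by blast
qed

lemma completion_closed [simp]: "cauchy_in X S \<Longrightarrow> cauchy_class X S \<in> carr (completion X)"
  by (simp add: completion_def)

lemma completion_minus:
  assumes S: "cauchy_in X S"
  shows "(- 1) \<odot>\<^bsub>completion X\<^esub> cauchy_class X S = cauchy_class X (\<lambda>n. (- 1) \<odot> S n)"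
proof -
  have "cauchy_class X (\<lambda>n. (- 1) \<odot> T n) = cauchy_class X (\<lambda>n. (- 1) \<odot> S n)" if T: "T \<in> cauchy_class X S" for T
  proof (rule class_eq[OF cauchy_minus[OF S]])
    have T': "cauchy_in X T" "(\<lambda>n. vdist X (S n) (T n)) \<longlonglongrightarrow> 0" using T by (auto simp: cauchy_class_def)
    have "(\<lambda>n. vdist X ((- 1) \<odot> S n) ((- 1) \<odot> T n)) \<longlonglongrightarrow> 0"
      by (rule null_le[OF T'(2)])
        (use vdist_nonneg vdist_scale[of _ _ "-1"] cauchy_carr[OF S] cauchy_carr[OF T'(1)] in auto)
    then show "(\<lambda>n. (- 1) \<odot> T n) \<in> cauchy_class X (\<lambda>n. (- 1) \<odot> S n)"
      using cauchy_minus[OF T'(1)] by (simp add: cauchy_class_def)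
  qed
  then have "(\<Union>T\<in>cauchy_class X S. cauchy_class X (\<lambda>n. (- 1) \<odot> T n)) = cauchy_class X (\<lambda>n. (- 1) \<odot> S n)"
    by (intro UN_constant_eq[OF class_self[OF S]] ballI)
  then show ?thesis by (simp add: completion_def)
qed

lemma completion_add:
  assumes S: "cauchy_in X S" and T: "cauchy_in X T"
  shows "cauchy_class X S \<oplus>\<^bsub>completion X\<^esub> cauchy_class X T = cauchy_class X (\<lambda>n. S n \<oplus> T n)"
proof -
  have "cauchy_class X (\<lambda>n. P n \<oplus> R n) = cauchy_class X (\<lambda>n. S n \<oplus> T n)"
    if P: "P \<in> cauchy_class X S" and R: "R \<in> cauchy_class X T" for P R
  proof (rule class_eq[OF cauchy_add[OF S T]])
    have P': "cauchy_in X P" "(\<lambda>n. vdist X (S n) (P n)) \<longlonglongrightarrow> 0" using P by (auto simp: cauchy_class_def)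
    have R': "cauchy_in X R" "(\<lambda>n. vdist X (T n) (R n)) \<longlonglongrightarrow> 0" using R by (auto simp: cauchy_class_def)
    have null: "(\<lambda>n. vdist X (S n) (P n) + vdist X (T n) (R n)) \<longlonglongrightarrow> 0"
      using tendsto_add[OF P'(2) R'(2)] by simp
    have "(\<lambda>n. vdist X (S n \<oplus> T n) (P n \<oplus> R n)) \<longlonglongrightarrow> 0"
      by (rule null_le[OF null]) (use vdist_nonneg vdist_add cauchy_carr S T P' R' in auto)
    then show "(\<lambda>n. P n \<oplus> R n) \<in> cauchy_class X (\<lambda>n. S n \<oplus> T n)"
      using cauchy_add[OF P'(1) R'(1)] by (simp add: cauchy_class_def)
  qed
  then have "(\<Union>P\<in>cauchy_class X S. \<Union>R\<in>cauchy_class X T. cauchy_class X (\<lambda>n. P n \<oplus> R n)) = cauchy_class X (\<lambda>n. S n \<oplus> T n)"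
    by (intro UN_constant_eq[OF class_self[OF S]] UN_constant_eq[OF class_self[OF T]] ballI)
  then show ?thesis by (simp add: completion_def)
qed

lemma completion_norm_le:
  assumes S: "cauchy_in X S" and le: "\<And>n. n \<ge> N \<Longrightarrow> \<parallel>S n\<parallel> \<le> r"
  shows "\<parallel>cauchy_class X S\<parallel>\<^bsub>completion X\<^esub> \<le> r"
proof -
  have norm_dist: "\<bar>\<parallel>x\<parallel> - \<parallel>y\<parallel>\<bar> \<le> vdist X x y" if "x \<in> carr X" "y \<in> carr X" for x y
  proof -
    have "\<parallel>x\<parallel> \<le> \<parallel>x \<ominus> y\<parallel> + \<parallel>y\<parallel>" "\<parallel>y\<parallel> \<le> \<parallel>y \<ominus> x\<parallel> + \<parallel>x\<parallel>"
      using snorm_triangle[of "x \<ominus> y" y] snorm_triangle[of "y \<ominus> x" x] that by (simp_all add: diff_add_cancel)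
    then show ?thesis using vdist_commute[OF that] by (simp add: vdist_def abs_le_iff)
  qed
  have "Cauchy (\<lambda>n. \<parallel>S n\<parallel>)"
  proof (rule CauchyI)
    fix e :: real assume "e > 0"
    then obtain N where N: "\<And>m n. m \<ge> N \<Longrightarrow> n \<ge> N \<Longrightarrow> vdist X (S m) (S n) < e"
      using S unfolding cauchy_in_def by meson
    then show "\<exists>N. \<forall>m\<ge>N. \<forall>n\<ge>N. norm (\<parallel>S m\<parallel> - \<parallel>S n\<parallel>) < e"
      using order_le_less_trans[OF norm_dist[OF cauchy_carr[OF S] cauchy_carr[OF S]]] by fastforce
  qed
  then obtain t where t: "(\<lambda>n. \<parallel>S n\<parallel>) \<longlonglongrightarrow> t" using Cauchy_convergent convergent_def by blast
  have all: "(\<lambda>n. \<parallel>T n\<parallel>) \<longlonglongrightarrow> t" if T: "T \<in> cauchy_class X S" for T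
  proof -
    have T': "cauchy_in X T" "(\<lambda>n. vdist X (S n) (T n)) \<longlonglongrightarrow> 0" using T by (auto simp: cauchy_class_def)
    have "(\<lambda>n. \<parallel>S n\<parallel> - \<parallel>T n\<parallel>) \<longlonglongrightarrow> 0"
      by (rule null_comparison[OF T'(2)]) (use norm_dist cauchy_carr S T'(1) in auto)
    from tendsto_diff[OF t this] show ?thesis by simp
  qed
  have "\<parallel>cauchy_class X S\<parallel>\<^bsub>completion X\<^esub> = (THE t. \<forall>T\<in>cauchy_class X S. (\<lambda>n. \<parallel>T n\<parallel>) \<longlonglongrightarrow> t)"
    by (simp add: completion_def)
  also have "\<dots> = t"
    using all class_self[OF S] by (intro the_equality) (auto intro: LIMSEQ_unique)
  finally show ?thesis using LIMSEQ_le_const2[OF t] le by auto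
qed

text \<open>
  The constant sequences are dense in the completion and representations are norm-decreasing, so
  invariance of a closed subspace need only be tested on the original algebra.
\<close>

lemma invariant_subspace_completionI:
  assumes L: "representation (completion X) V L" and W: "closed_subspace V W"
    and inv: "\<And>f x. \<lbrakk>f \<in> carr X; x \<in> W\<rbrakk> \<Longrightarrow> L (cauchy_class X (\<lambda>n. f)) x \<in> W"
  shows "invariant_subspace (completion X) V L W"
  unfolding invariant_subspace_def
proof (intro conjI ballI W)
  fix c x assume c: "c \<in> carr (completion X)" and x: "x \<in> W"
  note R = representationD[OF L]
  interpret V: hilbert_space V by (rule R(1))
  have xV: "x \<in> carr V" using W x by (auto simp: closed_subspace_def)
  obtain S where S: "cauchy_in X S" "c = cauchy_class X S" using c by (auto simp: completion_def)
  show "L c x \<in> W"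
  proof (rule V.closed_subspace_approx[OF W R(8)[OF c xV]])
    fix e :: real assume e: "e > 0"
    define d where "d = e / (\<parallel>x\<parallel>\<^bsub>V\<^esub> + 1)"
    have d: "d > 0" using e xV by (simp add: d_def add_nonneg_pos)
    obtain N where N: "\<And>m n. m \<ge> N \<Longrightarrow> n \<ge> N \<Longrightarrow> vdist X (S m) (S n) < d"
      using S(1) d unfolding cauchy_in_def by meson
    define f where "f = cauchy_class X (\<lambda>n. S N)"
    note cf = cauchy_const[OF cauchy_carr[OF S(1), of N]]
    have f: "f \<in> carr (completion X)" using cf by (simp add: f_def)
    have diff: "c \<ominus>\<^bsub>completion X\<^esub> f = cauchy_class X (\<lambda>n. S n \<ominus> S N)"
      unfolding S(2) f_def completion_minus[OF cf] by (rule completion_add[OF S(1) cauchy_minus[OF cf]])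
    have cd: "cauchy_in X (\<lambda>n. S n \<ominus> S N)" by (rule cauchy_add[OF S(1) cauchy_minus[OF cf]])
    have "\<parallel>c \<ominus>\<^bsub>completion X\<^esub> f\<parallel>\<^bsub>completion X\<^esub> \<le> d"
      unfolding diff by (rule completion_norm_le[OF cd, of N]) (use N in \<open>force simp: vdist_def intro: less_imp_le\<close>)
    then have "\<parallel>L (c \<ominus>\<^bsub>completion X\<^esub> f) x\<parallel>\<^bsub>V\<^esub> \<le> d * \<parallel>x\<parallel>\<^bsub>V\<^esub>"
      using representation_norm_le[OF L _ xV, of "c \<ominus>\<^bsub>completion X\<^esub> f"] completion_closed[OF cd]
        mult_right_mono[OF _ V.norm_nonneg[OF xV]] unfolding diff by (meson order_trans)
    moreover have "L (c \<ominus>\<^bsub>completion X\<^esub> f) x = L c x \<ominus>\<^bsub>V\<^esub> L f x"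
    proof -
      have "(- 1) \<odot>\<^bsub>completion X\<^esub> f \<in> carr (completion X)"
        unfolding f_def completion_minus[OF cf] using cauchy_minus[OF cf] by simp
      then show ?thesis using R(4)[OF c _ xV] R(6)[OF f xV] by simp
    qed
    moreover have "d * \<parallel>x\<parallel>\<^bsub>V\<^esub> < e"
      using e V.norm_nonneg[OF xV] by (simp add: d_def pos_divide_less_eq add_nonneg_pos)
    ultimately have "\<parallel>L c x \<ominus>\<^bsub>V\<^esub> L f x\<parallel>\<^bsub>V\<^esub> < e" by simp
    then show "\<exists>w\<in>W. \<parallel>L c x \<ominus>\<^bsub>V\<^esub> w\<parallel>\<^bsub>V\<^esub> < e"
      using inv[OF cauchy_carr[OF S(1)] x] unfolding f_def by blast
  qed
qed

end

lemma trivial_hilbert_space: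
  "hilbert_space \<lparr>carr = {z}, vzero = z, vadd = (\<lambda>_ _. z), vscale = (\<lambda>_ _. z), vnorm = (\<lambda>_. 0), vinner = (\<lambda>_ _. 0)\<rparr>"
  by unfold_locales (auto simp: vdist_def)

text \<open>
  The zero representation shows that the supremum defining the universal norm is taken over a
  nonempty set.
\<close>

lemma trivial_representation:
  assumes "\<And>a. a \<in> carr A \<Longrightarrow> 0 \<le> \<parallel>a\<parallel>\<^bsub>A\<^esub>"
  shows "representation A \<lparr>carr = {z}, vzero = z, vadd = (\<lambda>_ _. z), vscale = (\<lambda>_ _. z), vnorm = (\<lambda>_. 0),
    vinner = (\<lambda>_ _. 0)\<rparr> (\<lambda>_ _. z)"
  using assms trivial_hilbert_space[of z]
  by (auto simp: representation_def bounded_op_def op_norm_def)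

lemma universal_seminormed:
  assumes D: "complex_space D" and pos: "\<And>a. a \<in> carr D \<Longrightarrow> 0 \<le> \<parallel>a\<parallel>\<^bsub>D\<^esub>"
  shows "seminormed_space (universal_alg D)"
proof -
  interpret D: complex_space D by (rule D)
  define R where "R a = {op_norm V (L a) | (V :: ('a \<Rightarrow> complex) ispace) L. representation D V L}" for a
  have R: "universal_norm D a = Sup (R a)" for a by (simp add: universal_norm_def R_def)
  obtain V0 :: "('a \<Rightarrow> complex) ispace" and L0 where "representation D V0 L0"
    by (rule that[OF trivial_representation[of D "\<lambda>_. 0", OF pos]])
  then have "op_norm V0 (L0 a) \<in> R a" for a
    unfolding R_def by (intro CollectI exI[of _ V0] exI[of _ L0] conjI refl)
  then have ne: "R a \<noteq> {}" for a by blast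
  have bdd: "bdd_above (R a)" if "a \<in> carr D" for a
  proof (rule bdd_aboveI)
    fix r assume "r \<in> R a"
    then obtain V :: "('a \<Rightarrow> complex) ispace" and L where "representation D V L" "r = op_norm V (L a)"
      by (auto simp: R_def)
    then show "r \<le> \<parallel>a\<parallel>\<^bsub>D\<^esub>" using representationD(3) that by metis
  qed
  have upper: "op_norm V (L a) \<le> universal_norm D a" if "a \<in> carr D" "representation D V L"
    for a L and V :: "('a \<Rightarrow> complex) ispace"
    unfolding R by (rule cSup_upper[OF _ bdd[OF that(1)]]) (use that(2) in \<open>auto simp: R_def\<close>)
  have triangle: "universal_norm D (a \<oplus>\<^bsub>D\<^esub> b) \<le> universal_norm D a + universal_norm D b"
    if a: "a \<in> carr D" and b: "b \<in> carr D" for a b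
    unfolding R[of "a \<oplus>\<^bsub>D\<^esub> b"]
  proof (rule cSup_least[OF ne])
    fix r assume "r \<in> R (a \<oplus>\<^bsub>D\<^esub> b)"
    then obtain V :: "('a \<Rightarrow> complex) ispace" and L where L: "representation D V L" "r = op_norm V (L (a \<oplus>\<^bsub>D\<^esub> b))"
      by (auto simp: R_def)
    note Rd = representationD[OF L(1)]
    interpret V: hilbert_space V by (rule Rd(1))
    have "r \<le> op_norm V (L a) + op_norm V (L b)"
      unfolding L(2)
    proof (rule V.op_norm_le)
      fix x assume x: "x \<in> carr V"
      have "\<parallel>L (a \<oplus>\<^bsub>D\<^esub> b) x\<parallel>\<^bsub>V\<^esub> \<le> \<parallel>L a x\<parallel>\<^bsub>V\<^esub> + \<parallel>L b x\<parallel>\<^bsub>V\<^esub>"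
        using V.norm_triangle[OF Rd(8)[OF a x] Rd(8)[OF b x]] Rd(4)[OF a b x] by simp
      also have "\<dots> \<le> op_norm V (L a) * \<parallel>x\<parallel>\<^bsub>V\<^esub> + op_norm V (L b) * \<parallel>x\<parallel>\<^bsub>V\<^esub>"
        by (intro add_mono V.op_norm_bound Rd(2) a b x)
      finally show "\<parallel>L (a \<oplus>\<^bsub>D\<^esub> b) x\<parallel>\<^bsub>V\<^esub> \<le> (op_norm V (L a) + op_norm V (L b)) * \<parallel>x\<parallel>\<^bsub>V\<^esub>"
        by (simp add: distrib_right)
    qed (intro add_nonneg_nonneg V.op_norm_nonneg Rd(2) a b)
    then show "r \<le> universal_norm D a + universal_norm D b" using upper[OF a L(1)] upper[OF b L(1)] by simp
  qed
  have scale: "universal_norm D (c \<odot>\<^bsub>D\<^esub> a) \<le> cmod c * universal_norm D a" if a: "a \<in> carr D" for a c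
    unfolding R[of "c \<odot>\<^bsub>D\<^esub> a"]
  proof (rule cSup_least[OF ne])
    fix r assume "r \<in> R (c \<odot>\<^bsub>D\<^esub> a)"
    then obtain V :: "('a \<Rightarrow> complex) ispace" and L where L: "representation D V L" "r = op_norm V (L (c \<odot>\<^bsub>D\<^esub> a))"
      by (auto simp: R_def)
    note Rd = representationD[OF L(1)]
    interpret V: hilbert_space V by (rule Rd(1))
    have "r \<le> cmod c * op_norm V (L a)"
      unfolding L(2)
    proof (rule V.op_norm_le)
      fix x assume x: "x \<in> carr V"
      have "\<parallel>L (c \<odot>\<^bsub>D\<^esub> a) x\<parallel>\<^bsub>V\<^esub> = cmod c * \<parallel>L a x\<parallel>\<^bsub>V\<^esub>"
        using V.norm_scale[OF Rd(8)[OF a x]] Rd(6)[OF a x] by simp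
      also have "\<dots> \<le> cmod c * (op_norm V (L a) * \<parallel>x\<parallel>\<^bsub>V\<^esub>)"
        by (intro mult_left_mono V.op_norm_bound Rd(2) a x) simp
      finally show "\<parallel>L (c \<odot>\<^bsub>D\<^esub> a) x\<parallel>\<^bsub>V\<^esub> \<le> cmod c * op_norm V (L a) * \<parallel>x\<parallel>\<^bsub>V\<^esub>"
        by (simp add: mult.assoc)
    qed (intro mult_nonneg_nonneg norm_ge_zero V.op_norm_nonneg Rd(2) a)
    also have "\<dots> \<le> cmod c * universal_norm D a"
      by (intro mult_left_mono upper a L(1)) simp
    finally show "r \<le> cmod c * universal_norm D a" .
  qed
  show ?thesis
    by unfold_locales
      (auto simp: universal_alg_def D.add_ac D.scale_add_left D.scale_add_right triangle scale)
qed

context usc_banach_bundle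
begin

lemma continuous_on_zero_section: "continuous_on X (bzero B)"
proof -
  have "(bzero B \<longlongrightarrow> bzero B x) (nhds x)" for x
    by (rule econt_imp_tendsto) (auto intro: econt_zero)
  then have "continuous_on UNIV (bzero B)"
    by (simp add: continuous_on_def tendsto_at_iff_tendsto_nhds)
  then show ?thesis by (rule continuous_on_subset) simp
qed

end

context lc_banach_bundle
begin

lemma convolution_alg_simps [simp]:
  "carr (convolution_alg G B H \<nu>) = {f \<in> continuous_sections B H. \<exists>K. compact K \<and> K \<subseteq> H \<and> (\<forall>x\<in>H - K. f x = bzero B x)}"
  "\<zero>\<^bsub>convolution_alg G B H \<nu>\<^esub> = (\<lambda>x\<in>H. bzero B x)"
  "f \<oplus>\<^bsub>convolution_alg G B H \<nu>\<^esub> g = (\<lambda>x\<in>H. badd B (f x) (g x))"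
  "c \<odot>\<^bsub>convolution_alg G B H \<nu>\<^esub> f = (\<lambda>x\<in>H. bscale B c (f x))"
  by (simp_all add: convolution_alg_def)

lemma convolution_complex_space: "complex_space (convolution_alg G B H \<nu>)"
proof -
  have ax: "complex_space (fibre B x)" for x using fibre_banach[of x] by (simp add: banach_space_def)
  have ext: "f = g" if "f \<in> extensional H" "g \<in> extensional H" "\<And>x. x \<in> H \<Longrightarrow> f x = g x" for f g :: "'g \<Rightarrow> 'b"
    using that by (rule extensionalityI)
  show ?thesis
  proof
    show "\<zero>\<^bsub>convolution_alg G B H \<nu>\<^esub> \<in> carr (convolution_alg G B H \<nu>)"
      using continuous_on_zero_section[of H] by (auto simp: continuous_sections_def intro!: exI[of _ "{}"])
  next
    fix f g assume f: "f \<in> carr (convolution_alg G B H \<nu>)" and g: "g \<in> carr (convolution_alg G B H \<nu>)"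
    obtain K K' where K: "compact K" "K \<subseteq> H" "\<And>x. x \<in> H - K \<Longrightarrow> f x = bzero B x"
      "compact K'" "K' \<subseteq> H" "\<And>x. x \<in> H - K' \<Longrightarrow> g x = bzero B x" using f g by auto
    have "\<exists>K. compact K \<and> K \<subseteq> H \<and> (\<forall>x\<in>H - K. badd B (f x) (g x) = bzero B x)"
      by (rule exI[of _ "K \<union> K'"]) (use K in \<open>auto simp: badd_zero\<close>)
    then show "f \<oplus>\<^bsub>convolution_alg G B H \<nu>\<^esub> g \<in> carr (convolution_alg G B H \<nu>)"
      using f g continuous_on_badd[of H f g] by (auto simp: continuous_sections_def)
    show "f \<oplus>\<^bsub>convolution_alg G B H \<nu>\<^esub> g = g \<oplus>\<^bsub>convolution_alg G B H \<nu>\<^esub> f"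
      by (rule ext) (use f g complex_space.add_commute[OF ax] in \<open>auto simp: continuous_sections_def\<close>)
    show "c \<odot>\<^bsub>convolution_alg G B H \<nu>\<^esub> (f \<oplus>\<^bsub>convolution_alg G B H \<nu>\<^esub> g)
        = c \<odot>\<^bsub>convolution_alg G B H \<nu>\<^esub> f \<oplus>\<^bsub>convolution_alg G B H \<nu>\<^esub> c \<odot>\<^bsub>convolution_alg G B H \<nu>\<^esub> g" for c
      by (rule ext) (use f g complex_space.scale_add_right[OF ax] in \<open>auto simp: continuous_sections_def\<close>)
    fix h assume h: "h \<in> carr (convolution_alg G B H \<nu>)"
    show "f \<oplus>\<^bsub>convolution_alg G B H \<nu>\<^esub> g \<oplus>\<^bsub>convolution_alg G B H \<nu>\<^esub> h
        = f \<oplus>\<^bsub>convolution_alg G B H \<nu>\<^esub> (g \<oplus>\<^bsub>convolution_alg G B H \<nu>\<^esub> h)"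
      by (rule ext) (use f g h complex_space.add_assoc[OF ax] in \<open>auto simp: continuous_sections_def\<close>)
  next
    fix f c d assume f: "f \<in> carr (convolution_alg G B H \<nu>)"
    obtain K where K: "compact K" "K \<subseteq> H" "\<And>x. x \<in> H - K \<Longrightarrow> f x = bzero B x" using f by auto
    have "\<exists>K. compact K \<and> K \<subseteq> H \<and> (\<forall>x\<in>H - K. bscale B c (f x) = bzero B x)"
      by (rule exI[of _ K]) (use K in auto)
    then show "c \<odot>\<^bsub>convolution_alg G B H \<nu>\<^esub> f \<in> carr (convolution_alg G B H \<nu>)"
      using f continuous_on_bscale[of H f c] by (auto simp: continuous_sections_def)
    show "\<zero>\<^bsub>convolution_alg G B H \<nu>\<^esub> \<oplus>\<^bsub>convolution_alg G B H \<nu>\<^esub> f = f"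
      by (rule ext) (use f in \<open>auto simp: continuous_sections_def badd_zero\<close>)
    show "0 \<odot>\<^bsub>convolution_alg G B H \<nu>\<^esub> f = \<zero>\<^bsub>convolution_alg G B H \<nu>\<^esub>"
      by (rule ext) (use f in \<open>auto simp: continuous_sections_def bscale_zero\<close>)
    show "1 \<odot>\<^bsub>convolution_alg G B H \<nu>\<^esub> f = f"
      by (rule ext) (use f in \<open>auto simp: continuous_sections_def\<close>)
    show "c \<odot>\<^bsub>convolution_alg G B H \<nu>\<^esub> d \<odot>\<^bsub>convolution_alg G B H \<nu>\<^esub> f = (c * d) \<odot>\<^bsub>convolution_alg G B H \<nu>\<^esub> f"
      by (rule ext) (use f in \<open>auto simp: continuous_sections_def\<close>)
    show "(c + d) \<odot>\<^bsub>convolution_alg G B H \<nu>\<^esub> f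
        = c \<odot>\<^bsub>convolution_alg G B H \<nu>\<^esub> f \<oplus>\<^bsub>convolution_alg G B H \<nu>\<^esub> d \<odot>\<^bsub>convolution_alg G B H \<nu>\<^esub> f"
      by (rule ext) (use f in \<open>auto simp: continuous_sections_def bscale_add\<close>)
  qed
qed

lemma convolution_seminormed: "seminormed_space (universal_alg (convolution_alg G B H \<nu>))"
proof (rule universal_seminormed[OF convolution_complex_space])
  fix f
  have "0 \<le> (\<integral>x. bnorm B (f x) \<partial>\<nu>)" by (rule Bochner_Integration.integral_nonneg) simp
  then show "0 \<le> \<parallel>f\<parallel>\<^bsub>convolution_alg G B H \<nu>\<^esub>" by (simp add: convolution_alg_def le_max_iff_disj)
qed

text \<open>
  The integrated form maps W into the double orthogonal complement of W, since the integrand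
  pairs to zero with any vector orthogonal to W.
\<close>

lemma integrated_form_invariant:
  assumes L: "representation (group_cstar G B H \<nu>) V L" and int: "integrated_form G B H \<nu> \<Delta> V \<pi> L"
    and sp: "space \<nu> = H" and W: "closed_subspace V W"
    and inv: "\<And>b x. \<lbrakk>proj B b \<in> H; x \<in> W\<rbrakk> \<Longrightarrow> \<pi> b x \<in> W"
  shows "invariant_subspace (group_cstar G B H \<nu>) V L W"
proof -
  define D where "D = convolution_alg G B H \<nu>"
  interpret X: seminormed_space "universal_alg D" unfolding D_def by (rule convolution_seminormed)
  have L': "representation (completion (universal_alg D)) V L"
    using L by (simp add: group_cstar_def enveloping_cstar_def D_def)
  interpret V: hilbert_space V by (rule representationD(1)[OF L'])
  have WV: "w \<in> W \<Longrightarrow> w \<in> carr V" for w using W by (auto simp: closed_subspace_def)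
  have "invariant_subspace (completion (universal_alg D)) V L W"
  proof (rule X.invariant_subspace_completionI[OF L' W])
    fix f x assume f: "f \<in> carr (universal_alg D)" and x: "x \<in> W"
    have fD: "f \<in> carr D" using f by (simp add: universal_alg_def)
    have pf: "proj B (f s) = s" if "s \<in> H" for s using fD that by (simp add: D_def continuous_sections_def)
    show "L (cauchy_class (universal_alg D) (\<lambda>n. f)) x \<in> W"
    proof (rule V.in_closed_subspace_if_orthogonal[OF W])
      show "L (cauchy_class (universal_alg D) (\<lambda>n. f)) x \<in> carr V"
        using representationD(8)[OF L'] X.completion_closed X.cauchy_const f WV x by blast
      fix y assume y: "y \<in> carr V" "\<And>w. w \<in> W \<Longrightarrow> vinner V w y = 0"
      have "has_bochner_integral \<nu> (\<lambda>s. vinner V (\<pi> (f s) x) y * complex_of_real (\<Delta> s powr (- 1 / 2)))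
          (vinner V (L (envelope_embed D f) x) y)"
        using int fD x WV y(1) unfolding integrated_form_def D_def by blast
      moreover have "has_bochner_integral \<nu> (\<lambda>s. vinner V (\<pi> (f s) x) y * complex_of_real (\<Delta> s powr (- 1 / 2))) 0
        \<longleftrightarrow> has_bochner_integral \<nu> (\<lambda>s. 0 :: complex) 0"
        by (rule has_bochner_integral_cong) (use y(2) inv x pf sp in auto)
      ultimately show "vinner V (L (cauchy_class (universal_alg D) (\<lambda>n. f)) x) y = 0"
        using has_bochner_integral_eq has_bochner_integral_zero unfolding envelope_embed_def by blast
    qed
  qed
  then show ?thesis by (simp add: group_cstar_def enveloping_cstar_def D_def)
qed

end

section \<open>Locally closed points of the primitive ideal space\<close>

text \<open>
  For irreducible L, the vectors killed by an ideal form an invariant subspace, which is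
  zero unless L kills the ideal; so a nonzero vector can be moved by the ideals in turn.
\<close>

lemma irreducible_rep_prime:
  assumes L: "irreducible_rep A V L" and fin: "finite \<I>"
    and I: "\<And>I. I \<in> \<I> \<Longrightarrow> closed_ideal A I" "\<And>I. I \<in> \<I> \<Longrightarrow> \<not> I \<subseteq> rep_kernel A V L"
  obtains g where "g \<in> carr A" "g \<notin> rep_kernel A V L" "\<And>I. I \<in> \<I> \<Longrightarrow> g \<in> I"
proof -
  have rep: "representation A V L" and irr: "\<And>W. invariant_subspace A V L W \<Longrightarrow> W = {\<zero>\<^bsub>V\<^esub>} \<or> W = carr V"
    and ne: "rep_kernel A V L \<noteq> carr A"
    using L by (auto simp: irreducible_rep_def)
  note R = representationD[OF rep]
  interpret V: hilbert_space V by (rule R(1))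
  obtain g0 w where w: "g0 \<in> carr A" "w \<in> carr V" "L g0 w \<noteq> \<zero>\<^bsub>V\<^esub>"
    using ne by (auto simp: kernel_on_def)
  have "\<exists>g\<in>carr A. L g w \<noteq> \<zero>\<^bsub>V\<^esub> \<and> (\<forall>I\<in>\<I>. g \<in> I)" using fin I
  proof (induction \<I>)
    case empty
    then show ?case using w by blast
  next
    case (insert J \<I>)
    then obtain g where g: "g \<in> carr A" "L g w \<noteq> \<zero>\<^bsub>V\<^esub>" "\<And>I. I \<in> \<I> \<Longrightarrow> g \<in> I" by auto
    have J: "closed_ideal A J" "\<not> J \<subseteq> rep_kernel A V L" using insert.prems by auto
    have JA: "f \<in> carr A" if "f \<in> J" for f using J(1) that by (auto simp: closed_ideal_def closed_subspace_def)
    have ideal: "f \<otimes>\<^bsub>A\<^esub> a \<in> J" if "f \<in> J" "a \<in> carr A" for f a using J(1) that by (auto simp: closed_ideal_def)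
    define W where "W = {v \<in> carr V. \<forall>f\<in>J. L f v = \<zero>\<^bsub>V\<^esub>}"
    have "closed_subspace V W"
      unfolding W_def by (rule V.closed_subspace_annihilator) (use R(2) JA in blast)
    moreover have "L a v \<in> W" if "a \<in> carr A" "v \<in> W" for a v
    proof -
      have v: "v \<in> carr V" "\<And>f. f \<in> J \<Longrightarrow> L f v = \<zero>\<^bsub>V\<^esub>" using that(2) by (auto simp: W_def)
      have "L f (L a v) = \<zero>\<^bsub>V\<^esub>" if f: "f \<in> J" for f
        using R(5)[OF JA[OF f] \<open>a \<in> carr A\<close> v(1)] v(2)[OF ideal[OF f \<open>a \<in> carr A\<close>]] by simp
      then show ?thesis using R(8)[OF that(1) v(1)] by (simp add: W_def)
    qed
    ultimately have "invariant_subspace A V L W" by (simp add: invariant_subspace_def)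
    moreover have "W \<noteq> carr V" using J(2) JA by (auto simp: W_def kernel_on_def)
    ultimately have "W = {\<zero>\<^bsub>V\<^esub>}" using irr by blast
    then have "L g w \<notin> W" using g(2) by blast
    then obtain f where f: "f \<in> J" "L f (L g w) \<noteq> \<zero>\<^bsub>V\<^esub>" using R(8)[OF g(1) w(2)] by (auto simp: W_def)
    have "f \<otimes>\<^bsub>A\<^esub> g \<in> I" if "I \<in> insert J \<I>" for I
      using that ideal[OF f(1) g(1)] g(3)[of I] insert.prems(1)[of I] JA[OF f(1)] by (auto simp: closed_ideal_def)
    moreover have "L (f \<otimes>\<^bsub>A\<^esub> g) w \<noteq> \<zero>\<^bsub>V\<^esub>" using R(5)[OF JA[OF f(1)] g(1) w(2)] f(2) by simp
    moreover have "f \<otimes>\<^bsub>A\<^esub> g \<in> carr A" using ideal[OF f(1) g(1)] JA by blast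
    ultimately show ?case by blast
  qed
  then show thesis using that w(2) by (auto simp: kernel_on_def)
qed

text \<open>
  Finite intersections of generating sets form a base, where the empty intersection stands for the
  whole type.
\<close>

lemma generate_topology_on_basic:
  assumes "generate_topology_on \<S> U" "x \<in> U"
  shows "\<exists>F. finite F \<and> F \<subseteq> \<S> \<and> (\<forall>s\<in>F. x \<in> s) \<and> (\<forall>y. (\<forall>s\<in>F. y \<in> s) \<longrightarrow> y \<in> U)"
  using assms
proof (induction rule: generate_topology_on.induct)
  case (Int a b)
  obtain F where F: "finite F" "F \<subseteq> \<S>" "\<forall>s\<in>F. x \<in> s" "\<forall>y. (\<forall>s\<in>F. y \<in> s) \<longrightarrow> y \<in> a"
    using Int.IH(1) Int.prems by auto
  obtain F' where F': "finite F'" "F' \<subseteq> \<S>" "\<forall>s\<in>F'. x \<in> s" "\<forall>y. (\<forall>s\<in>F'. y \<in> s) \<longrightarrow> y \<in> b"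
    using Int.IH(2) Int.prems by auto
  have "\<forall>y. (\<forall>s\<in>F \<union> F'. y \<in> s) \<longrightarrow> y \<in> a \<inter> b" using F(4) F'(4) by simp
  then show ?case using F(1-3) F'(1-3) by (intro exI[of _ "F \<union> F'"]) auto
next
  case (UN K)
  then obtain k where k: "k \<in> K" "x \<in> k" by auto
  obtain F where F: "finite F" "F \<subseteq> \<S>" "\<forall>s\<in>F. x \<in> s" "\<forall>y. (\<forall>s\<in>F. y \<in> s) \<longrightarrow> y \<in> k"
    using UN.IH[OF k] by (elim exE conjE)
  have "\<forall>y. (\<forall>s\<in>F. y \<in> s) \<longrightarrow> y \<in> \<Union>K" using F(4) k(1) by (meson UnionI)
  then show ?case using F(1-3) by (intro exI[of _ F]) simp
next
  case (Basis s)
  then show ?case by (intro exI[of _ "{s}"]) auto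
qed auto

text \<open>
  The closure of a primitive ideal P consists of the primitive ideals containing it. That P is open
  in its closure is witnessed by finitely many ideals not contained in P, such that every primitive
  ideal strictly above P contains one of them; as P is prime, one element outside P lies in all of
  these ideals.
\<close>

lemma locally_closed_witness:
  assumes P: "P \<in> Prim A" and lc: "locally_closed_point (hull_kernel A) P"
  obtains g where "g \<in> carr A" "g \<notin> P" "\<And>Q. \<lbrakk>Q \<in> Prim A; P \<subseteq> Q; P \<noteq> Q\<rbrakk> \<Longrightarrow> g \<in> Q"
proof -
  define U where "U I = {Q \<in> Prim A. \<not> I \<subseteq> Q}" for I
  define \<S> where "\<S> = {U I | I. closed_ideal A I}"
  define T where "T = hull_kernel A"
  have T: "T = topology_generated_by \<S>" by (simp add: T_def hull_kernel_def \<S>_def U_def)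
  obtain O' where O': "openin T O'" "{P} = O' \<inter> T closure_of {P}"
    using lc unfolding locally_closed_point_def openin_subtopology T_def by blast
  have "generate_topology_on \<S> O'" using O'(1) unfolding T openin_topology_generated_by_iff .
  then obtain F where F: "finite F" "F \<subseteq> \<S>" "\<And>s. s \<in> F \<Longrightarrow> P \<in> s" "\<And>y. (\<forall>s\<in>F. y \<in> s) \<Longrightarrow> y \<in> O'"
  proof -
    have "P \<in> O'" using O'(2) by blast
    from generate_topology_on_basic[OF \<open>generate_topology_on \<S> O'\<close> this] show thesis
      using that by (elim exE conjE) blast
  qed
  have "F \<subseteq> U ` {I. closed_ideal A I}" using F(2) by (auto simp: \<S>_def)
  then obtain \<I> where \<I>: "\<I> \<subseteq> {I. closed_ideal A I}" "finite \<I>" "F = U ` \<I>"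
    using finite_subset_image[OF F(1)] by metis
  obtain V :: "('a \<Rightarrow> complex) ispace" and L where L: "irreducible_rep A V L" "P = rep_kernel A V L"
    using P by (auto simp: Prim_def)
  have "\<not> I \<subseteq> rep_kernel A V L" if "I \<in> \<I>" for I
    using F(3)[of "U I"] that \<I>(3) L(2) by (auto simp: U_def)
  then obtain g where g: "g \<in> carr A" "g \<notin> rep_kernel A V L" "\<And>I. I \<in> \<I> \<Longrightarrow> g \<in> I"
    using irreducible_rep_prime[OF L(1) \<I>(2)] \<I>(1) by blast
  have "g \<in> Q" if Q: "Q \<in> Prim A" "P \<subseteq> Q" "P \<noteq> Q" for Q
  proof (rule ccontr)
    assume "g \<notin> Q"
    then have "Q \<in> U I" if "I \<in> \<I>" for I using g(3)[OF that] Q(1) by (auto simp: U_def)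
    then have QO: "Q \<in> O'" using F(4)[of Q] \<I>(3) by blast
    moreover have "Q \<in> T closure_of {P}"
      unfolding in_closure_of
    proof (intro conjI allI impI)
      show "Q \<in> topspace T" using QO openin_subset[OF O'(1)] by blast
      fix S assume S: "Q \<in> S \<and> openin T S"
      then have "generate_topology_on \<S> S" unfolding T openin_topology_generated_by_iff by blast
      then obtain F' where F': "F' \<subseteq> \<S>" "\<And>s. s \<in> F' \<Longrightarrow> Q \<in> s" "\<And>y. (\<forall>s\<in>F'. y \<in> s) \<Longrightarrow> y \<in> S"
      proof -
        from generate_topology_on_basic[OF \<open>generate_topology_on \<S> S\<close> conjunct1[OF S]] show thesis
          using that by (elim exE conjE) blast
      qed
      have "P \<in> s" if s: "s \<in> F'" for s
      proof -
        obtain I where "s = U I" using s F'(1) by (auto simp: \<S>_def)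
        then show ?thesis using F'(2)[OF s] Q(2) P by (auto simp: U_def)
      qed
      then show "\<exists>y. y \<in> {P} \<and> y \<in> S" using F'(3) by blast
    qed
    ultimately have "Q \<in> {P}" using O'(2) by blast
    then show False using Q(3) by blast
  qed
  then show thesis using that g L(2) by blast
qed

section \<open>The section algebra over the unit space\<close>

sublocale fell_bundle \<subseteq> lc_banach_bundle B
  by unfold_locales (rule locally_compact)

context fell_bundle
begin

lemma closed_units: "closed (units G)"
proof -
  have "continuous_on UNIV (\<lambda>x. (\<lambda>(x, y). gmul G x y) (x, ginv G x))"
    by (rule continuous_on_compose2[OF continuous_mul])
      (auto intro!: continuous_on_Pair continuous_inv continuous_on_id simp: rng_inv)
  then have "continuous_on UNIV (rng G)" by (simp add: mul_inv)
  then have "closed {x. rng G x = x}" by (intro closed_Collect_eq continuous_on_id)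
  moreover have "{x. rng G x = x} = units G" by (auto simp: units_def rng_rng) (metis rangeI)
  ultimately show ?thesis by simp
qed

lemma unit_alg_simps [simp]:
  "carr (section_alg B X) = {f \<in> continuous_sections B X.
     \<forall>e>0. \<exists>K. compact K \<and> K \<subseteq> X \<and> (\<forall>x\<in>X - K. bnorm B (f x) < e)}"
  "vadd (section_alg B X) f g = (\<lambda>x\<in>X. badd B (f x) (g x))"
  "vscale (section_alg B X) c f = (\<lambda>x\<in>X. bscale B c (f x))"
  "amult (section_alg B X) f g = (\<lambda>x\<in>X. bmul B (f x) (g x))"
  "astar (section_alg B X) f = (\<lambda>x\<in>X. bstar B (f x))"
  by (simp_all add: section_alg_def)

lemma section_through:
  assumes u: "u \<in> units G" and b: "proj B b = u"
  obtains f where "f \<in> carr (unit_alg G B)" "f u = b"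
proof -
  obtain f where f: "\<And>x. proj B (f x) = x" "continuous_on UNIV f" "f (proj B b) = b"
    "\<exists>K. compact K \<and> (\<forall>x. x \<notin> K \<longrightarrow> f x = bzero B x)" using enough_sections[of b] by metis
  obtain K where K: "compact K" "\<And>x. x \<notin> K \<Longrightarrow> f x = bzero B x" using f(4) by blast
  define h where "h = restrict f (units G)"
  have "continuous_on (units G) h"
    unfolding h_def by (simp add: continuous_on_subset[OF f(2)])
  moreover have "\<exists>K. compact K \<and> K \<subseteq> units G \<and> (\<forall>x\<in>units G - K. bnorm B (h x) < e)" if "e > 0" for e
    by (rule exI[of _ "units G \<inter> K"])
      (use K that closed_Int_compact[OF closed_units K(1)] in \<open>auto simp: h_def\<close>)
  ultimately have "h \<in> carr (unit_alg G B)" using f(1) by (auto simp: continuous_sections_def h_def)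
  moreover have "h u = b" using f(3) u b by (simp add: h_def)
  ultimately show thesis using that by blast
qed

lemma section_norm:
  assumes f: "f \<in> carr (section_alg B X)" and u: "u \<in> X"
  shows "bnorm B (f u) \<le> \<parallel>f\<parallel>\<^bsub>section_alg B X\<^esub>"
proof -
  obtain K where K: "compact K" "K \<subseteq> X" "\<And>x. x \<in> X - K \<Longrightarrow> bnorm B (f x) < 1" using f by (auto dest: spec[of _ 1])
  have "continuous_on K f" using f K(2) by (auto simp: continuous_sections_def intro: continuous_on_subset)
  then have "compact (f ` K)" using K(1) by (rule compact_continuous_image)
  moreover have "f ` K \<subseteq> (\<Union>n\<in>(UNIV::nat set). {b. bnorm B b < real n})" using reals_Archimedean2 by blast
  ultimately obtain N where N: "finite N" "f ` K \<subseteq> (\<Union>n\<in>N. {b. bnorm B b < real n})"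
    using compactE_image[of "f ` K" UNIV "\<lambda>n. {b. bnorm B b < real n}"] norm_usc by metis
  have "bnorm B (f x) \<le> 1 + (\<Sum>n\<in>N. real n)" if x: "x \<in> X" for x
  proof (cases "x \<in> K")
    case True
    then obtain n where n: "n \<in> N" "bnorm B (f x) < real n" using N(2) by auto
    then have "real n \<le> (\<Sum>n\<in>N. real n)" using N(1) by (intro member_le_sum) auto
    then show ?thesis using n by simp
  next
    case False
    have "0 \<le> (\<Sum>n\<in>N. real n)" by (simp add: sum_nonneg)
    then show ?thesis using K(3)[of x] x False by simp
  qed
  then have "bdd_above ((\<lambda>x. bnorm B (f x)) ` X)" by (rule bdd_aboveI2)
  from cSUP_upper[OF u this] show ?thesis by (simp add: section_alg_def)
qed

text \<open>
  As evaluation at u is onto, an irreducible representation of the fibre over u is irreducible for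
  the section algebra.
\<close>

lemma irreducible_rep_eval:
  assumes u: "u \<in> units G" and \<rho>: "irreducible_rep (fibre B u) V \<rho>"
  shows "irreducible_rep (unit_alg G B) V (\<lambda>f. \<rho> (f u))"
    and "rep_kernel (unit_alg G B) V (\<lambda>f. \<rho> (f u)) = from_fibre G B u (rep_kernel (fibre B u) V \<rho>)"
proof -
  have rep: "representation (fibre B u) V \<rho>" using \<rho> by (simp add: irreducible_rep_def)
  note R = representationD[OF rep, simplified]
  have fu: "proj B (f u) = u" if "f \<in> carr (unit_alg G B)" for f
    using that u by (simp add: continuous_sections_def)
  have "representation (unit_alg G B) V (\<lambda>f. \<rho> (f u))"
    unfolding representation_def
  proof (intro conjI ballI allI)
    fix f assume f: "f \<in> carr (unit_alg G B)"
    show "op_norm V (\<rho> (f u)) \<le> \<parallel>f\<parallel>\<^bsub>unit_alg G B\<^esub>"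
      using R(3)[OF fu[OF f]] section_norm[OF f u] by simp
  qed (use R fu u in \<open>simp_all del: unit_alg_simps(1)\<close>)
  moreover show kernel: "rep_kernel (unit_alg G B) V (\<lambda>f. \<rho> (f u)) = from_fibre G B u (rep_kernel (fibre B u) V \<rho>)"
    using fu by (auto simp: kernel_on_def from_fibre_def simp del: unit_alg_simps(1))
  moreover have "from_fibre G B u (rep_kernel (fibre B u) V \<rho>) \<noteq> carr (unit_alg G B)"
  proof -
    have "rep_kernel (fibre B u) V \<rho> \<noteq> carr (fibre B u)" using \<rho> by (simp add: irreducible_rep_def)
    then obtain b where b: "proj B b = u" "b \<notin> rep_kernel (fibre B u) V \<rho>" by (auto simp: kernel_on_def)
    obtain f where "f \<in> carr (unit_alg G B)" "f u = b" using section_through[OF u b(1)] by blast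
    then show ?thesis using b(2) by (auto simp: from_fibre_def simp del: unit_alg_simps(1))
  qed
  moreover have "W = {\<zero>\<^bsub>V\<^esub>} \<or> W = carr V" if W: "invariant_subspace (unit_alg G B) V (\<lambda>f. \<rho> (f u)) W" for W
  proof -
    have "\<rho> b x \<in> W" if b: "proj B b = u" and x: "x \<in> W" for b x
    proof -
      obtain f where "f \<in> carr (unit_alg G B)" "f u = b" using section_through[OF u b] by blast
      then show ?thesis using W x unfolding invariant_subspace_def by blast
    qed
    then have "invariant_subspace (fibre B u) V \<rho> W" using W by (simp add: invariant_subspace_def)
    then show ?thesis using \<rho> by (simp add: irreducible_rep_def)
  qed
  ultimately show "irreducible_rep (unit_alg G B) V (\<lambda>f. \<rho> (f u))"
    by (simp add: irreducible_rep_def del: unit_alg_simps(1))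
qed

text \<open>
  Otherwise some irreducible representation of the fibre kills the kernel on W but not \<open>g u\<close>, and
  defines a primitive ideal strictly above P that does not contain g.
\<close>

lemma kernel_contains_witness:
  assumes u: "u \<in> units G" and L: "representation (fibre B u) V \<pi>"
    and W: "invariant_subspace (fibre B u) V \<pi> W"
    and P: "P = from_fibre G B u (rep_kernel (fibre B u) V \<pi>)"
    and g: "g \<in> carr (unit_alg G B)" "\<And>Q. \<lbrakk>Q \<in> Prim (unit_alg G B); P \<subseteq> Q; P \<noteq> Q\<rbrakk> \<Longrightarrow> g \<in> Q"
    and neq: "kernel_on (fibre B u) V \<pi> W \<noteq> rep_kernel (fibre B u) V \<pi>"
  shows "g u \<in> kernel_on (fibre B u) V \<pi> W"
proof (rule ccontr)
  assume j: "g u \<notin> kernel_on (fibre B u) V \<pi> W"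
  interpret C: cstar_algebra "fibre B u" by (rule unit_fibre_cstar[OF u])
  have gu: "g u \<in> carr (fibre B u)" using g(1) u by (simp add: continuous_sections_def)
  have q: "carr (fibre B u) \<subseteq> range (\<lambda>e :: 'g \<Rightarrow> 'b. e u)" by (auto intro: image_eqI[where x = "\<lambda>_. _"])
  obtain H :: "(('g \<Rightarrow> 'b) \<Rightarrow> complex) ispace" and \<rho> where H: "irreducible_rep (fibre B u) H \<rho>"
    "kernel_on (fibre B u) V \<pi> W \<subseteq> rep_kernel (fibre B u) H \<rho>" "g u \<notin> rep_kernel (fibre B u) H \<rho>"
    using C.irreducible_rep_separating[OF q L W gu j] by blast
  define Q where "Q = from_fibre G B u (rep_kernel (fibre B u) H \<rho>)"
  have "Q \<in> Prim (unit_alg G B)"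
    unfolding Prim_def using irreducible_rep_eval[OF u H(1)] Q_def by (metis (mono_tags, lifting) mem_Collect_eq)
  moreover have sub: "rep_kernel (fibre B u) V \<pi> \<subseteq> kernel_on (fibre B u) V \<pi> W"
    using W by (auto simp: kernel_on_def invariant_subspace_def closed_subspace_def)
  then have "P \<subseteq> Q" using H(2) unfolding P Q_def from_fibre_def by blast
  moreover have "P \<noteq> Q"
  proof -
    obtain k where k: "k \<in> kernel_on (fibre B u) V \<pi> W" "k \<notin> rep_kernel (fibre B u) V \<pi>" using sub neq by blast
    have "proj B k = u" using k(1) by (simp add: kernel_on_def)
    then obtain f where f: "f \<in> carr (unit_alg G B)" "f u = k" using section_through[OF u] by blast
    then have "f \<in> Q" "f \<notin> P" using k H(2) unfolding P Q_def from_fibre_def by auto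
    then show ?thesis by blast
  qed
  ultimately have "g \<in> Q" using g(2) by blast
  then show False using H(3) by (simp add: Q_def from_fibre_def)
qed

end

section \<open>The stability group\<close>

context fell_bundle
begin

lemma unitD: "u \<in> units G \<Longrightarrow> rng G u = u" "u \<in> units G \<Longrightarrow> src G u = u"
  by (auto simp: units_def rng_rng src_rng)

end

locale isotropy_arrow = fell_bundle G B for G :: "'g::t2_space grpd"
    and B :: "('g, 'b::topological_space) banach_bundle" +
  fixes u x :: 'g
  assumes rng_x [simp]: "rng G x = u" and src_x [simp]: "src G x = u"
begin

lemma u_unit: "u \<in> units G"
  unfolding units_def using rng_x by blast

lemma u_simps [simp]: "rng G u = u" "src G u = u" "rng G (ginv G x) = u" "src G (ginv G x) = u"
  "gmul G u x = x" "gmul G x u = x" "gmul G u u = u" "gmul G x (ginv G x) = u" "gmul G (ginv G x) x = u"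
  "gmul G u (ginv G x) = ginv G x" "gmul G (ginv G x) u = ginv G x"
  using unitD[OF u_unit] rng_unit[of x] src_unit[of x] rng_unit[of u] mul_inv[of x] inv_mul[of x]
    rng_unit[of "ginv G x"] src_unit[of "ginv G x"]
  by (simp_all add: rng_inv src_inv)

lemma star_u [simp]: "ginv G u = u"
  using src_unit[of "ginv G u"] mul_inv[of u] rng_unit[of "ginv G u"] by (simp add: rng_inv src_inv)

sublocale C: cstar_algebra "fibre B u"
  by (rule unit_fibre_cstar[OF u_unit])

sublocale X: imprimitivity_bimodule "fibre B u" "fibre B u" "fibre B x"
    "bmul B" "bmul B" "\<lambda>a b. bmul B a (bstar B b)" "\<lambda>a b. bmul B (bstar B a) b"
  using saturated[of x] by simp

text \<open>
  In a Fell bundle the norm of each fibre is determined by the inner products, so that products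
  are estimated in the C*-algebra over u.
\<close>

lemma norm_act:
  assumes k: "proj B k = u" and c: "proj B c = x"
  shows "bnorm B (bmul B k c) \<le> bnorm B k * bnorm B c"
proof -
  define s where "s = bmul B c (bstar B c)"
  have s: "proj B s = u" using c by (simp add: s_def proj_mul proj_star)
  have "bmul B (bmul B k c) (bstar B (bmul B k c)) = bmul B (bmul B k s) (bstar B k)"
    using k c by (simp add: s_def bstar_mul bmul_assoc proj_mul proj_star)
  then have "(bnorm B (bmul B k c))\<^sup>2 = bnorm B (bmul B (bmul B k s) (bstar B k))"
    using X.lip_norm[of "bmul B k c"] k c by (simp add: proj_mul)
  also have "\<dots> \<le> (bnorm B k * bnorm B s) * bnorm B k"
    using C.norm_mult[of "bmul B k s" "bstar B k"] C.norm_mult[of k s] C.norm_star[of k] k s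
    by (simp add: proj_mul proj_star) (meson mult_right_mono bnorm_nonneg order_trans)
  also have "bnorm B s = (bnorm B c)\<^sup>2" using X.lip_norm[of c] c by (simp add: s_def)
  finally have "(bnorm B (bmul B k c))\<^sup>2 \<le> (bnorm B k * bnorm B c)\<^sup>2"
    by (simp add: power2_eq_square mult_ac)
  then show ?thesis by (rule power2_le_imp_le) simp
qed

text \<open>
  Writing \<open>z z\<^sup>*\<close> as \<open>c\<^sup>*c\<close> turns \<open>b\<^sup>*z z\<^sup>*b\<close> into the inner square of \<open>c b\<close>.
\<close>

lemma norm_ip:
  assumes b: "proj B b = x" and z: "proj B z = x"
  shows "bnorm B (bmul B (bstar B b) z) \<le> bnorm B b * bnorm B z"
proof -
  obtain c where c: "proj B c = u" "bmul B z (bstar B z) = bmul B (bstar B c) c"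
    using X.lip_positive[of z] z by (auto simp: positive_elt_def)
  define r where "r = bmul B (bstar B b) z"
  have r: "proj B r = u" using b z by (simp add: r_def proj_mul proj_star)
  have "bmul B r (bstar B r) = bmul B (bstar B b) (bmul B (bmul B z (bstar B z)) b)"
    using b z by (simp add: r_def bstar_mul bstar_bstar bmul_assoc proj_mul proj_star)
  also have "\<dots> = bmul B (bstar B (bmul B c b)) (bmul B c b)"
    unfolding c(2) using b c(1) by (simp add: bstar_mul bmul_assoc proj_mul proj_star)
  finally have "bnorm B (bmul B r (bstar B r)) = (bnorm B (bmul B c b))\<^sup>2"
    using X.rip_norm[of "bmul B c b"] b c(1) by (simp add: proj_mul)
  moreover have "bnorm B (bmul B r (bstar B r)) = (bnorm B r)\<^sup>2"
    using C.cstar_identity[of "bstar B r"] C.norm_star[of r] r by (simp add: bstar_bstar proj_star)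
  moreover have "bnorm B (bmul B c b) \<le> bnorm B c * bnorm B b" by (rule norm_act[OF c(1) b])
  then have "(bnorm B (bmul B c b))\<^sup>2 \<le> (bnorm B c * bnorm B b)\<^sup>2" by (rule power_mono) simp
  moreover have "(bnorm B c)\<^sup>2 = (bnorm B z)\<^sup>2"
    using C.cstar_identity[of c] X.lip_norm[of z] c z by simp
  ultimately have "(bnorm B r)\<^sup>2 \<le> (bnorm B b * bnorm B z)\<^sup>2" by (simp add: power_mult_distrib mult.commute)
  then show ?thesis unfolding r_def by (rule power2_le_imp_le) simp
qed

lemma bounded_op_compress:
  assumes b: "proj B b = x" and c: "proj B c = x"
  shows "bounded_op (fibre B u) (\<lambda>k. bmul B (bstar B b) (bmul B k c))"
proof (rule bounded_opI)
  fix k assume k: "k \<in> carr (fibre B u)"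
  show "bmul B (bstar B b) (bmul B k c) \<in> carr (fibre B u)" using b c k by (simp add: proj_mul proj_star)
  have "bnorm B (bmul B (bstar B b) (bmul B k c)) \<le> bnorm B b * bnorm B (bmul B k c)"
    using norm_ip[OF b, of "bmul B k c"] k c by (simp add: proj_mul)
  also have "\<dots> \<le> bnorm B b * (bnorm B k * bnorm B c)"
    using norm_act[of k c] k c by (intro mult_left_mono) auto
  finally show "\<parallel>bmul B (bstar B b) (bmul B k c)\<parallel>\<^bsub>fibre B u\<^esub> \<le> (bnorm B b * bnorm B c) * \<parallel>k\<parallel>\<^bsub>fibre B u\<^esub>"
    by (simp add: mult_ac)
  show "bmul B (bstar B b) (bmul B (z \<odot>\<^bsub>fibre B u\<^esub> k) c) = z \<odot>\<^bsub>fibre B u\<^esub> bmul B (bstar B b) (bmul B k c)" for z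
    using b c k by (simp add: bmul_scale_left bmul_scale_right proj_mul proj_star)
  fix l assume "l \<in> carr (fibre B u)"
  then show "bmul B (bstar B b) (bmul B (k \<oplus>\<^bsub>fibre B u\<^esub> l) c)
      = bmul B (bstar B b) (bmul B k c) \<oplus>\<^bsub>fibre B u\<^esub> bmul B (bstar B b) (bmul B l c)"
    using b c k by (simp add: bmul_add_left bmul_add_right proj_mul proj_star)
qed

end

text \<open>
  For an arrow x that fixes P, the ideal J of the fibre over u corresponds to P. The identity
  \<open>x \<cdot> P = P\<close> alone shows that P is determined by J and that J is a closed ideal.
\<close>

locale fixing_arrow = isotropy_arrow G B u x for G :: "'g::t2_space grpd"
    and B :: "('g, 'b::topological_space) banach_bundle" and u x +
  fixes P :: "('g \<Rightarrow> 'b) set"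
  assumes fixes_P: "prim_act G B x P = P"
begin

abbreviation J :: "'b set" where
  "J \<equiv> at_fibre u P"

definition gens :: "'b set" where
  "gens = {bmul B (bmul B b j) (bstar B c) | b j c. proj B b = x \<and> j \<in> J \<and> proj B c = x}"

lemma P_eq: "P = from_fibre G B u (closed_span (fibre B u) gens)"
  using fixes_P by (simp add: prim_act_def fibre_rieffel_def rieffel_ideal_def gens_def)

lemma P_mem: "f \<in> P \<longleftrightarrow> f \<in> carr (unit_alg G B) \<and> f u \<in> closed_span (fibre B u) gens"
  by (subst P_eq) (simp add: from_fibre_def)

lemma J_proj: "j \<in> J \<Longrightarrow> proj B j = u"
  using P_mem u_unit by (auto simp: at_fibre_def continuous_sections_def)

lemma gens_proj: "gens \<subseteq> carr (fibre B u)"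
proof
  fix y assume "y \<in> gens"
  then obtain b j c where y: "y = bmul B (bmul B b j) (bstar B c)" "proj B b = x" "j \<in> J" "proj B c = x"
    unfolding gens_def by blast
  then show "y \<in> carr (fibre B u)" using J_proj[OF y(3)] by (simp add: proj_mul proj_star)
qed

lemma J_eq: "J = closed_span (fibre B u) gens"
proof
  show "J \<subseteq> closed_span (fibre B u) gens" using P_mem by (auto simp: at_fibre_def)
  show "closed_span (fibre B u) gens \<subseteq> J"
  proof
    fix k assume k: "k \<in> closed_span (fibre B u) gens"
    then have "proj B k = u" using closed_span_minimal[OF C.closed_subspace_carr gens_proj] by auto
    then obtain f where f: "f \<in> carr (unit_alg G B)" "f u = k" using section_through[OF u_unit] by blast
    then have "f \<in> P" using P_mem k by blast
    then show "k \<in> J" using f(2) by (auto simp: at_fibre_def)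
  qed
qed

lemma J_minimal: "\<lbrakk>closed_subspace (fibre B u) W; gens \<subseteq> W\<rbrakk> \<Longrightarrow> J \<subseteq> W"
  by (subst J_eq) (rule closed_span_minimal)

lemma J_closed: "closed_subspace (fibre B u) J"
  unfolding J_eq by (rule C.closed_span_closed_subspace[OF gens_proj])

lemma P_from_fibre: "P = from_fibre G B u J"
  using P_eq unfolding J_eq[symmetric] .

lemma gens_J: "\<lbrakk>proj B b = x; j \<in> J; proj B c = x\<rbrakk> \<Longrightarrow> bmul B (bmul B b j) (bstar B c) \<in> J"
proof -
  assume "proj B b = x" "j \<in> J" "proj B c = x"
  then have "bmul B (bmul B b j) (bstar B c) \<in> gens" unfolding gens_def by blast
  then show ?thesis using closed_span_superset[of gens "fibre B u"] by (subst J_eq) (rule subsetD)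
qed

lemma J_ideal:
  assumes a: "proj B a = u" and k: "k \<in> J"
  shows "bmul B a k \<in> J" "bmul B k a \<in> J"
proof -
  have left: "closed_subspace (fibre B u) {k \<in> carr (fibre B u). \<forall>i\<in>{a}. bmul B i k \<in> J}"
    by (rule C.closed_subspace_vimage[OF J_closed]) (use C.bounded_op_left a in simp)
  have right: "closed_subspace (fibre B u) {k \<in> carr (fibre B u). \<forall>i\<in>{a}. bmul B k i \<in> J}"
    by (rule C.closed_subspace_vimage[OF J_closed]) (use C.bounded_op_right a in simp)
  have "gens \<subseteq> {k \<in> carr (fibre B u). \<forall>i\<in>{a}. bmul B i k \<in> J}"
  proof
    fix y assume "y \<in> gens"
    then obtain b j c where y: "y = bmul B (bmul B b j) (bstar B c)" "proj B b = x" "j \<in> J" "proj B c = x"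
      unfolding gens_def by blast
    have "bmul B a y = bmul B (bmul B (bmul B a b) j) (bstar B c)"
      using a y J_proj[OF y(3)] by (simp add: bmul_assoc proj_mul proj_star)
    also have "\<dots> \<in> J" using a y by (intro gens_J) (simp_all add: proj_mul)
    finally show "y \<in> {k \<in> carr (fibre B u). \<forall>i\<in>{a}. bmul B i k \<in> J}"
      using y J_proj[OF y(3)] by (simp add: proj_mul proj_star)
  qed
  then have "J \<subseteq> {k \<in> carr (fibre B u). \<forall>i\<in>{a}. bmul B i k \<in> J}"
    by (rule J_minimal[OF left])
  then show "bmul B a k \<in> J" using k by auto
  have "gens \<subseteq> {k \<in> carr (fibre B u). \<forall>i\<in>{a}. bmul B k i \<in> J}"
  proof
    fix y assume "y \<in> gens"
    then obtain b j c where y: "y = bmul B (bmul B b j) (bstar B c)" "proj B b = x" "j \<in> J" "proj B c = x"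
      unfolding gens_def by blast
    have "bmul B y a = bmul B (bmul B b j) (bstar B (bmul B (bstar B a) c))"
      using a y J_proj[OF y(3)] by (simp add: bmul_assoc proj_mul proj_star bstar_mul bstar_bstar)
    also have "\<dots> \<in> J" using a y by (intro gens_J) (simp_all add: proj_mul proj_star)
    finally show "y \<in> {k \<in> carr (fibre B u). \<forall>i\<in>{a}. bmul B k i \<in> J}"
      using y J_proj[OF y(3)] by (simp add: proj_mul proj_star)
  qed
  then have "J \<subseteq> {k \<in> carr (fibre B u). \<forall>i\<in>{a}. bmul B k i \<in> J}"
    by (rule J_minimal[OF right])
  then show "bmul B k a \<in> J" using k by auto
qed

text \<open>The unit acts trivially because every element is a limit of products \<open>d k e\<close>.\<close>

lemma prim_act_unit: "prim_act G B u P = P"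
proof -
  define us where "us = {bmul B (bmul B b j) (bstar B c) | b j c. proj B b = u \<and> j \<in> J \<and> proj B c = u}"
  have us: "us \<subseteq> J"
  proof
    fix y assume "y \<in> us"
    then obtain b j c where y: "y = bmul B (bmul B b j) (bstar B c)" "proj B b = u" "j \<in> J" "proj B c = u"
      by (auto simp: us_def)
    show "y \<in> J" unfolding y(1) using y(2-) by (intro J_ideal) (simp_all add: proj_star)
  qed
  have us_carr: "us \<subseteq> carr (fibre B u)" using us J_proj by auto
  have "J \<subseteq> closed_span (fibre B u) us"
  proof
    fix j assume j: "j \<in> J"
    have jc: "j \<in> carr (fibre B u)" using J_proj[OF j] by simp
    show "j \<in> closed_span (fibre B u) us"
    proof (rule C.closed_subspace_approx[OF C.closed_span_closed_subspace[OF us_carr] jc])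
      fix e :: real assume e: "e > 0"
      obtain d a where da: "d \<in> carr (fibre B u)" "a \<in> carr (fibre B u)"
        and d3: "\<parallel>j \<ominus>\<^bsub>fibre B u\<^esub> d \<otimes>\<^bsub>fibre B u\<^esub> (j \<otimes>\<^bsub>fibre B u\<^esub> a)\<parallel>\<^bsub>fibre B u\<^esub> < e"
        by (rule C.two_sided_approx[OF jc e])
      have d: "proj B d = u" "proj B a = u" using da by simp_all
      have "bmul B d (bmul B j a) = bmul B (bmul B d j) (bstar B (bstar B a))"
        using d jc by (simp add: bmul_assoc bstar_bstar)
      moreover have "proj B (bstar B a) = u" using d by (simp add: proj_star)
      ultimately have "d \<otimes>\<^bsub>fibre B u\<^esub> (j \<otimes>\<^bsub>fibre B u\<^esub> a) \<in> us"
        unfolding us_def fibre_simps using d(1) j by blast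
      from subsetD[OF closed_span_superset this]
      show "\<exists>w\<in>closed_span (fibre B u) us. \<parallel>j \<ominus>\<^bsub>fibre B u\<^esub> w\<parallel>\<^bsub>fibre B u\<^esub> < e"
        by (rule bexI[rotated]) (rule d3)
    qed
  qed
  moreover have "closed_span (fibre B u) us \<subseteq> J" by (rule closed_span_minimal[OF J_closed us])
  ultimately have "closed_span (fibre B u) us = J" by (rule subset_antisym[rotated])
  moreover have "prim_act G B u P = from_fibre G B u (closed_span (fibre B u) us)"
    by (simp add: prim_act_def fibre_rieffel_def rieffel_ideal_def us_def)
  ultimately show ?thesis by (simp only: P_from_fibre[symmetric])
qed

text \<open>
  If \<open>b j c\<^sup>*\<close> lies in the ideal \<open>J = x \<cdot> J\<close> for all b, c over x, then \<open>b'\<^sup>*b j c\<^sup>*c'\<close>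
  lies in J as well, and by fullness the products \<open>b'\<^sup>*b\<close> span the fibre over u.
\<close>

lemma in_J_if_translates_in_J:
  assumes j: "proj B j = u"
    and mem: "\<And>b c. \<lbrakk>proj B b = x; proj B c = x\<rbrakk> \<Longrightarrow> bmul B (bmul B b j) (bstar B c) \<in> J"
  shows "j \<in> J"
proof -
  have compress: "bmul B (bstar B b) (bmul B k c) \<in> J" if b: "proj B b = x" and c: "proj B c = x" and k: "k \<in> J" for b c k
  proof -
    have cl: "closed_subspace (fibre B u) {k \<in> carr (fibre B u). \<forall>i\<in>{()}. bmul B (bstar B b) (bmul B k c) \<in> J}"
      by (rule C.closed_subspace_vimage[OF J_closed]) (use bounded_op_compress[OF b c] in simp)
    have "gens \<subseteq> {k \<in> carr (fibre B u). \<forall>i\<in>{()}. bmul B (bstar B b) (bmul B k c) \<in> J}"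
    proof
      fix y assume "y \<in> gens"
      then obtain b' j c' where y: "y = bmul B (bmul B b' j) (bstar B c')" "proj B b' = x" "j \<in> J" "proj B c' = x"
        unfolding gens_def by blast
      note pj = J_proj[OF y(3)]
      have "bmul B (bstar B b) (bmul B y c) = bmul B (bmul B (bstar B b) b') (bmul B j (bmul B (bstar B c') c))"
        using b c y pj by (simp add: bmul_assoc proj_mul proj_star)
      also have "\<dots> \<in> J" using b c y by (intro J_ideal) (simp_all add: proj_mul proj_star)
      finally show "y \<in> {k \<in> carr (fibre B u). \<forall>i\<in>{()}. bmul B (bstar B b) (bmul B k c) \<in> J}"
        using y pj by (simp add: proj_mul proj_star)
    qed
    then have "J \<subseteq> {k \<in> carr (fibre B u). \<forall>i\<in>{()}. bmul B (bstar B b) (bmul B k c) \<in> J}"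
      by (rule J_minimal[OF cl])
    then show ?thesis using k by auto
  qed
  define ips where "ips = {bmul B (bstar B b) b' | b b'. proj B b = x \<and> proj B b' = x}"
  have full: "closed_span (fibre B u) ips = carr (fibre B u)"
    using X.rip_full by (simp add: ips_def)
  have ips: "proj B s = u" if s: "s \<in> ips" for s
  proof -
    obtain b b' where "s = bmul B (bstar B b) b'" "proj B b = x" "proj B b' = x" using s unfolding ips_def by blast
    then show ?thesis by (simp add: proj_mul proj_star)
  qed
  have prod: "bmul B (bmul B s j) t \<in> J" if s: "s \<in> ips" and t: "t \<in> ips" for s t
  proof -
    obtain b b' where b: "s = bmul B (bstar B b) b'" "proj B b = x" "proj B b' = x" using s unfolding ips_def by blast
    obtain c c' where c: "t = bmul B (bstar B c) c'" "proj B c = x" "proj B c' = x" using t unfolding ips_def by blast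
    have "bmul B (bmul B s j) t = bmul B (bstar B b) (bmul B (bmul B (bmul B b' j) (bstar B c)) c')"
      using b c j by (simp add: bmul_assoc proj_mul proj_star)
    then show ?thesis using compress[OF b(2) c(3) mem[OF b(3) c(2)]] by simp
  qed
  have left: "bmul B (bmul B a j) t \<in> J" if a: "proj B a = u" and t: "t \<in> ips" for a t
  proof -
    have "closed_subspace (fibre B u) {a \<in> carr (fibre B u). \<forall>i\<in>{t}. bmul B (bmul B a j) i \<in> J}"
      by (rule C.closed_subspace_vimage[OF J_closed C.bounded_op_comp])
        (use C.bounded_op_right[of j] C.bounded_op_right[of t] j ips t in auto)
    moreover have "ips \<subseteq> {a \<in> carr (fibre B u). \<forall>i\<in>{t}. bmul B (bmul B a j) i \<in> J}"
      using ips prod t by auto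
    ultimately have "closed_span (fibre B u) ips \<subseteq> {a \<in> carr (fibre B u). \<forall>i\<in>{t}. bmul B (bmul B a j) i \<in> J}"
      by (rule closed_span_minimal)
    then have "a \<in> {a \<in> carr (fibre B u). \<forall>i\<in>{t}. bmul B (bmul B a j) i \<in> J}"
      unfolding full by (rule subsetD) (simp add: a)
    then show ?thesis by simp
  qed
  have both: "bmul B (bmul B a j) t \<in> J" if a: "proj B a = u" and t: "proj B t = u" for a t
  proof -
    have "closed_subspace (fibre B u) {t \<in> carr (fibre B u). \<forall>i\<in>{bmul B a j}. bmul B i t \<in> J}"
      by (rule C.closed_subspace_vimage[OF J_closed]) (use C.bounded_op_left[of "bmul B a j"] j a in \<open>simp add: proj_mul\<close>)
    moreover have "ips \<subseteq> {t \<in> carr (fibre B u). \<forall>i\<in>{bmul B a j}. bmul B i t \<in> J}"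
      using ips left a by auto
    ultimately have "closed_span (fibre B u) ips \<subseteq> {t \<in> carr (fibre B u). \<forall>i\<in>{bmul B a j}. bmul B i t \<in> J}"
      by (rule closed_span_minimal)
    then have "t \<in> {t \<in> carr (fibre B u). \<forall>i\<in>{bmul B a j}. bmul B i t \<in> J}"
      unfolding full by (rule subsetD) (simp add: t)
    then show ?thesis by simp
  qed
  have "bmul B a j \<in> J" if a: "proj B a = u" for a
    using C.in_ideal_if_right_multiples[OF J_closed, of "bmul B a j"] both a j by (simp add: proj_mul)
  then show ?thesis
    using C.in_ideal_if_left_multiples[OF J_closed, of j] j by simp
qed

end

section \<open>Homogeneity\<close>

text \<open>
  Strong continuity at the zero of the fibre makes each orbit map bounded, which is enough for
  the representation of the fibre to be contractive.
\<close>

lemma (in fell_bundle) bundle_rep_representation: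
  assumes rep: "bundle_rep B H V \<pi>" and u: "u \<in> units G" "u \<in> H"
  shows "representation (fibre B u) V \<pi>"
proof -
  interpret V: bundle_rep B H V \<pi> by (rule rep)
  interpret C: cstar_algebra "fibre B u" by (rule unit_fibre_cstar[OF u(1)])
  have V: "hilbert_space V" by (rule V.hilbert_space_axioms)
  have bop: "bounded_op V (\<pi> a)" if "proj B a = u" for a using V.bounded that u(2) by simp
  have "\<exists>M. \<forall>a\<in>carr (fibre B u). \<parallel>\<pi> a v\<parallel>\<^bsub>V\<^esub> \<le> M * \<parallel>a\<parallel>\<^bsub>fibre B u\<^esub>" if v: "v \<in> carr V" for v
  proof -
    have \<pi>0: "\<pi> (bzero B u) v = \<zero>\<^bsub>V\<^esub>"
      using V.rep_scale[of "bzero B u" v 0] u(2) v V.scale_zero[OF bounded_opD(1)[OF bop[of "bzero B u"] v]]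
      by (simp add: bscale_zero)
    have "\<forall>\<^sub>F a in at (bzero B u) within {a. proj B a \<in> H}. vdist V (\<pi> a v) (\<pi> (bzero B u) v) < 1"
      using order_tendstoD(2)[OF V.strongly_continuous[of "bzero B u" v], of 1] u(2) v by simp
    then obtain U where U: "open U" "bzero B u \<in> U"
      "\<And>a. \<lbrakk>a \<in> U; a \<noteq> bzero B u; proj B a \<in> H\<rbrakk> \<Longrightarrow> vdist V (\<pi> a v) (\<pi> (bzero B u) v) < 1"
      unfolding eventually_at_topological by auto
    obtain N \<delta> where N: "open N" "u \<in> N" "\<delta> > 0" "\<And>d. \<lbrakk>proj B d \<in> N; bnorm B d < \<delta>\<rbrakk> \<Longrightarrow> d \<in> U"
      using zero_neighbourhood[OF U(1,2)] by blast
    have small: "\<parallel>\<pi> a v\<parallel>\<^bsub>V\<^esub> \<le> 1" if a: "proj B a = u" "bnorm B a < \<delta>" for a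
    proof (cases "a = bzero B u")
      case False
      have "\<pi> a v \<in> carr V" using bounded_opD(1)[OF bop[OF a(1)] v] .
      then show ?thesis using U(3)[OF N(4)[of a] False] a N(2) u(2) \<pi>0 by (simp add: vdist_def)
    qed (simp add: \<pi>0)
    have "\<parallel>\<pi> a v\<parallel>\<^bsub>V\<^esub> \<le> (2 / \<delta>) * bnorm B a" if a: "proj B a = u" for a
    proof (cases "bnorm B a = 0")
      case True
      then have "a = bzero B u" using C.norm_eq_zero[of a] a by simp
      then show ?thesis using \<pi>0 by simp
    next
      case False
      then have n: "bnorm B a > 0" using bnorm_nonneg[of a] by linarith
      define c where "c = \<delta> / (2 * bnorm B a)"
      have c: "c > 0" using n N(3) by (simp add: c_def)
      have "bnorm B (bscale B (complex_of_real c) a) < \<delta>"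
        using c n N(3) by (simp add: bnorm_scale) (simp add: c_def)
      then have "\<parallel>\<pi> (bscale B (complex_of_real c) a) v\<parallel>\<^bsub>V\<^esub> \<le> 1" using small[of "bscale B (complex_of_real c) a"] a by simp
      then have "c * \<parallel>\<pi> a v\<parallel>\<^bsub>V\<^esub> \<le> 1"
        using V.rep_scale[of a v "complex_of_real c"] a u(2) v c V.norm_scale[OF bounded_opD(1)[OF bop[OF a] v]] by simp
      then show ?thesis using c n N(3) by (simp add: c_def field_simps)
    qed
    then show ?thesis by (intro exI[of _ "2 / \<delta>"]) simp
  qed
  note bounded = this
  have contractive: "\<parallel>\<pi> a v\<parallel>\<^bsub>V\<^esub> \<le> \<parallel>a\<parallel>\<^bsub>fibre B u\<^esub> * \<parallel>v\<parallel>\<^bsub>V\<^esub>" if "a \<in> carr (fibre B u)" "v \<in> carr V" for a v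
  proof (rule C.representation_contractive[OF V _ _ _ bounded that])
    show "\<pi> a x \<in> carr V" if "a \<in> carr (fibre B u)" "x \<in> carr V" for a x
      using bounded_opD(1)[OF bop] that by simp
    show "\<pi> (a \<otimes>\<^bsub>fibre B u\<^esub> b) x = \<pi> a (\<pi> b x)"
      if "a \<in> carr (fibre B u)" "b \<in> carr (fibre B u)" "x \<in> carr V" for a b x
      using V.rep_mul[of a b x] that u(2) by simp
    show "vinner V (\<pi> a x) y = vinner V x (\<pi> (astar (fibre B u) a) y)"
      if "a \<in> carr (fibre B u)" "x \<in> carr V" "y \<in> carr V" for a x y
      using V.rep_star[of a x y] that u(2) by simp
  qed
  show ?thesis
    unfolding representation_def
  proof (intro conjI ballI allI)
    fix a assume a: "a \<in> carr (fibre B u)"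
    show "op_norm V (\<pi> a) \<le> \<parallel>a\<parallel>\<^bsub>fibre B u\<^esub>" by (rule V.op_norm_le[OF contractive[OF a]]) (use a in auto)
  qed (use V bop V.rep_add V.rep_scale V.rep_mul V.rep_star u(2) in auto)
qed

theorem proposition5p1:
  fixes G :: "'g::{t2_space, second_countable_topology} grpd"
    and \<mu> :: "'g \<Rightarrow> 'g measure"
    and B :: "('g, 'b::topological_space) banach_bundle"
    and P :: "('g \<Rightarrow> 'b) set"
    and u :: 'g
    and G\<^sub>P :: "'g set"
    and \<nu> :: "'g measure"
    and \<Delta> :: "'g \<Rightarrow> real"
    and V :: "'v ispace"
    and \<pi> :: "'b \<Rightarrow> 'v \<Rightarrow> 'v"
    and L :: "(nat \<Rightarrow> 'g \<Rightarrow> 'b) set \<Rightarrow> 'v \<Rightarrow> 'v"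
  assumes "lc_groupoid G"
    and "haar_system G \<mu>"
    and "fell_bundle G B"
    and "separable_bundle B"
    and "P \<in> Prim (unit_alg G B)"
    and "locally_closed_point (hull_kernel (unit_alg G B)) P"
    and "u = sigma G B P"
    and "G\<^sub>P = stability_group G B P"
    and "haar_measure G G\<^sub>P \<nu>"
    and "modular_function G G\<^sub>P \<nu> \<Delta>"
    and "irreducible_rep (group_cstar G B G\<^sub>P \<nu>) V L"
    and "bundle_rep B G\<^sub>P V \<pi>"
    and "integrated_form G B G\<^sub>P \<nu> \<Delta> V \<pi> L"
    and "rep_kernel (fibre B u) V \<pi> = at_fibre u P"
  shows "homogeneous_rep (fibre B u) V \<pi>"
proof -
  interpret F: fell_bundle G B by (rule assms(3))
  interpret V: bundle_rep B G\<^sub>P V \<pi> by (rule assms(12))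
  interpret H: haar_measure G G\<^sub>P \<nu> by (rule assms(9))
  have sp: "space \<nu> = G\<^sub>P"
    using sets_eq_imp_space_eq[OF H.sets_borel] by (simp add: space_restrict_space)
  have stab: "x \<in> G\<^sub>P \<longleftrightarrow> rng G x = u \<and> src G x = u \<and> prim_act G B x P = P" for x
    using assms(7,8) by (simp add: stability_group_def)
  have fixing: "fixing_arrow G B u x P" if "x \<in> G\<^sub>P" for x
    by unfold_locales (use that stab in auto)
  \<comment> \<open>The stability group is nonempty as it carries a nonzero measure; any arrow in it shows that
    u is a unit and that P is induced from the fibre over u.\<close>
  have "G\<^sub>P \<noteq> {}" using H.nonzero by auto
  then obtain x0 where "x0 \<in> G\<^sub>P" by blast
  then interpret X0: fixing_arrow G B u x0 P by (rule fixing)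
  have uH: "u \<in> G\<^sub>P" using stab X0.prim_act_unit by simp
  have rep: "representation (fibre B u) V \<pi>"
    by (rule F.bundle_rep_representation[OF assms(12) X0.u_unit uH])
  note R = representationD[OF rep, simplified]
  define J where "J = at_fibre u P"
  have J: "J = rep_kernel (fibre B u) V \<pi>" using assms(14) by (simp add: J_def)
  have P: "P = from_fibre G B u (rep_kernel (fibre B u) V \<pi>)"
    using X0.P_from_fibre assms(14) by simp
  have J_iff: "a \<in> J \<longleftrightarrow> proj B a = u \<and> (\<forall>v\<in>carr V. \<pi> a v = \<zero>\<^bsub>V\<^esub>)" for a
    by (simp add: J kernel_on_def)
  obtain g where g: "g \<in> carr (unit_alg G B)" "g \<notin> P"
    "\<And>Q. \<lbrakk>Q \<in> Prim (unit_alg G B); P \<subseteq> Q; P \<noteq> Q\<rbrakk> \<Longrightarrow> g \<in> Q"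
    using locally_closed_witness[OF assms(5,6)] by metis
  define j where "j = g u"
  have pj: "proj B j = u" using g(1) X0.u_unit by (simp add: j_def continuous_sections_def)
  have jJ: "j \<notin> J" using g(1,2) P unfolding J j_def from_fibre_def by blast
  have witness: "\<pi> j w = \<zero>\<^bsub>V\<^esub>"
    if W: "invariant_subspace (fibre B u) V \<pi> W" "kernel_on (fibre B u) V \<pi> W \<noteq> J" "w \<in> W" for W w
    using F.kernel_contains_witness[OF X0.u_unit rep W(1) P g(1,3)] W(2,3) unfolding J j_def
    by (simp add: kernel_on_def)
  have bop: "bounded_op V (\<pi> b)" if "proj B b \<in> G\<^sub>P" for b using V.bounded that .
  define V0 where "V0 = {v \<in> carr V. \<forall>a\<in>{a. proj B a = u}. \<pi> j (\<pi> a v) = \<zero>\<^bsub>V\<^esub>}"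
  have V0_closed: "closed_subspace V V0"
    unfolding V0_def
    by (rule V.closed_subspace_annihilator, rule V.bounded_op_comp) (use R(2) pj in auto)
  have V0_V: "v \<in> carr V" if "v \<in> V0" for v using that by (simp add: V0_def)
  have V0_zero: "\<pi> j (\<pi> a v) = \<zero>\<^bsub>V\<^esub>" if "v \<in> V0" "proj B a = u" for a v using that by (simp add: V0_def)
  have V0_inv: "\<pi> b v \<in> V0" if b: "proj B b \<in> G\<^sub>P" and v: "v \<in> V0" for b v
  proof -
    define x where "x = proj B b"
    have xH: "x \<in> G\<^sub>P" using b by (simp add: x_def)
    interpret X: fixing_arrow G B u x P by (rule fixing[OF xH])
    define S where "S = {\<pi> c w | c w. proj B c = x \<and> w \<in> V0}"
    have SV: "S \<subseteq> carr V" unfolding S_def using bounded_opD(1)[OF bop] xH V0_V by auto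
    define W where "W = closed_span V S"
    have W_closed: "closed_subspace V W" unfolding W_def by (rule V.closed_span_closed_subspace[OF SV])
    have "W \<subseteq> {w \<in> carr V. \<forall>a\<in>{a. proj B a = u}. \<pi> a w \<in> W}"
      unfolding W_def
    proof (rule closed_span_minimal)
      show "closed_subspace V {w \<in> carr V. \<forall>a\<in>{a. proj B a = u}. \<pi> a w \<in> closed_span V S}"
        using R(2) W_closed unfolding W_def by (intro V.closed_subspace_vimage) auto
      show "S \<subseteq> {w \<in> carr V. \<forall>a\<in>{a. proj B a = u}. \<pi> a w \<in> closed_span V S}"
      proof
        fix y assume y: "y \<in> S"
        then obtain c w where c: "y = \<pi> c w" "proj B c = x" "w \<in> V0" unfolding S_def by blast
        have "\<pi> a y \<in> S" if a: "proj B a = u" for a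
        proof -
          have "\<pi> a y = \<pi> (bmul B a c) w"
            using V.rep_mul[of a c w] a c xH uH V0_V by simp
          moreover have "proj B (bmul B a c) = x" using a c(2) by (simp add: F.proj_mul)
          ultimately show ?thesis unfolding S_def using c(3) by blast
        qed
        then show "y \<in> {w \<in> carr V. \<forall>a\<in>{a. proj B a = u}. \<pi> a w \<in> closed_span V S}"
          using subsetD[OF closed_span_superset, of _ S V] SV y by blast
      qed
    qed
    then have W: "invariant_subspace (fibre B u) V \<pi> W"
      using W_closed by (auto simp: invariant_subspace_def)
    \<comment> \<open>If the kernel on W were J, then \<open>b j c\<^sup>*\<close> would lie in J for all b, c over x.\<close>
    have "kernel_on (fibre B u) V \<pi> W \<noteq> J"
    proof
      assume ker: "kernel_on (fibre B u) V \<pi> W = J"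
      have "j \<in> at_fibre u P"
      proof (rule X.in_J_if_translates_in_J[OF pj])
        fix c d assume c: "proj B c = x" and d: "proj B d = x"
        define y where "y = bmul B (bmul B c j) (bstar B d)"
        have py: "proj B y = u" using c d pj by (simp add: y_def F.proj_mul F.proj_star)
        have "W \<subseteq> {w \<in> carr V. \<forall>i\<in>{y}. \<pi> i w = \<zero>\<^bsub>V\<^esub>}"
          unfolding W_def
        proof (rule closed_span_minimal)
          show "closed_subspace V {w \<in> carr V. \<forall>i\<in>{y}. \<pi> i w = \<zero>\<^bsub>V\<^esub>}"
            by (rule V.closed_subspace_annihilator) (use R(2) py in simp)
          show "S \<subseteq> {w \<in> carr V. \<forall>i\<in>{y}. \<pi> i w = \<zero>\<^bsub>V\<^esub>}"
          proof
            fix z assume z: "z \<in> S"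
            then obtain e w where e: "z = \<pi> e w" "proj B e = x" "w \<in> V0" unfolding S_def by blast
            note wV = V0_V[OF e(3)]
            define a where "a = bmul B (bstar B d) e"
            have pa: "proj B a = u" using d e(2) by (simp add: a_def F.proj_mul F.proj_star)
            have "\<pi> y z = \<pi> (bmul B y e) w" using V.rep_mul[of y e w] py e xH uH wV by simp
            also have "bmul B y e = bmul B c (bmul B j a)"
              using c d e(2) pj by (simp add: y_def a_def F.bmul_assoc F.proj_mul F.proj_star)
            also have "\<pi> (bmul B c (bmul B j a)) w = \<pi> c (\<pi> j (\<pi> a w))"
              using V.rep_mul[of c "bmul B j a" w] V.rep_mul[of j a w] c pj pa xH uH wV by (simp add: F.proj_mul)
            also have "\<dots> = \<zero>\<^bsub>V\<^esub>" using V0_zero[OF e(3) pa] V.bounded_op_zero[OF bop[of c]] c xH by simp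
            finally show "z \<in> {w \<in> carr V. \<forall>i\<in>{y}. \<pi> i w = \<zero>\<^bsub>V\<^esub>}" using z SV by auto
          qed
        qed
        then have "y \<in> kernel_on (fibre B u) V \<pi> W" using py by (auto simp: kernel_on_def)
        then show "bmul B (bmul B c j) (bstar B d) \<in> at_fibre u P" using ker by (simp add: y_def J_def)
      qed
      then show False using jJ by (simp add: J_def)
    qed
    then have zero: "\<pi> j w = \<zero>\<^bsub>V\<^esub>" if "w \<in> W" for w using witness[OF W _ that] by blast
    have "\<pi> j (\<pi> a (\<pi> b v)) = \<zero>\<^bsub>V\<^esub>" if a: "proj B a = u" for a
    proof -
      have "\<pi> b v \<in> W" unfolding W_def using closed_span_superset[of S V] v by (auto simp: S_def x_def)
      then have "\<pi> a (\<pi> b v) \<in> W" using W a by (simp add: invariant_subspace_def)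
      then show ?thesis by (rule zero)
    qed
    then show ?thesis using bounded_opD(1)[OF bop[OF b] V0_V[OF v]] by (simp add: V0_def)
  qed
  have irr: "representation (group_cstar G B G\<^sub>P \<nu>) V L"
    "\<And>W. invariant_subspace (group_cstar G B G\<^sub>P \<nu>) V L W \<Longrightarrow> W = {\<zero>\<^bsub>V\<^esub>} \<or> W = carr V"
    using assms(11) by (auto simp: irreducible_rep_def)
  have V0_cases: "V0 = {\<zero>\<^bsub>V\<^esub>} \<or> V0 = carr V"
    using irr(2) F.integrated_form_invariant[OF irr(1) assms(13) sp V0_closed V0_inv] by blast
  have "V0 \<noteq> carr V"
  proof
    assume all: "V0 = carr V"
    have "j \<in> at_fibre u P"
    proof (rule X0.C.in_ideal_if_right_multiples[OF X0.J_closed])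
      show "j \<in> carr (fibre B u)" using pj by simp
      fix a assume a: "a \<in> carr (fibre B u)"
      then have "bmul B j a \<in> J"
        using V0_zero all V.rep_mul[of j a] pj uH by (simp add: J_iff F.proj_mul)
      then show "j \<otimes>\<^bsub>fibre B u\<^esub> a \<in> at_fibre u P" by (simp add: J_def)
    qed
    then show False using jJ by (simp add: J_def)
  qed
  then have V0: "V0 = {\<zero>\<^bsub>V\<^esub>}" using V0_cases by blast
  have "kernel_on (fibre B u) V \<pi> W = rep_kernel (fibre B u) V \<pi>"
    if W: "invariant_subspace (fibre B u) V \<pi> W" and W0: "W \<noteq> {\<zero>\<^bsub>V\<^esub>}" for W
  proof (rule ccontr)
    assume "kernel_on (fibre B u) V \<pi> W \<noteq> rep_kernel (fibre B u) V \<pi>"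
    then have zero: "\<pi> j w = \<zero>\<^bsub>V\<^esub>" if "w \<in> W" for w using witness[OF W _ that] J by blast
    have WV: "W \<subseteq> carr V" "\<zero>\<^bsub>V\<^esub> \<in> W" "\<And>a w. \<lbrakk>proj B a = u; w \<in> W\<rbrakk> \<Longrightarrow> \<pi> a w \<in> W"
      using W by (auto simp: invariant_subspace_def closed_subspace_def)
    have "W \<subseteq> V0" using WV(1,3) zero unfolding V0_def by blast
    then show False using V0 W0 WV(2) by blast
  qed
  then show ?thesis using rep by (simp add: homogeneous_rep_def)
qed

end
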